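(* Let $w$ be a finite prime of $F$, $K$ the completion at $w$, and $\phi$ a rank 2 Drinfeld $A$-module over $K$ with $\phi_t(X)=tX+a_1X^q+a_2X^{q^2}$ having bad reduction over $K$ (so $w(\mathbf{j})<0$ for $\mathbf{j}=a_1^{q+1}/a_2$), and assume $p\nmid w(\mathbf{j})$. Let $(\psi,\Lambda,e_\phi)$ be its Tate uniformization, $u$ a finite prime of $A$ of degree $d$ not divisible by $w$, $n$ a positive integer, $\{\omega_2^0\}$ an SMB of $\Lambda$ (i.e. a nonzero element of $\Lambda$ of minimal $|\cdot|$), and $\omega_2$ a root of $\psi_{u^n}(X)-\omega_2^0$. Let $L=K(\Lambda)$, $L_n=L(u^{-n}\Lambda)$, $L(\psi[u^n])$ the extension of $L$ generated by $\psi[u^n]$, and $R=-w(\omega_2^0)=\frac{-w(\mathbf{j})}{q-1}$. Then: (1) the map $\mathrm{Gal}(L_n/L(\psi[u^n]))\to\psi[u^n]$, $\sigma\mapsto\sigma(\omega_2)-\omega_2$, is an isomorphism; (2) if $E$ is the ramification index of $L/K$, the Herbrand $\psi$-function of $L_n/K$ is $$\psi_{L_n/K}(y)=\begin{cases}y,&-1\le y\le0,\\ Ey,&0\le y\le R,\\ q^{nd}Ey-(q^{nd}-1)ER,&R\le y.\end{cases}$$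
   Context: $q$ a power of a prime $p$, $A=\mathbb{F}_q[t]$, $F$ a finite extension of $\mathbb{F}_q(t)$; a finite prime of $F$ does not lie over $1/t$. $K$ the completion at $w$, normalized valuation $w$ extended to $K^{\mathrm{sep}}$ and $\mathbb{C}_w$. Bad reduction means: $a_1,a_2$ integral, $w(a_1)=0$, $w(a_2)>0$ (stable reduction with reduction of rank 1). Tate uniformization: a rank 1 Drinfeld module $\psi$ over $K$ with good reduction ($\psi_t(X)=tX+b_1X^q$, $b_1$ a unit), a Galois-stable rank 1 $A$-lattice $\Lambda\subset\mathbb{C}_w$ under $a\cdot_\psi z=\psi_a(z)$, nonzero elements of negative valuation, and $e_\phi(z)=z\prod_{\mu\in\Lambda\setminus\{0\}}(1-z/\mu)$ surjective with kernel $\Lambda$ and $e_\phi(\psi_a(z))=\phi_a(e_\phi(z))$. $u^{-n}\Lambda$ is the set of roots of $\psi_{u^n}(X)-\omega$ for all $\omega\in\Lambda$; $\psi[u^n]$ the roots of $\psi_{u^n}(X)$. $|x|=-w(x)$ if $w(x)<0$, $-w(x)$ if $w(x)\ge0$ (here $r'=1$). For a finite Galois extension $M/K$ with upper ramification groups $G^y$, $\psi_{M/K}(y)=\int_0^y\#G^0/\#G^s\,ds$ for $y\ge0$ and $\psi_{M/K}(y)=y$ for $-1\le y\le0$. *)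

theory Defs
  imports "HOL-Analysis.Analysis" "HOL-Algebra.Bij" "HOL-Algebra.Generated_Fields" "HOL-Algebra.Algebraic_Closure_Type"
begin

text \<open>
  All fields live inside one field type \<open>'c\<close>, the field \<open>\<complex>\<^sub>w\<close>. Subfields are subsets of \<open>'c\<close>,
  viewed through the ring record of the whole type, so that the notions of HOL-Algebra apply.
  Valuations are additive, with values in the extended reals and \<open>w 0 = \<infinity>\<close>.
\<close>

abbreviation ambient :: "'c::field ring"
  where "ambient \<equiv> ring_of_type_algebra"

abbreviation field_adjoin :: "'c::field set \<Rightarrow> 'c set \<Rightarrow> 'c set"
  where "field_adjoin K S \<equiv> generate_field ambient (K \<union> S)"

definition additive_group :: "'a::ab_group_add set \<Rightarrow> 'a monoid"
  where "additive_group S = \<lparr>carrier = S, monoid.mult = (+), one = 0\<rparr>"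


section \<open>Valuations, completions, ramification index\<close>

definition valuation :: "('c::field \<Rightarrow> ereal) \<Rightarrow> bool"
  where "valuation w \<longleftrightarrow>
    (\<forall>x. w x = \<infinity> \<longleftrightarrow> x = 0) \<and> (\<forall>x. w x \<noteq> -\<infinity>) \<and>
    (\<forall>x y. w (x * y) = w x + w y) \<and> (\<forall>x y. min (w x) (w y) \<le> w (x + y))"

definition val_dense_in :: "('c::field \<Rightarrow> ereal) \<Rightarrow> 'c set \<Rightarrow> 'c set \<Rightarrow> bool"
  where "val_dense_in w S T \<longleftrightarrow> S \<subseteq> T \<and> (\<forall>x\<in>T. \<forall>r::real. \<exists>y\<in>S. ereal r < w (x - y))"

definition val_complete :: "('c::field \<Rightarrow> ereal) \<Rightarrow> 'c set \<Rightarrow> bool"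
  where "val_complete w S \<longleftrightarrow>
    (\<forall>s::nat \<Rightarrow> 'c. (\<forall>n. s n \<in> S) \<and>
        (\<forall>r::real. \<exists>N. \<forall>m\<ge>N. \<forall>n\<ge>N. ereal r < w (s m - s n)) \<longrightarrow>
        (\<exists>x\<in>S. (\<lambda>n. w (s n - x)) \<longlonglongrightarrow> \<infinity>))"

definition is_completion :: "('c::field \<Rightarrow> ereal) \<Rightarrow> 'c set \<Rightarrow> 'c set \<Rightarrow> bool"
  where "is_completion w F K \<longleftrightarrow>
    subfield K ambient \<and> val_dense_in w F K \<and> val_complete w K"

text \<open>
  The whole type is the completion of an algebraic closure of \<open>K\<close>. As \<open>'c\<close> is algebraically
  closed, the elements algebraic over \<open>K\<close> form an algebraic closure of \<open>K\<close>.
\<close>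

definition completed_algebraic_closure :: "('c::alg_closed_field \<Rightarrow> ereal) \<Rightarrow> 'c set \<Rightarrow> bool"
  where "completed_algebraic_closure w K \<longleftrightarrow>
    val_dense_in w {x. (ring.algebraic ambient over K) x} UNIV \<and> val_complete w UNIV"

definition value_group :: "('c::field \<Rightarrow> ereal) \<Rightarrow> 'c set \<Rightarrow> real set"
  where "value_group w M = {r. \<exists>x\<in>M. x \<noteq> 0 \<and> w x = ereal r}"

definition ram_index :: "('c::field \<Rightarrow> ereal) \<Rightarrow> 'c set \<Rightarrow> 'c set \<Rightarrow> nat"
  where "ram_index w K M =
    card (rcosets\<^bsub>additive_group (value_group w M)\<^esub> (value_group w K))"

text \<open>
  \<open>\<iota>\<close> is the inclusion of \<open>\<F>\<^sub>q(t)\<close>; the place \<open>w\<close> is given by its normalized valuation. It lies over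
  \<open>1/t\<close> iff \<open>w(t) < 0\<close>.
\<close>

definition poly_emb :: "('q::field poly fract \<Rightarrow> 'c) \<Rightarrow> 'q poly \<Rightarrow> 'c"
  where "poly_emb \<iota> a = \<iota> (Fraction_Field.Fract a 1)"

definition finite_ext_of_rational_functions ::
    "('q::{field,finite} poly fract \<Rightarrow> 'c::field) \<Rightarrow> 'c set \<Rightarrow> bool"
  where "finite_ext_of_rational_functions \<iota> F \<longleftrightarrow>
    \<iota> \<in> ring_hom ambient ambient \<and> subfield F ambient \<and> range \<iota> \<subseteq> F \<and>
    ring.finite_dimension ambient (range \<iota>) F"

definition finite_prime ::
    "('q::{field,finite} poly fract \<Rightarrow> 'c::field) \<Rightarrow> 'c set \<Rightarrow> ('c \<Rightarrow> ereal) \<Rightarrow> bool"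
  where "finite_prime \<iota> F w \<longleftrightarrow>
    w ` (F - {0}) = range (\<lambda>k::int. ereal (of_int k)) \<and> 0 \<le> w (poly_emb \<iota> [:0, 1:])"


section \<open>Galois groups, ramification groups, Herbrand functions\<close>

definition galois_group :: "'c::field set \<Rightarrow> 'c set \<Rightarrow> ('c \<Rightarrow> 'c) monoid"
  where "galois_group M K = BijGroup M
    \<lparr>carrier := {\<sigma> \<in> Bij M. \<sigma> \<in> ring_iso (ambient\<lparr>carrier := M\<rparr>) (ambient\<lparr>carrier := M\<rparr>) \<and>
                        (\<forall>x\<in>K. \<sigma> x = x)}\<rparr>"

definition finite_galois :: "'c::field set \<Rightarrow> 'c set \<Rightarrow> bool"
  where "finite_galois M K \<longleftrightarrow>
    subfield K ambient \<and> subfield M ambient \<and> K \<subseteq> M \<and> ring.finite_dimension ambient K M \<and>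
    {x \<in> M. \<forall>\<sigma>\<in>carrier (galois_group M K). \<sigma> x = x} = K"

text \<open>
  Lower numbering with real index: \<open>G\<^sub>s = G\<^bsub>\<lceil>s\<rceil>\<^esub>\<close>. If \<open>w\<close> is normalized on \<open>K\<close>, the normalized
  valuation of \<open>M\<close> is \<open>e(M/K) \<cdot> w\<close>.
\<close>

definition lower_ram_group :: "('c::field \<Rightarrow> ereal) \<Rightarrow> 'c set \<Rightarrow> 'c set \<Rightarrow> real \<Rightarrow> ('c \<Rightarrow> 'c) set"
  where "lower_ram_group w M K s =
    {\<sigma> \<in> carrier (galois_group M K). \<forall>x\<in>M. 0 \<le> w x \<longrightarrow>
       ereal (of_int \<lceil>s\<rceil> + 1) \<le> ereal (real (ram_index w K M)) * w (\<sigma> x - x)}"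

definition herbrand_phi :: "('c::field \<Rightarrow> ereal) \<Rightarrow> 'c set \<Rightarrow> 'c set \<Rightarrow> real \<Rightarrow> real"
  where "herbrand_phi w M K x =
    (if x \<le> 0 then x
     else integral {0..x} (\<lambda>s. real (card (lower_ram_group w M K s)) /
                               real (card (lower_ram_group w M K 0))))"

text \<open>Upper numbering: \<open>G\<^sup>y = G\<^sub>x\<close> where \<open>y = \<phi>(x)\<close>, for \<open>y \<ge> -1\<close>.\<close>

definition upper_ram_group :: "('c::field \<Rightarrow> ereal) \<Rightarrow> 'c set \<Rightarrow> 'c set \<Rightarrow> real \<Rightarrow> ('c \<Rightarrow> 'c) set"
  where "upper_ram_group w M K y =
    lower_ram_group w M K (the_inv_into {-1..} (herbrand_phi w M K) y)"

definition herbrand_psi :: "('c::field \<Rightarrow> ereal) \<Rightarrow> 'c set \<Rightarrow> 'c set \<Rightarrow> real \<Rightarrow> real"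
  where "herbrand_psi w M K y =
    (if y \<le> 0 then y
     else integral {0..y} (\<lambda>s. real (card (upper_ram_group w M K 0)) /
                               real (card (upper_ram_group w M K s))))"


section \<open>Drinfeld modules over \<open>\<F>\<^sub>q[t]\<close> and Tate uniformization\<close>

text \<open>
  \<open>K{\<tau>}\<close>, realised as the \<open>q\<close>-polynomials over \<open>K\<close>; its multiplication is composition.
\<close>

definition q_polys :: "nat \<Rightarrow> 'c::field set \<Rightarrow> 'c poly set"
  where "q_polys q K =
    {f. \<forall>i. Polynomial.coeff f i \<in> K \<and> (Polynomial.coeff f i \<noteq> 0 \<longrightarrow> (\<exists>k. i = q ^ k))}"

text \<open>
  \<open>\<gamma>\<close> is the structure map \<open>A \<rightarrow> K\<close>. The conditions imply \<open>\<phi>\<^sub>c(X) = \<gamma>(c) X\<close> for constants \<open>c\<close>.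
\<close>

definition drinfeld_module ::
    "('q::{field,finite} poly \<Rightarrow> 'c::field) \<Rightarrow> 'c set \<Rightarrow> nat \<Rightarrow> ('q poly \<Rightarrow> 'c poly) \<Rightarrow> bool"
  where "drinfeld_module \<gamma> K r \<phi> \<longleftrightarrow> 0 < r \<and>
    (\<forall>a. \<phi> a \<in> q_polys CARD('q) K) \<and>
    (\<forall>a b. \<phi> (a + b) = \<phi> a + \<phi> b) \<and>
    (\<forall>a b. \<phi> (a * b) = pcompose (\<phi> a) (\<phi> b)) \<and>
    (\<forall>a. Polynomial.coeff (\<phi> a) 1 = \<gamma> a) \<and>
    (\<forall>a. a \<noteq> 0 \<longrightarrow> Polynomial.degree (\<phi> a) = CARD('q) ^ (r * Polynomial.degree a))"

text \<open>
  For the rank 2 module with \<open>\<phi>\<^sub>t(X) = tX + a\<^sub>1X\<^sup>q + a\<^sub>2X^(q^2)\<close>: stable reduction, the reduction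
  having rank 1.
\<close>

definition bad_reduction :: "('c::field \<Rightarrow> ereal) \<Rightarrow> 'c \<Rightarrow> 'c \<Rightarrow> bool"
  where "bad_reduction w a1 a2 \<longleftrightarrow> 0 \<le> w a1 \<and> 0 \<le> w a2 \<and> w a1 = 0 \<and> 0 < w a2"

text \<open>
  The \<open>A\<close>-module structure is \<open>a \<cdot> z = \<psi>\<^sub>a(z)\<close>. As \<open>A\<close> is a principal ideal domain, the
  finitely generated projective modules of rank 1 are the free ones on one generator.
\<close>

definition rank1_lattice ::
    "('c::field \<Rightarrow> ereal) \<Rightarrow> ('q::field poly \<Rightarrow> 'c poly) \<Rightarrow> 'c set \<Rightarrow> bool"
  where "rank1_lattice w \<psi> \<Lambda> \<longleftrightarrow>
    (\<exists>\<mu>. inj (\<lambda>a. poly (\<psi> a) \<mu>) \<and> \<Lambda> = range (\<lambda>a. poly (\<psi> a) \<mu>)) \<and>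
    (\<forall>r::real. finite {z \<in> \<Lambda>. ereal r \<le> w z})"

text \<open>
  \<open>Gal(K\<^sup>s\<^sup>e\<^sup>p/K)\<close> acts on \<open>\<complex>\<^sub>w\<close> by continuity; the maps obtained are the isometric field
  automorphisms of \<open>\<complex>\<^sub>w\<close> over \<open>K\<close>.
\<close>

definition galois_stable :: "('c::field \<Rightarrow> ereal) \<Rightarrow> 'c set \<Rightarrow> 'c set \<Rightarrow> bool"
  where "galois_stable w K \<Lambda> \<longleftrightarrow>
    (\<forall>\<sigma>. \<sigma> \<in> ring_iso ambient ambient \<and> (\<forall>x\<in>K. \<sigma> x = x) \<and> (\<forall>x. w (\<sigma> x) = w x) \<longrightarrow> \<sigma> ` \<Lambda> \<subseteq> \<Lambda>)"

text \<open>The infinite product is the limit of the net of finite partial products.\<close>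

definition lattice_exponential ::
    "('c::field \<Rightarrow> ereal) \<Rightarrow> 'c set \<Rightarrow> ('c \<Rightarrow> 'c) \<Rightarrow> bool"
  where "lattice_exponential w \<Lambda> e \<longleftrightarrow>
    (\<forall>z. ((\<lambda>S. w (z * (\<Prod>\<mu>\<in>S. 1 - z / \<mu>) - e z)) \<longlongrightarrow> \<infinity>) (finite_subsets_at_top (\<Lambda> - {0})))"

definition tate_uniformization ::
    "('c::field \<Rightarrow> ereal) \<Rightarrow> ('q::{field,finite} poly \<Rightarrow> 'c) \<Rightarrow> 'c set \<Rightarrow> ('q poly \<Rightarrow> 'c poly) \<Rightarrow>
     ('q poly \<Rightarrow> 'c poly) \<Rightarrow> 'c set \<Rightarrow> ('c \<Rightarrow> 'c) \<Rightarrow> bool"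
  where "tate_uniformization w \<gamma> K \<phi> \<psi> \<Lambda> e \<longleftrightarrow>
    drinfeld_module \<gamma> K 1 \<psi> \<and>
    (\<exists>b1. \<psi> [:0, 1:] = Polynomial.monom (\<gamma> [:0, 1:]) 1 + Polynomial.monom b1 CARD('q) \<and> w b1 = 0) \<and>
    rank1_lattice w \<psi> \<Lambda> \<and> galois_stable w K \<Lambda> \<and> (\<forall>\<mu>\<in>\<Lambda> - {0}. w \<mu> < 0) \<and>
    lattice_exponential w \<Lambda> e \<and> surj e \<and> {z. e z = 0} = \<Lambda> \<and>
    (\<forall>a z. e (poly (\<psi> a) z) = poly (\<phi> a) (e z))"

definition torsion :: "('q \<Rightarrow> 'c::field poly) \<Rightarrow> 'q \<Rightarrow> 'c set"
  where "torsion \<psi> a = {z. poly (\<psi> a) z = 0}"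

definition division_lattice :: "('q \<Rightarrow> 'c::field poly) \<Rightarrow> 'q \<Rightarrow> 'c set \<Rightarrow> 'c set"
  where "division_lattice \<psi> a \<Lambda> = {z. \<exists>\<omega>\<in>\<Lambda>. poly (\<psi> a - [:\<omega>:]) z = 0}"

text \<open>
  The size of \<open>x\<close> is \<open>|x| = -w(x)\<close>. For a lattice of rank 1, a successive minimum basis is one
  nonzero element of minimal size.
\<close>

definition is_smb :: "('c::field \<Rightarrow> ereal) \<Rightarrow> 'c set \<Rightarrow> 'c \<Rightarrow> bool"
  where "is_smb w \<Lambda> \<omega> \<longleftrightarrow> \<omega> \<in> \<Lambda> - {0} \<and> (\<forall>\<mu>\<in>\<Lambda> - {0}. - w \<omega> \<le> - w \<mu>)"

end

theory Submission
  imports Defs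
begin

text \<open>
  The exponential \<open>e\<close> is a power series over \<open>K\<close>: the equation \<open>e(\<psi>\<^sub>t(z)) = \<phi>\<^sub>t(e(z))\<close> determines
  its coefficients recursively, because \<open>t\<close> is transcendental. By Newton's identities the sums
  of the \<open>1/\<mu>\<^sup>k\<close> over the nonzero lattice points lie in \<open>K\<close>, and as a minimal vector \<open>s\<close> dominates
  them, \<open>s\<^bsup>q-1\<^esup> \<in> K\<close>. Hence \<open>L = K(s)\<close> is a Kummer extension, and with \<open>U = u\<^sup>n\<close> the division field
  \<open>L\<^sub>n\<close> is the splitting field over \<open>K\<close> of the separable polynomial \<open>\<psi>\<^sub>U(X)\<^bsup>q-1\<^esup> - s\<^bsup>q-1\<^esup>\<close>. Comparing
  valuations in the functional equation at a single point gives \<open>w(a\<^sub>2) = (q - 1) R\<close>, so \<open>p\<close> does not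
  divide the integer \<open>E R\<close>.

  The field \<open>M\<^sub>0\<close> generated over \<open>K\<close> by \<open>\<psi>[U]\<close> and \<open>s\<^sup>E\<close> is unramified, and \<open>L\<^sub>n = M\<^sub>0(\<omega>)\<close> for a root \<open>\<omega>\<close>
  of \<open>\<psi>\<^sub>U(X) - s\<close>. The powers \<open>\<omega>\<^sup>i\<close> with \<open>i < E q\<^bsup>nd\<^esup>\<close> have valuations that are distinct modulo \<open>\<int>\<close>. So the
  valuation of a combination of these powers is the minimum over its terms, the equation
  \<open>\<psi>\<^sub>U(X)\<^sup>E = s\<^sup>E\<close> of \<open>\<omega>\<close> over \<open>M\<^sub>0\<close> is irreducible, and the ramification number of an inertial
  automorphism \<open>\<sigma>\<close> is read off from \<open>w(\<sigma>\<omega>/\<omega> - 1)\<close> with \<open>\<sigma>\<omega> = c \<omega> + \<zeta>\<close>, where \<open>c\<close> is a constant and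
  \<open>\<zeta>\<close> a torsion point.
\<close>

section \<open>Subfields and polynomials over them\<close>

text \<open>The exponential is given only as a pointwise limit over finite subsets of the lattice,
  so identities between its coefficients must be recovered from estimates on the unit disc. The
  field \<open>M0\<close> is unramified because conjugates of its generators move by units: a
  difference of torsion points is a torsion point, and \<open>s ^ E\<close>, scaled to a unit by a
  power of a uniformizer, is multiplied by a constant of \<F>_q. For an inertial \<sigma> with
  \<sigma>\<omega> = c\<omega> + \<zeta> there are three possibilities. If c is not 1, then
  \<sigma>\<omega>/\<omega> - 1 is a unit (tame). If c = 1 it equals \<zeta>/\<omega>, and a nonzero
  \<zeta> is a unit, so its valuation is R / q^(nd). If also \<zeta> = 0, then \<sigma> is the
  identity. Multiplying R / q^(nd) by the ramification index E q^(nd) gives ER, the wild break in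
  the lower numbering; division by the tame index E makes it the upper break R. That p does not
  divide ER gives R / q^(nd) the full denominator E q^(nd). In general \<omega> is no uniformizer,
  but a monomial in \<omega> and a uniformizer of K is one, and it serves as the test
  element.\<close>

lemma field_ambient: "Ring.field (ambient :: 'c::field ring)"
  by (rule field_from_type_algebra)

lemma ambient_simps [simp]:
  "carrier ambient = UNIV" "zero ambient = (0::'c::field)" "one ambient = (1::'c)"
  "add ambient x y = x + y" "monoid.mult ambient x y = x * (y::'c)"
  by (simp_all add: ring_of_type_algebra_def)

lemma a_inv_ambient [simp]: "a_inv ambient x = - (x::'c::field)"
proof -
  interpret R: Ring.field "ambient :: 'c ring" by (rule field_ambient)
  show ?thesis
    using R.minus_equality[of "- x" x] by simp
qed

lemma m_inv_ambient [simp]: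
  assumes "(x::'c::field) \<noteq> 0"
  shows "m_inv ambient x = inverse x"
proof -
  interpret R: Ring.field "ambient :: 'c ring" by (rule field_ambient)
  show ?thesis
    using R.comm_inv_char[of x "inverse x"] assms by simp
qed

text \<open>Since \<open>inverse 0 = 0\<close>, closure under \<open>inverse\<close> can be demanded
  of every element, without an exception for zero.\<close>

lemma subfield_ambient_iff:
  fixes N :: "'c::field set"
  shows "subfield N ambient \<longleftrightarrow> 0 \<in> N \<and> 1 \<in> N \<and> (\<forall>x\<in>N. \<forall>y\<in>N. x + y \<in> N \<and> x * y \<in> N) \<and>
    (\<forall>x\<in>N. - x \<in> N \<and> inverse x \<in> N)" (is "_ \<longleftrightarrow> ?R")
proof
  interpret R: Ring.field "ambient :: 'c ring" by (rule field_ambient)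
  assume S: "subfield N ambient"
  have inv: "inverse x \<in> N" if "x \<in> N" for x
  proof (cases "x = 0")
    case False
    then show ?thesis
      using R.subfield_m_inv(1)[OF S, of x] that by auto
  qed (use that in auto)
  note sr = subfieldE(1)[OF S]
  show ?R
    using subringE(2,3,5,6,7)[OF sr] inv by auto
next
  interpret R: Ring.field "ambient :: 'c ring" by (rule field_ambient)
  assume ?R
  then show "subfield N ambient"
    by (intro R.subfieldI' R.subringI) auto
qed

context
  fixes N :: "'c::field set"
  assumes N: "subfield N ambient"
begin

lemma sf_0: "0 \<in> N" and sf_1: "1 \<in> N"
  and sf_add: "\<And>x y. x \<in> N \<Longrightarrow> y \<in> N \<Longrightarrow> x + y \<in> N"
  and sf_mult: "\<And>x y. x \<in> N \<Longrightarrow> y \<in> N \<Longrightarrow> x * y \<in> N"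
  and sf_uminus: "\<And>x. x \<in> N \<Longrightarrow> - x \<in> N"
  and sf_inverse: "\<And>x. x \<in> N \<Longrightarrow> inverse x \<in> N"
  using N unfolding subfield_ambient_iff by auto

lemma sf_diff: "x \<in> N \<Longrightarrow> y \<in> N \<Longrightarrow> x - y \<in> N"
  using sf_add[OF _ sf_uminus, of x y] by simp

lemma sf_divide: "x \<in> N \<Longrightarrow> y \<in> N \<Longrightarrow> x / y \<in> N"
  using sf_mult[OF _ sf_inverse, of x y] by (simp add: divide_inverse)

lemma sf_power: "x \<in> N \<Longrightarrow> x ^ n \<in> N"
  by (induction n) (auto intro: sf_1 sf_mult)

lemma sf_sum: "(\<And>i. i \<in> I \<Longrightarrow> f i \<in> N) \<Longrightarrow> sum f I \<in> N"
  by (induction I rule: infinite_finite_induct) (auto intro: sf_0 sf_add)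

lemma sf_of_nat: "of_nat n \<in> N"
  by (induction n) (auto intro: sf_0 sf_1 sf_add)

end

lemma field_adjoin_subfield: "subfield (field_adjoin N S) ambient"
  for N :: "'c::field set"
  by (rule field.generate_field_is_subfield[OF field_ambient]) auto

lemma field_adjoin_incl: "N \<subseteq> field_adjoin N S" "S \<subseteq> field_adjoin N S"
  for N :: "'c::field set"
  by (auto intro: generate_field.incl)

lemma field_adjoin_least:
  fixes N :: "'c::field set"
  assumes "subfield M ambient" "N \<subseteq> M" "S \<subseteq> M"
  shows "field_adjoin N S \<subseteq> M"
  by (rule field.generate_field_min_subfield1[OF field_ambient]) (use assms in auto)

definition polys_over :: "'c::field set \<Rightarrow> 'c poly set"
  where "polys_over N = {f. \<forall>i. Polynomial.coeff f i \<in> N}"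

lemma polys_over_coeff: "f \<in> polys_over N \<Longrightarrow> Polynomial.coeff f i \<in> N"
  by (simp add: polys_over_def)

lemma polys_over_mono: "N \<subseteq> N' \<Longrightarrow> polys_over N \<subseteq> polys_over N'"
  by (auto simp: polys_over_def)

context
  fixes N :: "'c::field set"
  assumes N: "subfield N ambient"
begin

lemma polys_over_0: "0 \<in> polys_over N"
  by (simp add: polys_over_def sf_0[OF N])

lemma polys_over_add: "f \<in> polys_over N \<Longrightarrow> g \<in> polys_over N \<Longrightarrow> f + g \<in> polys_over N"
  by (simp add: polys_over_def sf_add[OF N])

lemma polys_over_uminus: "f \<in> polys_over N \<Longrightarrow> - f \<in> polys_over N"
  by (simp add: polys_over_def sf_uminus[OF N])

lemma polys_over_diff: "f \<in> polys_over N \<Longrightarrow> g \<in> polys_over N \<Longrightarrow> f - g \<in> polys_over N"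
  by (simp add: polys_over_def sf_diff[OF N])

lemma polys_over_mult: "f \<in> polys_over N \<Longrightarrow> g \<in> polys_over N \<Longrightarrow> f * g \<in> polys_over N"
  by (auto simp: polys_over_def coeff_mult intro!: sf_sum[OF N] sf_mult[OF N])

lemma polys_over_monom: "c \<in> N \<Longrightarrow> Polynomial.monom c k \<in> polys_over N"
  by (simp add: polys_over_def sf_0[OF N])

lemma polys_over_pCons: "c \<in> N \<Longrightarrow> f \<in> polys_over N \<Longrightarrow> pCons c f \<in> polys_over N"
  by (auto simp: polys_over_def coeff_pCons split: nat.splits)

lemma polys_over_const: "c \<in> N \<Longrightarrow> [:c:] \<in> polys_over N"
  by (intro polys_over_pCons polys_over_0)

lemma polys_over_1: "1 \<in> polys_over N"
  using polys_over_const[OF sf_1[OF N]] by (simp add: one_pCons)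

lemma polys_over_smult: "c \<in> N \<Longrightarrow> f \<in> polys_over N \<Longrightarrow> Polynomial.smult c f \<in> polys_over N"
  by (simp add: polys_over_def sf_mult[OF N])

lemma polys_over_power: "f \<in> polys_over N \<Longrightarrow> f ^ n \<in> polys_over N"
  by (induction n) (auto intro: polys_over_1 polys_over_mult)

lemma polys_over_poly: "f \<in> polys_over N \<Longrightarrow> x \<in> N \<Longrightarrow> poly f x \<in> N"
  by (simp add: poly_altdef polys_over_coeff sf_sum[OF N] sf_mult[OF N] sf_power[OF N])

text \<open>Long division by cancelling leading terms: every coefficient that arises is built from
  those of \<open>f\<close> and \<open>h\<close> by field operations, so quotient and remainder stay
  over \<open>N\<close>.\<close>

lemma polys_over_divide:
  assumes h: "h \<in> polys_over N" "h \<noteq> 0" and f: "f \<in> polys_over N"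
  shows "\<exists>q\<in>polys_over N. \<exists>r\<in>polys_over N.
    f = q * h + r \<and> (r = 0 \<or> Polynomial.degree r < Polynomial.degree h)"
  using f
proof (induction "Polynomial.degree f" arbitrary: f rule: less_induct)
  case less
  show ?case
  proof (cases "f = 0 \<or> Polynomial.degree f < Polynomial.degree h")
    case True
    then show ?thesis
      using less.prems by (intro bexI[of _ 0] bexI[of _ f]) (auto intro: polys_over_0)
  next
    case False
    define g where "g = Polynomial.monom (Polynomial.lead_coeff f / Polynomial.lead_coeff h)
      (Polynomial.degree f - Polynomial.degree h)"
    have g: "g \<in> polys_over N"
      unfolding g_def by (intro polys_over_monom sf_divide[OF N] polys_over_coeff less.prems h)
    define f' where "f' = f - g * h"
    have f': "f' \<in> polys_over N"
      unfolding f'_def by (intro polys_over_diff polys_over_mult less.prems g h)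
    have fq: "f = g * h + f'" by (simp add: f'_def)
    have g0: "g \<noteq> 0" using False h by (simp add: g_def)
    have degg: "Polynomial.degree g = Polynomial.degree f - Polynomial.degree h"
      using False h by (simp add: g_def degree_monom_eq)
    have deg: "Polynomial.degree (g * h) = Polynomial.degree f"
      using False h g0 degg by (subst degree_mult_eq) auto
    have lc: "Polynomial.lead_coeff (g * h) = Polynomial.lead_coeff f"
      unfolding lead_coeff_mult degg using h by (simp add: g_def)
    \<comment> \<open>A constant \<open>f\<close> is a case of its own: the zero polynomial has
      degree 0, so the degree cannot drop and \<open>f'\<close> has to vanish.\<close>
    have "f' = 0 \<or> Polynomial.degree f' < Polynomial.degree f"
    proof (cases "Polynomial.degree f = 0")
      case True
      then have "f' = 0"
        using deg lc unfolding f'_def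
        by (metis degree_eq_zeroE lead_coeff_pCons(2) cancel_comm_monoid_add_class.diff_cancel
            lead_coeff_pCons(1))
      then show ?thesis by simp
    next
      case False
      have "Polynomial.degree f' < Polynomial.degree f"
      proof (rule ccontr)
        assume "\<not> ?thesis"
        moreover have "Polynomial.degree f' \<le> Polynomial.degree f"
          unfolding f'_def by (rule degree_diff_le) (auto simp: deg)
        ultimately have e: "Polynomial.degree f' = Polynomial.degree f" by simp
        have "Polynomial.lead_coeff f' = 0"
          unfolding e using lc deg by (simp add: f'_def)
        then have "f' = 0" by (simp only: leading_coeff_0_iff)
        then show False using e False by simp
      qed
      then show ?thesis by simp
    qed
    then show ?thesis
    proof
      assume "f' = 0"
      then show ?thesis
        using fq g by (intro bexI[of _ g] bexI[of _ 0]) (auto intro: polys_over_0)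
    next
      assume "Polynomial.degree f' < Polynomial.degree f"
      from less.hyps[OF this f'] obtain q r where qr: "q \<in> polys_over N" "r \<in> polys_over N"
        "f' = q * h + r" "r = 0 \<or> Polynomial.degree r < Polynomial.degree h" by blast
      have "f = (g + q) * h + r" using fq qr(3) by (simp add: algebra_simps)
      then show ?thesis
        using qr g by (intro bexI[of _ "g + q"] bexI[of _ r]) (auto intro: polys_over_add)
    qed
  qed
qed

end

text \<open>Least degree is demanded instead of irreducibility: this is what division with remainder
  consumes, and what an argument with valuations can establish directly
  (\<open>ramified_min_poly\<close>).\<close>

definition is_min_poly :: "'c::field set \<Rightarrow> 'c \<Rightarrow> 'c poly \<Rightarrow> bool"
  where "is_min_poly N a g \<longleftrightarrow> g \<in> polys_over N \<and> Polynomial.lead_coeff g = 1 \<and> poly g a = 0 \<and>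
    (\<forall>h\<in>polys_over N. h \<noteq> 0 \<longrightarrow> poly h a = 0 \<longrightarrow> Polynomial.degree g \<le> Polynomial.degree h)"

definition simple_ext :: "'c::field set \<Rightarrow> 'c \<Rightarrow> 'c set"
  where "simple_ext N a = {poly h a | h. h \<in> polys_over N}"

context
  fixes N :: "'c::field set"
  assumes N: "subfield N ambient"
begin

lemma is_min_poly_exists:
  assumes "f \<in> polys_over N" "f \<noteq> 0" "poly f a = 0"
  obtains g where "is_min_poly N a g"
proof -
  define P where "P h \<longleftrightarrow> h \<in> polys_over N \<and> h \<noteq> 0 \<and> poly h a = 0" for h
  obtain h where h: "P h" "\<And>k. P k \<Longrightarrow> Polynomial.degree h \<le> Polynomial.degree k"
    using arg_min_nat_lemma[of P f Polynomial.degree] assms unfolding P_def by blast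
  define g where "g = Polynomial.smult (inverse (Polynomial.lead_coeff h)) h"
  have "is_min_poly N a g"
    using h unfolding is_min_poly_def g_def P_def
    by (auto intro!: polys_over_smult[OF N] sf_inverse[OF N] polys_over_coeff)
  then show ?thesis by (rule that)
qed

lemma is_min_poly_dvd:
  assumes g: "is_min_poly N a g" and f: "f \<in> polys_over N" "poly f a = 0"
  obtains q where "q \<in> polys_over N" "f = q * g"
proof -
  have "g \<noteq> 0" using g by (auto simp: is_min_poly_def)
  then obtain q r where qr: "q \<in> polys_over N" "r \<in> polys_over N" "f = q * g + r"
    "r = 0 \<or> Polynomial.degree r < Polynomial.degree g"
    using polys_over_divide[OF N _ _ f(1), of g] g by (auto simp: is_min_poly_def)
  have "poly r a = 0" using qr(3) f(2) g by (simp add: is_min_poly_def)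
  then have "r = 0" using g qr(2,4) by (force simp: is_min_poly_def)
  then show ?thesis using that qr by auto
qed

lemma is_min_poly_degree_pos: "is_min_poly N a g \<Longrightarrow> 0 < Polynomial.degree g"
  unfolding is_min_poly_def
  by (metis degree_eq_zeroE gr0I lead_coeff_pCons(2) mult_zero_right one_neq_zero poly_const_conv)

lemma simple_ext_reduced:
  assumes g: "is_min_poly N a g" and x: "x \<in> simple_ext N a"
  obtains h where "h \<in> polys_over N" "x = poly h a" "Polynomial.degree h < Polynomial.degree g"
proof -
  have "g \<noteq> 0" using g by (auto simp: is_min_poly_def)
  obtain f where f: "f \<in> polys_over N" "x = poly f a" using x by (auto simp: simple_ext_def)
  obtain q r where qr: "q \<in> polys_over N" "r \<in> polys_over N" "f = q * g + r"
    "r = 0 \<or> Polynomial.degree r < Polynomial.degree g"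
    using polys_over_divide[OF N _ \<open>g \<noteq> 0\<close> f(1)] g by (auto simp: is_min_poly_def)
  have "x = poly r a" using qr(3) f(2) g by (simp add: is_min_poly_def)
  moreover have "Polynomial.degree r < Polynomial.degree g"
    using qr(4) is_min_poly_degree_pos[OF g] by auto
  ultimately show ?thesis using that qr(2) by blast
qed

text \<open>Euclid's algorithm: from \<open>g = q * h + r\<close> the inverse of \<open>h(a)\<close>
  is \<open>- q(a)\<close> times the inverse of \<open>r(a)\<close>, known by induction. If
  \<open>r(a) = 0\<close>, minimality gives \<open>r = 0\<close> and \<open>q(a) = 0\<close>; so
  \<open>q\<close> has the full degree of \<open>g\<close>, and \<open>h\<close> is
  constant.\<close>

lemma simple_ext_inverse_aux:
  assumes g: "is_min_poly N a g" and h: "h \<in> polys_over N" "poly h a \<noteq> 0"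
    "Polynomial.degree h < Polynomial.degree g"
  shows "inverse (poly h a) \<in> simple_ext N a"
  using h
proof (induction "Polynomial.degree h" arbitrary: h rule: less_induct)
  case less
  have h0: "h \<noteq> 0" using less.prems by auto
  obtain q r where qr: "q \<in> polys_over N" "r \<in> polys_over N" "g = q * h + r"
    "r = 0 \<or> Polynomial.degree r < Polynomial.degree h"
    using polys_over_divide[OF N less.prems(1) h0, of g] g by (auto simp: is_min_poly_def)
  have eq: "poly q a * poly h a + poly r a = 0"
    using g qr(3) by (simp add: is_min_poly_def)
  show ?case
  proof (cases "poly r a = 0")
    case True
    with eq less.prems have q0: "poly q a = 0" by simp
    have "r = 0"
      using True qr(2,4) g less.prems(3) by (force simp: is_min_poly_def)
    then have gq: "g = q * h" using qr(3) by simp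
    have "q \<noteq> 0" using gq g by (auto simp: is_min_poly_def)
    then have "Polynomial.degree g \<le> Polynomial.degree q"
      using q0 qr(1) g by (auto simp: is_min_poly_def)
    then have "Polynomial.degree h = 0"
      using gq h0 \<open>q \<noteq> 0\<close> by (simp add: degree_mult_eq)
  then obtain c where c: "h = [:c:]" by (rule degree_eq_zeroE)
    then have "c \<in> N" using polys_over_coeff[OF less.prems(1), of 0] by simp
    then show ?thesis
      unfolding simple_ext_def using c
      by (auto intro!: exI[of _ "[:inverse c:]"] polys_over_const[OF N] sf_inverse[OF N])
  next
    case False
    then have "Polynomial.degree r < Polynomial.degree h" using qr(4) by auto
    with less.hyps[OF this qr(2) False] less.prems(3)
    obtain k where k: "k \<in> polys_over N" "inverse (poly r a) = poly k a"
      by (auto simp: simple_ext_def)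
    have "poly h a * (- poly q a * poly k a) = 1"
    proof -
      have "poly h a * - poly q a = poly r a"
        using eq by (simp add: eq_neg_iff_add_eq_0 minus_equation_iff mult.commute) (metis add.commute eq_neg_iff_add_eq_0 minus_minus)
      then have "poly h a * - poly q a * inverse (poly r a) = 1" using False by simp
      then show ?thesis by (simp only: k(2) mult.assoc)
    qed
    then have "inverse (poly h a) = poly (- q * k) a"
      by (simp add: inverse_unique)
    then show ?thesis
      unfolding simple_ext_def using k(1) qr(1)
      by (auto intro!: exI[of _ "- q * k"] polys_over_uminus[OF N] polys_over_mult[OF N])
  qed
qed

lemma simple_ext_inverse:
  assumes g: "is_min_poly N a g" and x: "x \<in> simple_ext N a"
  shows "inverse x \<in> simple_ext N a"
proof (cases "x = 0")
  case True
  then show ?thesis using x by simp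
next
  case False
  obtain h where "h \<in> polys_over N" "x = poly h a" "Polynomial.degree h < Polynomial.degree g"
    using simple_ext_reduced[OF g x] .
  then show ?thesis using simple_ext_inverse_aux[OF g] False by simp
qed

lemma simple_ext_subfield:
  assumes g: "is_min_poly N a g"
  shows "subfield (simple_ext N a) ambient"
  unfolding subfield_ambient_iff
proof (intro conjI ballI)
  show "0 \<in> simple_ext N a"
    unfolding simple_ext_def by (auto intro!: exI[of _ 0] polys_over_0[OF N])
  show "1 \<in> simple_ext N a"
    unfolding simple_ext_def by (auto intro!: exI[of _ 1] polys_over_1[OF N])
next
  fix x y assume "x \<in> simple_ext N a" "y \<in> simple_ext N a"
  then obtain f h where "f \<in> polys_over N" "h \<in> polys_over N" "x = poly f a" "y = poly h a"
    by (auto simp: simple_ext_def)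
  then show "x + y \<in> simple_ext N a" "x * y \<in> simple_ext N a"
    unfolding simple_ext_def using polys_over_add[OF N] polys_over_mult[OF N]
    by (metis (mono_tags, lifting) mem_Collect_eq poly_add, metis (mono_tags, lifting) mem_Collect_eq poly_mult)
next
  fix x assume x: "x \<in> simple_ext N a"
  then obtain f where "f \<in> polys_over N" "x = poly f a"
    by (auto simp: simple_ext_def)
  then show "- x \<in> simple_ext N a"
    unfolding simple_ext_def by (auto intro!: exI[of _ "- f"] polys_over_uminus[OF N])
  show "inverse x \<in> simple_ext N a" by (rule simple_ext_inverse[OF g x])
qed

lemma simple_ext_incl: "N \<subseteq> simple_ext N a" "a \<in> simple_ext N a"
proof -
  show "N \<subseteq> simple_ext N a"
    unfolding simple_ext_def by (auto intro!: exI[of _ "[:_:]"] polys_over_const[OF N])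
  show "a \<in> simple_ext N a"
    unfolding simple_ext_def
    by (auto intro!: exI[of _ "[:0, 1:]"] polys_over_pCons[OF N] polys_over_0[OF N] sf_0[OF N] sf_1[OF N])
qed

lemma simple_ext_least:
  assumes "subfield M ambient" "N \<subseteq> M" "a \<in> M"
  shows "simple_ext N a \<subseteq> M"
  unfolding simple_ext_def using polys_over_poly[OF assms(1)] polys_over_mono[OF assms(2)] assms(3)
  by auto

end

section \<open>Embeddings and Galois groups\<close>

text \<open>Nothing is required outside \<open>M\<close>, so an embedding can be extended or
  restricted without a change of type; \<open>\<tau> 1 = 1\<close> excludes the zero map and thereby
  forces injectivity.\<close>

definition field_emb :: "'c::field set \<Rightarrow> ('c \<Rightarrow> 'c) \<Rightarrow> bool"
  where "field_emb M \<tau> \<longleftrightarrow> (\<forall>x\<in>M. \<forall>y\<in>M. \<tau> (x + y) = \<tau> x + \<tau> y \<and> \<tau> (x * y) = \<tau> x * \<tau> y) \<and> \<tau> 1 = 1"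

context
  fixes M :: "'c::field set" and \<tau>
  assumes M: "subfield M ambient" and \<tau>: "field_emb M \<tau>"
begin

lemma field_emb_add: "x \<in> M \<Longrightarrow> y \<in> M \<Longrightarrow> \<tau> (x + y) = \<tau> x + \<tau> y"
  and field_emb_mult: "x \<in> M \<Longrightarrow> y \<in> M \<Longrightarrow> \<tau> (x * y) = \<tau> x * \<tau> y"
  and field_emb_1: "\<tau> 1 = 1"
  using \<tau> by (auto simp: field_emb_def)

lemma field_emb_0: "\<tau> 0 = 0"
  using field_emb_add[of 0 0] sf_0[OF M] add_cancel_right_right[of "\<tau> 0" "\<tau> 0"] by simp

lemma field_emb_uminus: "x \<in> M \<Longrightarrow> \<tau> (- x) = - \<tau> x"
  using field_emb_add[of x "- x"] sf_uminus[OF M, of x] field_emb_0 by (simp add: add_eq_0_iff2)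

lemma field_emb_diff: "x \<in> M \<Longrightarrow> y \<in> M \<Longrightarrow> \<tau> (x - y) = \<tau> x - \<tau> y"
  using field_emb_add[of x "- y"] field_emb_uminus[of y] sf_uminus[OF M, of y] by simp

lemma field_emb_eq_0: "x \<in> M \<Longrightarrow> \<tau> x = 0 \<longleftrightarrow> x = 0"
  using field_emb_mult[of x "inverse x"] sf_inverse[OF M, of x] field_emb_0 field_emb_1
  by (cases "x = 0") auto

lemma field_emb_inj: "inj_on \<tau> M"
proof (rule inj_onI)
  fix x y assume "x \<in> M" "y \<in> M" "\<tau> x = \<tau> y"
  then show "x = y"
    using field_emb_diff[of x y] field_emb_eq_0[of "x - y"] sf_diff[OF M, of x y] by simp
qed

lemma field_emb_inverse: "x \<in> M \<Longrightarrow> \<tau> (inverse x) = inverse (\<tau> x)"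
  using field_emb_mult[of x "inverse x"] sf_inverse[OF M, of x] field_emb_0 field_emb_1
  by (cases "x = 0") (auto simp: inverse_unique)

lemma field_emb_divide: "x \<in> M \<Longrightarrow> y \<in> M \<Longrightarrow> \<tau> (x / y) = \<tau> x / \<tau> y"
  using field_emb_mult[of x "inverse y"] sf_inverse[OF M, of y] field_emb_inverse[of y]
  by (simp add: divide_inverse)

lemma field_emb_power: "x \<in> M \<Longrightarrow> \<tau> (x ^ n) = \<tau> x ^ n"
  by (induction n) (auto simp: field_emb_1 field_emb_mult sf_power[OF M])

lemma field_emb_sum: "(\<And>i. i \<in> I \<Longrightarrow> f i \<in> M) \<Longrightarrow> \<tau> (sum f I) = (\<Sum>i\<in>I. \<tau> (f i))"
  by (induction I rule: infinite_finite_induct) (auto simp: field_emb_0 field_emb_add sf_sum[OF M])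

lemma field_emb_poly: "f \<in> polys_over M \<Longrightarrow> x \<in> M \<Longrightarrow> \<tau> (poly f x) = poly (map_poly \<tau> f) (\<tau> x)"
proof -
  assume f: "f \<in> polys_over M" and x: "x \<in> M"
  have "\<tau> (poly f x) = (\<Sum>i\<le>Polynomial.degree f. \<tau> (Polynomial.coeff f i) * \<tau> x ^ i)"
    unfolding poly_altdef using f x
    by (subst field_emb_sum)
      (auto simp: field_emb_mult field_emb_power polys_over_coeff sf_power[OF M] sf_mult[OF M])
  also have "\<dots> = poly (map_poly \<tau> f) (\<tau> x)"
  proof -
    have "Polynomial.degree (map_poly \<tau> f) = Polynomial.degree f"
      using field_emb_eq_0[of "Polynomial.lead_coeff f"] polys_over_coeff[OF f] field_emb_0
      by (cases "f = 0") (auto intro!: antisym map_poly_degree_leq le_degree simp: coeff_map_poly)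
    then show ?thesis by (simp add: poly_altdef coeff_map_poly field_emb_0)
  qed
  finally show ?thesis .
qed

lemma field_emb_image_subfield: "subfield (\<tau> ` M) ambient"
  unfolding subfield_ambient_iff
proof (intro conjI ballI)
  show "0 \<in> \<tau> ` M" using field_emb_0 sf_0[OF M] by (metis imageI)
  show "1 \<in> \<tau> ` M" using field_emb_1 sf_1[OF M] by (metis imageI)
  fix x' assume "x' \<in> \<tau> ` M"
  then obtain x where x: "x \<in> M" "x' = \<tau> x" by auto
  show "- x' \<in> \<tau> ` M" using field_emb_uminus[OF x(1)] sf_uminus[OF M x(1)] x(2) by (metis imageI)
  show "inverse x' \<in> \<tau> ` M" using field_emb_inverse[OF x(1)] sf_inverse[OF M x(1)] x(2) by (metis imageI)
  fix y' assume "y' \<in> \<tau> ` M"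
  then obtain y where y: "y \<in> M" "y' = \<tau> y" by auto
  show "x' + y' \<in> \<tau> ` M" using field_emb_add[OF x(1) y(1)] sf_add[OF M x(1) y(1)] x(2) y(2) by (metis imageI)
  show "x' * y' \<in> \<tau> ` M" using field_emb_mult[OF x(1) y(1)] sf_mult[OF M x(1) y(1)] x(2) y(2) by (metis imageI)
qed

lemma field_emb_preimage_subfield:
  assumes N: "subfield N ambient"
  shows "subfield {x \<in> M. \<tau> x \<in> N} ambient"
  unfolding subfield_ambient_iff
  by (auto simp: field_emb_0 field_emb_1 field_emb_add field_emb_mult field_emb_uminus
      field_emb_inverse intro: sf_0[OF M] sf_1[OF M] sf_add[OF M] sf_mult[OF M] sf_uminus[OF M]
      sf_inverse[OF M] sf_0[OF N] sf_1[OF N] sf_add[OF N] sf_mult[OF N] sf_uminus[OF N] sf_inverse[OF N])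

text \<open>As the locus of agreement is a field, two embeddings need only be compared on
  generators.\<close>

lemma field_emb_equalizer_subfield:
  assumes \<sigma>: "field_emb M \<sigma>" and inv: "\<And>x. x \<in> M \<Longrightarrow> \<sigma> (inverse x) = inverse (\<sigma> x)"
    "\<And>x. x \<in> M \<Longrightarrow> \<sigma> (- x) = - \<sigma> x" "\<sigma> 0 = 0"
  shows "subfield {x \<in> M. \<sigma> x = \<tau> x} ambient"
  using \<sigma> unfolding subfield_ambient_iff field_emb_def
  by (auto simp: field_emb_0 field_emb_1 field_emb_add field_emb_mult field_emb_uminus
      field_emb_inverse inv intro: sf_0[OF M] sf_1[OF M] sf_add[OF M] sf_mult[OF M] sf_uminus[OF M]
      sf_inverse[OF M])

lemma map_poly_field_emb_add: "f \<in> polys_over M \<Longrightarrow> g \<in> polys_over M \<Longrightarrow>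
    map_poly \<tau> (f + g) = map_poly \<tau> f + map_poly \<tau> g"
  by (rule poly_eqI) (simp add: coeff_map_poly field_emb_0 field_emb_add polys_over_coeff)

lemma map_poly_field_emb_diff: "f \<in> polys_over M \<Longrightarrow> g \<in> polys_over M \<Longrightarrow>
    map_poly \<tau> (f - g) = map_poly \<tau> f - map_poly \<tau> g"
  by (rule poly_eqI) (simp add: coeff_map_poly field_emb_0 field_emb_diff polys_over_coeff)

lemma map_poly_field_emb_mult: "f \<in> polys_over M \<Longrightarrow> g \<in> polys_over M \<Longrightarrow>
    map_poly \<tau> (f * g) = map_poly \<tau> f * map_poly \<tau> g"
  by (rule poly_eqI) (simp add: coeff_map_poly field_emb_0 coeff_mult field_emb_sum
      field_emb_mult polys_over_coeff sf_mult[OF M])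

end

lemma map_poly_fixed: "f \<in> polys_over N \<Longrightarrow> (\<And>x. x \<in> N \<Longrightarrow> \<tau> x = x) \<Longrightarrow> \<tau> 0 = 0 \<Longrightarrow> map_poly \<tau> f = f"
  by (rule poly_eqI) (simp add: coeff_map_poly polys_over_coeff)

lemma field_emb_fixed_poly:
  assumes "subfield N ambient" "subfield M ambient" "N \<subseteq> M" "field_emb M \<tau>"
    "\<And>x. x \<in> N \<Longrightarrow> \<tau> x = x" "f \<in> polys_over N" "x \<in> M"
  shows "\<tau> (poly f x) = poly f (\<tau> x)"
  using field_emb_poly[OF assms(2,4) _ assms(7), of f] polys_over_mono[OF assms(3)] assms(6)
    map_poly_fixed[OF assms(6,5)] field_emb_0[OF assms(2,4)] by auto

text \<open>The extension sends \<open>h(a)\<close> to the value of the conjugated polynomial at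
  \<open>b\<close>. Two representatives \<open>h\<close> of the same element differ by a multiple of
  \<open>g\<close>, whose conjugate vanishes at \<open>b\<close>, so the choice made by
  \<open>SOME\<close> is immaterial.\<close>

lemma field_emb_extend_simple:
  fixes N :: "'c::alg_closed_field set"
  assumes N: "subfield N ambient" and \<tau>: "field_emb N \<tau>" and g: "is_min_poly N a g"
    and b: "poly (map_poly \<tau> g) b = 0"
  obtains \<tau>' where "field_emb (simple_ext N a) \<tau>'" "\<And>x. x \<in> N \<Longrightarrow> \<tau>' x = \<tau> x" "\<tau>' a = b"
proof -
  define \<tau>' where "\<tau>' x = poly (map_poly \<tau> (SOME h. h \<in> polys_over N \<and> poly h a = x)) b" for x
  have gN: "g \<in> polys_over N" using g by (simp add: is_min_poly_def)
  have val: "\<tau>' (poly h a) = poly (map_poly \<tau> h) b" if h: "h \<in> polys_over N" for h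
  proof -
    define h' where "h' = (SOME h'. h' \<in> polys_over N \<and> poly h' a = poly h a)"
    have h': "h' \<in> polys_over N \<and> poly h' a = poly h a"
      unfolding h'_def by (rule someI[of _ h]) (use h in auto)
    obtain q where q: "q \<in> polys_over N" "h' - h = q * g"
      using is_min_poly_dvd[OF N g, of "h' - h"] h h' polys_over_diff[OF N] by auto
    have "map_poly \<tau> h' - map_poly \<tau> h = map_poly \<tau> q * map_poly \<tau> g"
      using map_poly_field_emb_diff[OF N \<tau>, of h' h] map_poly_field_emb_mult[OF N \<tau> q(1) gN] h h' q(2)
      by simp
    then have "poly (map_poly \<tau> h' - map_poly \<tau> h) b = 0" using b by simp
    then show ?thesis by (simp add: \<tau>'_def h'_def)
  qed
  show ?thesis
  proof
    show "\<tau>' x = \<tau> x" if "x \<in> N" for x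
      using val[OF polys_over_const[OF N that]] field_emb_0[OF N \<tau>] by (simp add: map_poly_pCons)
    show "\<tau>' a = b"
      using val[OF polys_over_pCons[OF N sf_0[OF N] polys_over_const[OF N sf_1[OF N]]]]
        field_emb_0[OF N \<tau>] field_emb_1[OF N \<tau>] by (simp add: map_poly_pCons)
    have "\<tau>' 1 = 1"
      using val[OF polys_over_1[OF N]] field_emb_0[OF N \<tau>] field_emb_1[OF N \<tau>]
      by (simp add: one_pCons map_poly_pCons)
    moreover have "\<tau>' (x + y) = \<tau>' x + \<tau>' y \<and> \<tau>' (x * y) = \<tau>' x * \<tau>' y"
      if xy: "x \<in> simple_ext N a" "y \<in> simple_ext N a" for x y
    proof -
      obtain f where f: "f \<in> polys_over N" "x = poly f a"
        using xy(1) unfolding simple_ext_def by blast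
      obtain h where h: "h \<in> polys_over N" "y = poly h a"
        using xy(2) unfolding simple_ext_def by blast
      note fh = f(1) h(1) f(2) h(2)
      show ?thesis
        unfolding fh(3,4) poly_add[symmetric] poly_mult[symmetric]
        using fh(1,2) by (simp only: val polys_over_add[OF N] polys_over_mult[OF N]
          map_poly_field_emb_add[OF N \<tau>] map_poly_field_emb_mult[OF N \<tau>]) simp
    qed
    ultimately show "field_emb (simple_ext N a) \<tau>'" by (auto simp: field_emb_def)
  qed
qed

text \<open>Members of \<open>Bij M\<close> are extensional, which turns equality on
  \<open>M\<close> into equality of functions.\<close>

lemma galois_group_iff:
  fixes M :: "'c::field set"
  assumes M: "subfield M ambient"
  shows "\<sigma> \<in> carrier (galois_group M K) \<longleftrightarrow>
    \<sigma> \<in> extensional M \<and> field_emb M \<sigma> \<and> \<sigma> ` M = M \<and> (\<forall>x\<in>K. \<sigma> x = x)"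
proof -
  have eq: "(\<sigma> \<in> Bij M \<and> \<sigma> \<in> ring_iso (ambient\<lparr>carrier := M\<rparr>) (ambient\<lparr>carrier := M\<rparr>)) \<longleftrightarrow>
     \<sigma> \<in> extensional M \<and> field_emb M \<sigma> \<and> \<sigma> ` M = M"
    using field_emb_inj[OF M, of \<sigma>]
    by (auto simp: Bij_def ring_iso_def ring_hom_def field_emb_def bij_betw_def)
  show ?thesis
    unfolding galois_group_def using eq by auto
qed

lemma galois_group_mult:
  assumes "\<sigma> \<in> carrier (galois_group M K)" "\<tau> \<in> carrier (galois_group M K)"
  shows "\<sigma> \<otimes>\<^bsub>galois_group M K\<^esub> \<tau> = compose M \<sigma> \<tau>"
  using assms by (auto simp: galois_group_def BijGroup_def)

lemma galois_group_antimono: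
  "N \<subseteq> N' \<Longrightarrow> carrier (galois_group M N') \<subseteq> carrier (galois_group M N)"
  by (auto simp: galois_group_def)

lemma galois_group_compose:
  fixes M :: "'c::field set"
  assumes M: "subfield M ambient" and K: "K \<subseteq> M"
    and "\<sigma> \<in> carrier (galois_group M K)" "\<tau> \<in> carrier (galois_group M K)"
  shows "compose M \<sigma> \<tau> \<in> carrier (galois_group M K)"
  unfolding galois_group_iff[OF M]
proof (intro conjI ballI)
  have \<sigma>: "field_emb M \<sigma>" "\<sigma> ` M = M" "\<And>x. x \<in> K \<Longrightarrow> \<sigma> x = x"
    and \<tau>: "field_emb M \<tau>" "\<tau> ` M = M" "\<And>x. x \<in> K \<Longrightarrow> \<tau> x = x"
    using assms(3,4) unfolding galois_group_iff[OF M] by auto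
  show "field_emb M (compose M \<sigma> \<tau>)"
    using \<sigma>(1) \<tau>(1) imageI[of _ M \<tau>, unfolded \<tau>(2)]
    by (auto simp: field_emb_def compose_def sf_add[OF M] sf_mult[OF M] sf_1[OF M])
  show "compose M \<sigma> \<tau> ` M = M"
  proof -
    have "compose M \<sigma> \<tau> ` M = \<sigma> ` \<tau> ` M" by (auto simp: compose_def)
    then show ?thesis using \<sigma>(2) \<tau>(2) by simp
  qed
  show "compose M \<sigma> \<tau> x = x" if "x \<in> K" for x
    using \<sigma>(3)[OF that] \<tau>(3)[OF that] that K by (auto simp: compose_def)
qed (rule compose_extensional)

lemma galois_group_in: 
  fixes M :: "'c::field set"
  assumes M: "subfield M ambient" and "\<sigma> \<in> carrier (galois_group M K)" "x \<in> M"
  shows "\<sigma> x \<in> M"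
  using assms(2,3) unfolding galois_group_iff[OF M] by auto

text \<open>Unions of root sets of separable polynomials: they are stable under conjugation over \<open>K\<close>.\<close>

definition separable_set :: "'c::field set \<Rightarrow> 'c set \<Rightarrow> bool"
  where "separable_set K S \<longleftrightarrow> finite S \<and>
    (\<forall>r\<in>S. \<exists>f\<in>polys_over K. f \<noteq> 0 \<and> poly f r = 0 \<and> {z. poly f z = 0} \<subseteq> S \<and>
       (\<forall>z. poly f z = 0 \<longrightarrow> poly (pderiv f) z \<noteq> 0))"

lemma separable_set_mono: "K \<subseteq> K' \<Longrightarrow> separable_set K S \<Longrightarrow> separable_set K' S"
  unfolding separable_set_def using polys_over_mono by blast

lemma card_roots_separable:
  fixes f :: "'c::alg_closed_field poly"
  assumes "f \<noteq> 0" "\<And>z. poly f z = 0 \<Longrightarrow> poly (pderiv f) z \<noteq> 0"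
  shows "card {z. poly f z = 0} = Polynomial.degree f"
  using assms
proof (induction "Polynomial.degree f" arbitrary: f)
  case 0
  then obtain c where "f = [:c:]" "c \<noteq> 0" by (metis degree_eq_zeroE pCons_0_0)
  then show ?case by simp
next
  case (Suc d)
  then obtain a where a: "poly f a = 0"
    using alg_closed_imp_poly_has_root[of f] by auto
  then obtain h where h: "f = [:- a, 1:] * h" by (auto simp: poly_eq_0_iff_dvd elim: dvdE)
  have h0: "h \<noteq> 0" using h Suc.prems by auto
  have d: "Polynomial.degree f = Suc (Polynomial.degree h)"
    unfolding h by (subst degree_mult_eq) (use h0 in auto)
  have pd: "poly (pderiv f) z = poly h z + (z - a) * poly (pderiv h) z" for z
    unfolding h pderiv_mult by (simp add: pderiv_pCons algebra_simps)
  have ha: "poly h a \<noteq> 0" using Suc.prems(2)[OF a] pd[of a] by simp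
  have "poly (pderiv h) z \<noteq> 0" if "poly h z = 0" for z
    using Suc.prems(2)[of z] pd[of z] that h by auto
  then have IH: "card {z. poly h z = 0} = Polynomial.degree h"
    using Suc.hyps(1)[of h] Suc.hyps(2) d h0 by auto
  have "{z. poly f z = 0} = insert a {z. poly h z = 0}" using h by auto
  then show ?case using IH d ha poly_roots_finite[OF h0] by simp
qed

text \<open>A splitting field of separable polynomials, presented by their roots. Extension of
  embeddings and the fixed field theorem are proved by induction on the number of generators outside
  an intermediate field.\<close>

locale galois_generators =
  fixes K :: "'c::alg_closed_field set" and S M
  assumes K: "subfield K ambient" and S: "separable_set K S" and M: "M = field_adjoin K S"
begin

lemma M_subfield: "subfield M ambient"
  unfolding M by (rule field_adjoin_subfield)

lemma K_le: "K \<subseteq> M" and S_le: "S \<subseteq> M"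
  unfolding M by (rule field_adjoin_incl)+

lemma S_min_poly:
  assumes "subfield N ambient" "K \<subseteq> N" "r \<in> S"
  obtains g where "is_min_poly N r g"
proof -
  obtain f where "f \<in> polys_over K" "f \<noteq> 0" "poly f r = 0"
    using S assms(3) unfolding separable_set_def by blast
  then show ?thesis
    using is_min_poly_exists[OF assms(1), of f r] polys_over_mono[OF assms(2)] that by auto
qed

lemma S_image:
  assumes N: "subfield N ambient" "K \<subseteq> N" and \<tau>: "field_emb N \<tau>" "\<And>x. x \<in> K \<Longrightarrow> \<tau> x = x"
    and r: "r \<in> S" "r \<in> N"
  shows "\<tau> r \<in> S"
proof -
  obtain f where f: "f \<in> polys_over K" "poly f r = 0" "{z. poly f z = 0} \<subseteq> S"
    using S r(1) unfolding separable_set_def by blast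
  have "poly f (\<tau> r) = \<tau> (poly f r)"
    using field_emb_fixed_poly[OF K N \<tau> f(1) r(2)] by simp
  then have "poly f (\<tau> r) = 0" using f(2) field_emb_0[OF N(1) \<tau>(1)] by simp
  then show ?thesis using f(3) by auto
qed

text \<open>The embedding maps the finite set \<open>S\<close> injectively into itself, hence onto
  itself, so its image contains all generators.\<close>

lemma emb_image:
  assumes \<tau>: "field_emb M \<tau>" "\<And>x. x \<in> K \<Longrightarrow> \<tau> x = x"
  shows "\<tau> ` M = M"
proof -
  have sub: "\<tau> ` S \<subseteq> S"
    using S_image[OF M_subfield K_le \<tau>] S_le by blast
  have "finite S" using S by (simp add: separable_set_def)
  then have S_eq: "\<tau> ` S = S"
    using endo_inj_surj[OF _ sub] inj_on_subset[OF field_emb_inj[OF M_subfield \<tau>(1)] S_le] by auto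
  note sf = field_emb_image_subfield[OF M_subfield \<tau>(1)]
  have "M \<subseteq> \<tau> ` M"
  proof -
    have "K \<subseteq> \<tau> ` M" using \<tau>(2) K_le by (force simp: image_iff)
    moreover have "S \<subseteq> \<tau> ` M" using S_eq S_le by blast
    ultimately show ?thesis unfolding M by (intro field_adjoin_least) (use sf M in auto)
  qed
  moreover have "\<tau> ` M \<subseteq> M"
  proof -
    note field_emb_preimage_subfield[OF M_subfield \<tau>(1) M_subfield]
    moreover have "K \<subseteq> {x \<in> M. \<tau> x \<in> M}" "S \<subseteq> {x \<in> M. \<tau> x \<in> M}"
      using K_le \<tau>(2) S_le sub by auto
    ultimately have "M \<subseteq> {x \<in> M. \<tau> x \<in> M}" using field_adjoin_least M by blast
    then show ?thesis by auto
  qed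
  ultimately show ?thesis by auto
qed

text \<open>A missing generator is sent to a root of its conjugated minimal polynomial. Such a root
  exists because the leading coefficient 1 is preserved, so the degree stays positive over an
  algebraically closed type.\<close>

lemma emb_extend:
  assumes "subfield N ambient" "K \<subseteq> N" "N \<subseteq> M" "field_emb N \<tau>"
  obtains \<tau>' where "field_emb M \<tau>'" "\<And>x. x \<in> N \<Longrightarrow> \<tau>' x = \<tau> x"
proof -
  have "\<exists>\<tau>'. field_emb M \<tau>' \<and> (\<forall>x\<in>N. \<tau>' x = \<tau> x)"
    using assms
  proof (induction "card (S - N)" arbitrary: N \<tau> rule: less_induct)
    case (less N \<tau>)
    show ?case
    proof (cases "S \<subseteq> N")
      case True
      then have "M \<subseteq> N"
        unfolding M by (intro field_adjoin_least less.prems)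
      then show ?thesis using less.prems by auto
    next
      case False
      then obtain r where r: "r \<in> S" "r \<notin> N" by auto
      obtain g where g: "is_min_poly N r g" using S_min_poly[OF less.prems(1,2) r(1)] .
      have "Polynomial.coeff (map_poly \<tau> g) (Polynomial.degree g) = 1"
        using g field_emb_0[OF less.prems(1,4)] field_emb_1[OF less.prems(1,4)]
        by (simp add: coeff_map_poly is_min_poly_def)
      then have "Polynomial.degree g \<le> Polynomial.degree (map_poly \<tau> g)"
        by (intro le_degree) simp
      then have "0 < Polynomial.degree (map_poly \<tau> g)"
        using is_min_poly_degree_pos[OF less.prems(1) g] by simp
      then obtain b where b: "poly (map_poly \<tau> g) b = 0"
        using alg_closed_imp_poly_has_root by blast
      obtain \<tau>1 where \<tau>1: "field_emb (simple_ext N r) \<tau>1" "\<And>x. x \<in> N \<Longrightarrow> \<tau>1 x = \<tau> x"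
        using field_emb_extend_simple[OF less.prems(1,4) g b] by metis
      note sub = simple_ext_incl[OF less.prems(1), of r]
      have fin: "finite S" using S by (simp add: separable_set_def)
      have "card (S - simple_ext N r) < card (S - N)"
        by (rule psubset_card_mono) (use fin r sub in auto)
      moreover have "simple_ext N r \<subseteq> M"
        by (rule simple_ext_least[OF less.prems(1) M_subfield less.prems(3)]) (use r S_le in auto)
      ultimately obtain \<tau>' where "field_emb M \<tau>'" "\<forall>x\<in>simple_ext N r. \<tau>' x = \<tau>1 x"
        using less.hyps[OF _ simple_ext_subfield[OF less.prems(1) g] _ _ \<tau>1(1)] sub less.prems(2)
        by blast
      then show ?thesis using \<tau>1(2) sub by (intro exI[of _ \<tau>']) auto
    qed
  qed
  then show ?thesis using that by auto
qed

lemma galois_transitive: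
  assumes N: "subfield N ambient" "K \<subseteq> N" "N \<subseteq> M" and g: "is_min_poly N a g" and a: "a \<in> M"
    and b: "poly g b = 0"
  obtains \<sigma> where "\<sigma> \<in> carrier (galois_group M N)" "\<sigma> a = b"
proof -
  have id: "field_emb N (\<lambda>x. x)" by (simp add: field_emb_def)
  have "map_poly (\<lambda>x. x) g = g" by (rule poly_eqI) (simp add: coeff_map_poly)
  then obtain \<tau> where \<tau>: "field_emb (simple_ext N a) \<tau>" "\<And>x. x \<in> N \<Longrightarrow> \<tau> x = x" "\<tau> a = b"
    using field_emb_extend_simple[OF N(1) id g] b by metis
  note sub = simple_ext_incl[OF N(1), of a]
  have "simple_ext N a \<subseteq> M" by (rule simple_ext_least[OF N(1) M_subfield N(3) a])
  then obtain \<tau>' where \<tau>': "field_emb M \<tau>'" "\<And>x. x \<in> simple_ext N a \<Longrightarrow> \<tau>' x = \<tau> x"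
    using emb_extend[OF simple_ext_subfield[OF N(1) g] _ _ \<tau>(1)] sub N(2) by (metis subset_trans)
  define \<sigma> where "\<sigma> = restrict \<tau>' M"
  have "field_emb M \<sigma>"
    using \<tau>'(1) by (simp add: \<sigma>_def field_emb_def sf_add[OF M_subfield] sf_mult[OF M_subfield] sf_1[OF M_subfield])
  moreover have fixed: "\<sigma> x = x" if "x \<in> N" for x
    using that \<tau>(2) \<tau>'(2) sub N(3) by (auto simp: \<sigma>_def)
  moreover have "\<sigma> ` M = M"
    by (rule emb_image) (use \<open>field_emb M \<sigma>\<close> fixed N(2) in auto)
  ultimately have "\<sigma> \<in> carrier (galois_group M N)"
    unfolding galois_group_iff[OF M_subfield] by (auto simp: \<sigma>_def)
  moreover have "\<sigma> a = b" using \<tau>(3) \<tau>'(2) sub a by (auto simp: \<sigma>_def)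
  ultimately show ?thesis by (rule that)
qed

text \<open>By induction \<open>x = h(r)\<close> for a generator \<open>r\<close> with minimal
  polynomial \<open>g\<close> and \<open>h\<close> of smaller degree. Transitivity gives
  \<open>h(b) = x\<close> at every root \<open>b\<close> of \<open>g\<close>. By separability there
  are as many roots as the degree of \<open>g\<close>, too many for \<open>h - x\<close> unless it
  is zero, so \<open>x\<close> is the constant coefficient of \<open>h\<close>.\<close>

lemma galois_fixed_field:
  assumes "subfield N ambient" "K \<subseteq> N" "N \<subseteq> M" "x \<in> M"
    and "\<And>\<sigma>. \<sigma> \<in> carrier (galois_group M N) \<Longrightarrow> \<sigma> x = x"
  shows "x \<in> N"
  using assms
proof (induction "card (S - N)" arbitrary: N rule: less_induct)
  case (less N)
  show ?case
  proof (cases "S \<subseteq> N")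
    case True
    then have "M \<subseteq> N"
      unfolding M by (intro field_adjoin_least less.prems)
    then show ?thesis using less.prems by auto
  next
    case False
    then obtain r where r: "r \<in> S" "r \<notin> N" by auto
    obtain g where g: "is_min_poly N r g" using S_min_poly[OF less.prems(1,2) r(1)] .
    note sub = simple_ext_incl[OF less.prems(1), of r]
    have fin: "finite S" using S by (simp add: separable_set_def)
    have le: "simple_ext N r \<subseteq> M"
      by (rule simple_ext_least[OF less.prems(1) M_subfield less.prems(3)]) (use r S_le in auto)
    have "card (S - simple_ext N r) < card (S - N)"
      by (rule psubset_card_mono) (use fin r sub in auto)
    then have "x \<in> simple_ext N r"
      using less.hyps[OF _ simple_ext_subfield[OF less.prems(1) g] _ le less.prems(4)] sub
        less.prems(2,5) galois_group_antimono[OF sub(1), of M] by blast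
    then obtain h where h: "h \<in> polys_over N" "x = poly h r"
      "Polynomial.degree h < Polynomial.degree g"
      using simple_ext_reduced[OF less.prems(1) g] by blast
    obtain f where f: "f \<in> polys_over K" "f \<noteq> 0" "poly f r = 0"
      "\<And>z. poly f z = 0 \<Longrightarrow> poly (pderiv f) z \<noteq> 0"
      using S r(1) unfolding separable_set_def by blast
    obtain k where k: "f = k * g"
      using is_min_poly_dvd[OF less.prems(1) g, of f] f polys_over_mono[OF less.prems(2)] by blast
    have g0: "g \<noteq> 0" using k f(2) by auto
    have "poly (pderiv g) z \<noteq> 0" if "poly g z = 0" for z
      using f(4)[of z] that unfolding k by (simp add: pderiv_mult)
    then have cd: "card {z. poly g z = 0} = Polynomial.degree g"
      by (rule card_roots_separable[OF g0])
    have "poly h b = x" if b: "poly g b = 0" for b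
    proof -
      obtain \<sigma> where \<sigma>: "\<sigma> \<in> carrier (galois_group M N)" "\<sigma> r = b"
        using galois_transitive[OF less.prems(1-3) g _ b] r S_le by blast
      then have "\<sigma> (poly h r) = poly h (\<sigma> r)"
        using r S_le by (intro field_emb_fixed_poly[OF less.prems(1) M_subfield less.prems(3) _ _ h(1)])
          (auto simp: galois_group_iff[OF M_subfield])
      then show ?thesis using less.prems(5)[OF \<sigma>(1)] \<sigma>(2) h(2) by simp
    qed
    then have sub': "{z. poly g z = 0} \<subseteq> {z. poly (h - [:x:]) z = 0}" by auto
    have "h - [:x:] = 0"
    proof (rule ccontr)
      assume nz: "h - [:x:] \<noteq> 0"
      then have "card {z. poly g z = 0} \<le> Polynomial.degree (h - [:x:])"
        using card_mono[OF poly_roots_finite[OF nz] sub'] card_poly_roots_bound[OF nz] by simp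
      also have "\<dots> \<le> Polynomial.degree h" by (rule degree_diff_le) auto
      finally show False using cd h(3) by simp
    qed
    then show ?thesis using polys_over_coeff[OF h(1), of 0] by simp
  qed
qed

lemma galois_eqI:
  assumes "\<sigma> \<in> carrier (galois_group M K)" "\<tau> \<in> carrier (galois_group M K)" "\<And>r. r \<in> S \<Longrightarrow> \<sigma> r = \<tau> r"
  shows "\<sigma> = \<tau>"
proof -
  have \<sigma>: "\<sigma> \<in> extensional M" "field_emb M \<sigma>" "\<And>x. x \<in> K \<Longrightarrow> \<sigma> x = x"
   and \<tau>: "\<tau> \<in> extensional M" "field_emb M \<tau>" "\<And>x. x \<in> K \<Longrightarrow> \<tau> x = x"
    using assms(1,2) by (auto simp: galois_group_iff[OF M_subfield])
  note field_emb_equalizer_subfield[OF M_subfield \<tau>(2) \<sigma>(2) field_emb_inverse[OF M_subfield \<sigma>(2)]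
      field_emb_uminus[OF M_subfield \<sigma>(2)] field_emb_0[OF M_subfield \<sigma>(2)]]
  moreover have "K \<subseteq> {x \<in> M. \<sigma> x = \<tau> x}" "S \<subseteq> {x \<in> M. \<sigma> x = \<tau> x}"
    using K_le \<sigma>(3) \<tau>(3) S_le assms(3) by auto
  ultimately have "M \<subseteq> {x \<in> M. \<sigma> x = \<tau> x}" using field_adjoin_least M by blast
  then show ?thesis by (intro extensionalityI[OF \<sigma>(1) \<tau>(1)]) auto
qed

lemma galois_finite: "finite (carrier (galois_group M K))"
proof (rule finite_imageD)
  have fin: "finite S" using S by (simp add: separable_set_def)
  show "inj_on (\<lambda>\<sigma>. restrict \<sigma> S) (carrier (galois_group M K))"
    by (rule inj_onI, rule galois_eqI) (auto simp: fun_eq_iff, metis restrict_apply')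
  have "\<sigma> r \<in> S" if "\<sigma> \<in> carrier (galois_group M K)" "r \<in> S" for \<sigma> r
    using that S_image[OF M_subfield K_le, of \<sigma> r] S_le by (auto simp: galois_group_iff[OF M_subfield])
  then have "(\<lambda>\<sigma>. restrict \<sigma> S) ` carrier (galois_group M K) \<subseteq> (S \<rightarrow>\<^sub>E S)"
    by auto
  then show "finite ((\<lambda>\<sigma>. restrict \<sigma> S) ` carrier (galois_group M K))"
    using finite_subset finite_PiE[OF fin, of "\<lambda>_. S"] fin by blast
qed

lemma algebraic_over:
  assumes r: "r \<in> S"
  shows "(ring.algebraic ambient over K) r"
proof -
  interpret R: Ring.field "ambient :: 'c ring" by (rule field_ambient)
  obtain f where f: "f \<in> polys_over K" "f \<noteq> 0" "poly f r = 0"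
    using S r unfolding separable_set_def by blast
  \<comment> \<open>Polynomials of HOL-Algebra are lists with the leading coefficient in front,
    while \<open>Poly\<close> reads the constant term first; hence the reversal.\<close>
  have ev: "R.eval (rev xs) r = poly (Poly xs) r" for xs
  proof -
    have "R.eval (ys @ [x]) r = R.eval ys r * r + x" for ys x
    proof (induction ys)
      case (Cons y ys)
      have pw: "r [^]\<^bsub>ambient\<^esub> n = r ^ n" for n :: nat
        by (induction n) (auto simp: mult.commute)
      show ?case using Cons by (simp add: pw algebra_simps)
    qed simp
    then show ?thesis by (induction xs) (auto simp: algebra_simps)
  qed
  have "rev (coeffs f) \<in> carrier (K[X]\<^bsub>ambient\<^esub>)"
    using f unfolding univ_poly_carrier[symmetric] polynomial_def
    by (auto simp: hd_rev last_coeffs_eq_coeff_degree coeffs_def polys_over_coeff)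
  then show ?thesis
    by (rule R.algebraicI) (use f ev[of "coeffs f"] in auto)
qed

lemma finite_dim: "ring.finite_dimension ambient K M"
proof -
  interpret R: Ring.field "ambient :: 'c ring" by (rule field_ambient)
  obtain xs where xs: "set xs = S"
    using finite_list[of S] S unfolding separable_set_def by metis
  have alg: "\<And>x. x \<in> set xs \<Longrightarrow> (R.algebraic over K) x" using algebraic_over xs by auto
  have sf: "subfield (R.finite_extension K xs) ambient"
    by (rule R.finite_extension_is_subfield[OF K]) (use alg in auto)
  have "R.finite_extension K xs = M"
  proof
    show "M \<subseteq> R.finite_extension K xs"
      unfolding M using R.finite_extension_mem[OF subfieldE(1)[OF K], of xs] xs
        R.finite_extension_incl[of K xs]
      by (intro field_adjoin_least[OF sf]) auto
    show "R.finite_extension K xs \<subseteq> M"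
      by (rule R.finite_extension_subring_incl[OF subfieldE(1)[OF M_subfield] K_le]) (use xs S_le in auto)
  qed
  then show ?thesis
    using R.finite_extension_finite_dimension(1)[OF K, of xs] alg by auto
qed

lemma is_finite_galois: "finite_galois M K"
  unfolding finite_galois_def
proof (intro conjI K M_subfield K_le finite_dim)
  show "{x \<in> M. \<forall>\<sigma>\<in>carrier (galois_group M K). \<sigma> x = x} = K"
    using galois_fixed_field[OF K order.refl K_le] K_le
    by (auto simp: galois_group_iff[OF M_subfield])
qed

lemma galois_trace:
  assumes x: "x \<in> M"
  shows "(\<Sum>\<tau>\<in>carrier (galois_group M K). \<tau> x) \<in> K"
proof (rule galois_fixed_field[OF K order.refl K_le])
  let ?G = "carrier (galois_group M K)"
  show "(\<Sum>\<tau>\<in>?G. \<tau> x) \<in> M"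
    by (intro sf_sum[OF M_subfield] galois_group_in[OF M_subfield _ x])
  fix \<sigma> assume \<sigma>: "\<sigma> \<in> ?G"
  have inj: "inj_on (compose M \<sigma>) ?G"
  proof (rule inj_onI)
    fix \<tau> \<tau>' assume t: "\<tau> \<in> ?G" "\<tau>' \<in> ?G" "compose M \<sigma> \<tau> = compose M \<sigma> \<tau>'"
    have inj: "inj_on \<sigma> M" using \<sigma> field_emb_inj[OF M_subfield] by (auto simp: galois_group_iff[OF M_subfield])
    show "\<tau> = \<tau>'"
    proof (rule extensionalityI[of _ M])
      fix y assume y: "y \<in> M"
      have "\<sigma> (\<tau> y) = \<sigma> (\<tau>' y)" using fun_cong[OF t(3), of y] y by (simp add: compose_def)
      then show "\<tau> y = \<tau>' y"
        using inj galois_group_in[OF M_subfield t(1) y] galois_group_in[OF M_subfield t(2) y]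
        by (simp add: inj_on_eq_iff)
    qed (use t in \<open>auto simp: galois_group_iff[OF M_subfield]\<close>)
  qed
  have "compose M \<sigma> ` ?G = ?G"
    by (rule endo_inj_surj[OF galois_finite _ inj])
      (use galois_group_compose[OF M_subfield K_le \<sigma>] in auto)
  then have bij: "bij_betw (compose M \<sigma>) ?G ?G" using inj by (simp add: bij_betw_def)
  have "\<sigma> (\<Sum>\<tau>\<in>?G. \<tau> x) = (\<Sum>\<tau>\<in>?G. \<sigma> (\<tau> x))"
    by (rule field_emb_sum[OF M_subfield])
      (use \<sigma> galois_group_in[OF M_subfield _ x] in \<open>auto simp: galois_group_iff[OF M_subfield]\<close>)
  also have "\<dots> = (\<Sum>\<tau>\<in>?G. compose M \<sigma> \<tau> x)" using x by (simp add: compose_def)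
  also have "\<dots> = (\<Sum>\<tau>\<in>?G. \<tau> x)" by (rule sum.reindex_bij_betw[OF bij])
  finally show "\<sigma> (\<Sum>\<tau>\<in>?G. \<tau> x) = (\<Sum>\<tau>\<in>?G. \<tau> x)" .
qed

end

section \<open>Valuations\<close>

locale valued =
  fixes w :: "'c::field \<Rightarrow> ereal"
  assumes valuation: "valuation w"
begin

lemma w_eq_PInf [simp]: "w x = \<infinity> \<longleftrightarrow> x = 0"
  and w_neq_MInf [simp]: "w x \<noteq> -\<infinity>"
  and w_mult: "w (x * y) = w x + w y"
  and w_add: "min (w x) (w y) \<le> w (x + y)"
  using valuation unfolding valuation_def by auto

lemma w_0 [simp]: "w 0 = \<infinity>" by simp

lemma w_real: assumes "x \<noteq> 0" obtains r where "w x = ereal r"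
  using w_eq_PInf[of x] w_neq_MInf[of x] assms by (cases "w x") auto

lemma w_1 [simp]: "w 1 = 0"
proof -
  obtain r where r: "w 1 = ereal r" by (rule w_real[of 1]) auto
  show ?thesis using w_mult[of 1 1] r by (simp add: zero_ereal_def)
qed

lemma w_minus [simp]: "w (- x) = w x"
proof -
  obtain r where r: "w (- 1) = ereal r" by (rule w_real[of "- 1"]) auto
  have "w (- 1) = 0" using w_mult[of "- 1" "- 1"] r by (simp add: zero_ereal_def)
  then show ?thesis using w_mult[of "- 1" x] by simp
qed

lemma w_minus_commute: "w (x - y) = w (y - x)"
  using w_minus[of "x - y"] by simp

lemma w_inverse: "x \<noteq> 0 \<Longrightarrow> w (inverse x) = - w x"
proof -
  assume x: "x \<noteq> 0"
  obtain r where r: "w x = ereal r" using x by (rule w_real)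
  obtain s where s: "w (inverse x) = ereal s" by (rule w_real[of "inverse x"]) (use x in auto)
  show ?thesis using w_mult[of x "inverse x"] x r s by (simp add: zero_ereal_def)
qed

lemma w_divide: "y \<noteq> 0 \<Longrightarrow> w (x / y) = w x - w y"
  by (simp add: divide_inverse w_mult w_inverse minus_ereal_def)

lemma w_power: "w (x ^ n) = ereal (real n) * w x"
proof (cases "x = 0")
  case True
  then show ?thesis by (cases "n = 0") (auto simp: zero_ereal_def[symmetric])
next
  case False
  then obtain r where r: "w x = ereal r" by (rule w_real)
  show ?thesis
    by (induction n) (auto simp: r w_mult algebra_simps zero_ereal_def[symmetric])
qed

lemma w_power_int: assumes "x \<noteq> 0" shows "w (x powi k) = ereal (of_int k) * w x"
proof -
  obtain r where r: "w x = ereal r" using assms by (rule w_real)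
  show ?thesis using assms by (simp add: power_int_def w_power w_inverse r)
qed

lemma w_prod: "w (prod f I) = (\<Sum>i\<in>I. w (f i))"
  by (induction I rule: infinite_finite_induct) (auto simp: w_mult)

lemma w_add_ge: "r \<le> w x \<Longrightarrow> r \<le> w y \<Longrightarrow> r \<le> w (x + y)"
  using w_add[of x y] by (meson min.boundedI order_trans)

lemma w_diff_ge: "r \<le> w x \<Longrightarrow> r \<le> w y \<Longrightarrow> r \<le> w (x - y)"
  using w_add_ge[of r x "- y"] by simp

lemma w_add_gt: "r < w x \<Longrightarrow> r < w y \<Longrightarrow> r < w (x + y)"
  using w_add[of x y] by (metis min_less_iff_conj order_less_le_trans)

lemma w_diff_gt: "r < w x \<Longrightarrow> r < w y \<Longrightarrow> r < w (x - y)"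
  using w_add_gt[of r x "- y"] by simp

lemma w_sum_ge: "(\<And>i. i \<in> I \<Longrightarrow> r \<le> w (f i)) \<Longrightarrow> r \<le> w (sum f I)"
  by (induction I rule: infinite_finite_induct) (auto intro: w_add_ge)

lemma w_add_eq: assumes "w x < w y" shows "w (x + y) = w x"
proof (rule antisym)
  show "w x \<le> w (x + y)" using w_add[of x y] assms by (simp add: min_def split: if_splits)
  show "w (x + y) \<le> w x"
  proof (rule ccontr)
    assume "\<not> w (x + y) \<le> w x"
    then have "w x < w (x + y - y)" using assms by (intro w_diff_gt) auto
    then show False by simp
  qed
qed

lemma w_add_eq': "w y < w x \<Longrightarrow> w (x + y) = w y"
  using w_add_eq[of y x] by (simp add: add.commute)

lemma w_diff_eq: "w x < w y \<Longrightarrow> w (x - y) = w x"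
  using w_add_eq[of x "- y"] by simp

lemma w_diff_eq': "w y < w x \<Longrightarrow> w (x - y) = w y"
  using w_add_eq'[of "- y" x] by simp

lemma w_mult_ge: "ereal r \<le> w x \<Longrightarrow> ereal s \<le> w y \<Longrightarrow> ereal (r + s) \<le> w (x * y)"
  unfolding w_mult plus_ereal.simps(1)[symmetric] by (rule add_mono)

lemma w_mult_int: "0 \<le> w x \<Longrightarrow> 0 \<le> w y \<Longrightarrow> 0 \<le> w (x * y)"
  by (simp add: w_mult)

lemma w_mult_int_ge: "0 \<le> w x \<Longrightarrow> r \<le> w y \<Longrightarrow> r \<le> w (x * y)"
  unfolding w_mult using add_mono[of 0 "w x" r "w y"] by simp

lemma w_power_int_ge: "0 \<le> w x \<Longrightarrow> 0 \<le> w (x ^ n)"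
  by (induction n) (auto simp: w_mult)

text \<open>With distinct valuations the ultrametric inequality becomes an equality. Zero terms all
  share the valuation \<infinity>, so distinctness can be asked of nonzero terms only.\<close>

lemma w_sum_distinct:
  assumes "finite I" "\<And>i j. i \<in> I \<Longrightarrow> j \<in> I \<Longrightarrow> i \<noteq> j \<Longrightarrow> f i \<noteq> 0 \<Longrightarrow> f j \<noteq> 0 \<Longrightarrow> w (f i) \<noteq> w (f j)"
  shows "I = {} \<or> (\<exists>i\<in>I. w (sum f I) = w (f i) \<and> (\<forall>j\<in>I. w (f i) \<le> w (f j)))"
  using assms
proof (induction I rule: finite_induct)
  case (insert a I)
  show ?case
  proof (cases "I = {}")
    case False
    then obtain i where i: "i \<in> I" "w (sum f I) = w (f i)" "\<forall>j\<in>I. w (f i) \<le> w (f j)"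
      using insert by (metis insertCI)
    have eq: "sum f (insert a I) = f a + sum f I" using insert by simp
    consider "f a = 0" | "f i = 0" | "f a \<noteq> 0" "f i \<noteq> 0" by auto
    then have "\<exists>i\<in>insert a I. w (sum f (insert a I)) = w (f i) \<and> (\<forall>j\<in>insert a I. w (f i) \<le> w (f j))"
    proof cases
      case 1
      then show ?thesis using eq i by (intro bexI[of _ i]) auto
    next
      case 2
      then have "sum f I = 0" using i(2) by simp
      then show ?thesis using eq i 2 by (intro bexI[of _ a]) auto
    next
      case 3
      have "w (f a) \<noteq> w (f i)"
        by (rule insert.prems) (use 3 i insert.hyps in auto)
      then consider "w (f a) < w (f i)" | "w (f i) < w (f a)" by (metis linorder_neqE)
      then show ?thesis
      proof cases
        case 1
        then show ?thesis
          using eq i w_add_eq[of "f a" "sum f I"] by (intro bexI[of _ a]) auto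
      next
        case 2
        then show ?thesis
          using eq i w_add_eq'[of "sum f I" "f a"] by (intro bexI[of _ i]) auto
      qed
    qed
    then show ?thesis by simp
  qed auto
qed auto

section \<open>Limits in the valuation topology\<close>

definition wlim :: "(nat \<Rightarrow> 'c) \<Rightarrow> 'c \<Rightarrow> bool"
  where "wlim f l \<longleftrightarrow> (\<forall>r::real. \<forall>\<^sub>F n in sequentially. ereal r \<le> w (f n - l))"

lemma wlim_iff: "wlim f l \<longleftrightarrow> (\<lambda>n. w (f n - l)) \<longlonglongrightarrow> \<infinity>"
  unfolding tendsto_PInfty wlim_def
proof safe
  fix r assume "\<forall>r. \<forall>\<^sub>F n in sequentially. ereal r \<le> w (f n - l)"
  then have "\<forall>\<^sub>F n in sequentially. ereal (r + 1) \<le> w (f n - l)" by blast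
  then show "\<forall>\<^sub>F n in sequentially. ereal r < w (f n - l)"
    by eventually_elim (metis ereal_less_eq(3) less_add_one linorder_not_le order_trans)
next
  fix r assume "\<forall>r. \<forall>\<^sub>F n in sequentially. ereal r < w (f n - l)"
  then have "\<forall>\<^sub>F n in sequentially. ereal r < w (f n - l)" by blast
  then show "\<forall>\<^sub>F n in sequentially. ereal r \<le> w (f n - l)" by eventually_elim simp
qed

lemma wlim_const: "wlim (\<lambda>_. c) c"
  by (simp add: wlim_def)

lemma wlim_add: "wlim f l \<Longrightarrow> wlim g m \<Longrightarrow> wlim (\<lambda>n. f n + g n) (l + m)"
  unfolding wlim_def
proof
  fix r assume a: "\<forall>r. \<forall>\<^sub>F n in sequentially. ereal r \<le> w (f n - l)" "\<forall>r. \<forall>\<^sub>F n in sequentially. ereal r \<le> w (g n - m)"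
  show "\<forall>\<^sub>F n in sequentially. ereal r \<le> w (f n + g n - (l + m))"
    using spec[OF a(1), of r] spec[OF a(2), of r]
  proof eventually_elim
    case (elim n)
    have "f n + g n - (l + m) = (f n - l) + (g n - m)" by simp
    then show ?case using w_add_ge elim by metis
  qed
qed

lemma wlim_minus: "wlim f l \<Longrightarrow> wlim (\<lambda>n. - f n) (- l)"
  unfolding wlim_def by (simp add: w_minus_commute add.commute)

lemma wlim_diff: "wlim f l \<Longrightarrow> wlim g m \<Longrightarrow> wlim (\<lambda>n. f n - g n) (l - m)"
  using wlim_add[of f l "\<lambda>n. - g n" "- m"] wlim_minus[of g m] by simp

lemma wlim_cmult: "wlim f l \<Longrightarrow> wlim (\<lambda>n. c * f n) (c * l)"
proof (cases "c = 0")
  case False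
  then obtain s where s: "w c = ereal s" by (rule w_real)
  assume f: "wlim f l"
  show ?thesis
    unfolding wlim_def
  proof
    fix r :: real
    have "\<forall>\<^sub>F n in sequentially. ereal (r - s) \<le> w (f n - l)"
      using f unfolding wlim_def by blast
    then show "\<forall>\<^sub>F n in sequentially. ereal r \<le> w (c * f n - c * l)"
    proof eventually_elim
      case (elim n)
      then show ?case
        using w_mult_ge[of s c "r - s" "f n - l"] s by (simp add: right_diff_distrib)
    qed
  qed
qed (simp add: wlim_const)

lemma wlim_mult: assumes "wlim f l" "wlim g m" shows "wlim (\<lambda>n. f n * g n) (l * m)"
proof -
  have "wlim (\<lambda>n. (f n - l) * (g n - m)) 0"
    unfolding wlim_def
  proof
    fix r :: real
    have "\<forall>\<^sub>F n in sequentially. ereal r \<le> w (f n - l)" "\<forall>\<^sub>F n in sequentially. ereal 0 \<le> w (g n - m)"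
      using assms unfolding wlim_def by blast+
    then show "\<forall>\<^sub>F n in sequentially. ereal r \<le> w ((f n - l) * (g n - m) - 0)"
      by eventually_elim (use w_mult_ge[of r _ 0] in force)
  qed
  from wlim_add[OF this wlim_add[OF wlim_cmult[OF assms(1), of m] wlim_cmult[OF wlim_diff[OF assms(2) wlim_const[of m]], of l]]]
  have "wlim (\<lambda>n. (f n - l) * (g n - m) + (m * f n + l * (g n - m))) (l * m)"
    by (simp add: mult.commute)
  moreover have "(\<lambda>n. (f n - l) * (g n - m) + (m * f n + l * (g n - m))) = (\<lambda>n. f n * g n)"
    by (rule ext) (simp add: algebra_simps)
  ultimately show ?thesis by simp
qed

lemma wlim_sum: "(\<And>i. i \<in> I \<Longrightarrow> wlim (\<lambda>n. f n i) (l i)) \<Longrightarrow> wlim (\<lambda>n. sum (f n) I) (sum l I)"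
  by (induction I rule: infinite_finite_induct) (auto intro: wlim_const wlim_add)

lemma wlim_ge:
  assumes "wlim f l" "\<forall>\<^sub>F n in sequentially. ereal r \<le> w (f n)"
  shows "ereal r \<le> w l"
proof -
  have "\<forall>\<^sub>F n in sequentially. ereal r \<le> w (f n - l)" using assms(1) unfolding wlim_def by blast
  with assms(2) have "\<forall>\<^sub>F n in sequentially. ereal r \<le> w l"
  proof eventually_elim
    case (elim n)
    then show ?case using w_diff_ge[of "ereal r" "f n" "f n - l"] by simp
  qed
  then show ?thesis by simp
qed

lemma wlim_unique: assumes "wlim f l" "wlim f m" shows "l = m"
proof -
  have "ereal r \<le> w (l - m)" for r
    by (rule wlim_ge[OF wlim_diff[OF assms]]) simp
  then have "w (l - m) = \<infinity>" by (metis PInfty_neq_ereal(1) ereal_top)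
  then show ?thesis by simp
qed

lemma wlim_imp_Cauchy:
  assumes "wlim f l"
  shows "\<exists>N. \<forall>m\<ge>N. \<forall>n\<ge>N. ereal r < w (f m - f n)"
proof -
  have "\<forall>\<^sub>F n in sequentially. ereal (r + 1) \<le> w (f n - l)" using assms unfolding wlim_def by blast
  then obtain N where N: "\<And>n. n \<ge> N \<Longrightarrow> ereal (r + 1) \<le> w (f n - l)"
    by (auto simp: eventually_sequentially)
  have "ereal r < w (f m - f n)" if "m \<ge> N" "n \<ge> N" for m n
  proof -
    have "ereal (r + 1) \<le> w ((f m - l) - (f n - l))" by (rule w_diff_ge[OF N N]) (rule that)+
    moreover have "ereal r < ereal (r + 1)" by simp
    ultimately show ?thesis by (simp del: less_ereal.simps)
  qed
  then show ?thesis by blast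
qed

lemma wlim_complete:
  assumes "val_complete w K" "\<And>n. f n \<in> K" "\<And>r. \<exists>N. \<forall>m\<ge>N. \<forall>n\<ge>N. ereal r < w (f m - f n)"
  obtains l where "l \<in> K" "wlim f l"
  using assms unfolding val_complete_def wlim_iff by metis

lemma wlim_closed:
  assumes "val_complete w K" "\<And>n. f n \<in> K" "wlim f l"
  shows "l \<in> K"
proof -
  obtain l' where "l' \<in> K" "wlim f l'"
    using wlim_complete[OF assms(1,2) wlim_imp_Cauchy[OF assms(3)]] .
  then show ?thesis using wlim_unique assms(3) by metis
qed

text \<open>Equivalence of norms on a finite-dimensional space over a complete field, in the
  direction that a small vector has small coordinates. It yields the uniqueness of the extended
  valuation.\<close>

lemma coord_bound:
  fixes m :: nat
  assumes K: "subfield K ambient" "val_complete w K"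
    and ind: "\<And>a i. (\<And>i. a i \<in> K) \<Longrightarrow> (\<Sum>i<m. a i * v i) = 0 \<Longrightarrow> i < m \<Longrightarrow> a i = 0"
  shows "\<exists>C::real. \<forall>a. (\<forall>i. a i \<in> K) \<longrightarrow> (\<forall>i<m. w (\<Sum>j<m. a j * v j) \<le> w (a i) + ereal C)"
  using ind
proof (induction m)
  case (Suc m)
  have "\<exists>C::real. \<forall>a. (\<forall>i. a i \<in> K) \<longrightarrow> (\<forall>i<m. w (\<Sum>j<m. a j * v j) \<le> w (a i) + ereal C)"
  proof (rule Suc.IH)
    fix a i assume a: "\<And>i. a i \<in> K" "(\<Sum>i<m. a i * v i) = 0" "i < m"
    have s: "(\<Sum>i<Suc m. (a(m := 0)) i * v i) = 0"
      using a(2) by simp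
    have "(a(m := 0)) i = 0"
    proof -
      have "\<And>k. (a(m := 0)) k \<in> K" using a(1) sf_0[OF K(1)] by simp
      then show ?thesis by (rule Suc.prems[OF _ s]) (use a(3) in simp)
    qed
    then show "a i = 0" using a by simp
  qed
  then obtain C where C: "\<And>a i. (\<And>i. a i \<in> K) \<Longrightarrow> i < m \<Longrightarrow> w (\<Sum>j<m. a j * v j) \<le> w (a i) + ereal C"
    by blast
  \<comment> \<open>\<open>v m\<close> keeps its distance from the span of the earlier vectors: the
    coefficients of ever better approximations would be Cauchy by the bound \<open>C\<close>, and
    their limits in \<open>K\<close> would give a linear relation.\<close>
  have "\<exists>C'::real. \<forall>a. (\<forall>i. a i \<in> K) \<longrightarrow> w (v m + (\<Sum>j<m. a j * v j)) \<le> ereal C'"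
  proof (rule ccontr)
    assume "\<not> ?thesis"
    then have "\<forall>n::nat. \<exists>a. (\<forall>i. a i \<in> K) \<and> ereal (real n) < w (v m + (\<Sum>j<m. a j * v j))"
      by (meson not_le)
    then obtain A where A: "\<And>n i. A n i \<in> K"
      "\<And>n::nat. ereal (real n) < w (v m + (\<Sum>j<m. A n j * v j))" by metis
    have "\<exists>b\<in>K. wlim (\<lambda>n. A n i) b" if i: "i < m" for i
    proof -
      have "\<exists>N. \<forall>n\<ge>N. \<forall>k\<ge>N. ereal r < w (A n i - A k i)" for r
      proof (intro exI allI impI)
        fix n k assume nk: "nat \<lceil>r + C\<rceil> \<le> n" "nat \<lceil>r + C\<rceil> \<le> k"
        have "ereal (r + C) < w ((v m + (\<Sum>j<m. A n j * v j)) - (v m + (\<Sum>j<m. A k j * v j)))"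
        proof (rule w_diff_gt)
          have "ereal (r + C) \<le> ereal (real n)" "ereal (r + C) \<le> ereal (real k)" using nk by (simp_all add: nat_le_iff) linarith+
          then show "ereal (r + C) < w (v m + (\<Sum>j<m. A n j * v j))" "ereal (r + C) < w (v m + (\<Sum>j<m. A k j * v j))"
            using A(2) order_le_less_trans by blast+
        qed
        also have "(v m + (\<Sum>j<m. A n j * v j)) - (v m + (\<Sum>j<m. A k j * v j)) = (\<Sum>j<m. (A n j - A k j) * v j)"
          by (simp add: sum_subtractf left_diff_distrib)
        also have "w \<dots> \<le> w (A n i - A k i) + ereal C"
          using C[of "\<lambda>j. A n j - A k j" i] i A(1) by (simp add: sf_diff[OF K(1)])
        finally show "ereal r < w (A n i - A k i)" by (cases "w (A n i - A k i)") auto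
      qed
      then show ?thesis using wlim_complete[OF K(2), of "\<lambda>n. A n i"] A(1) by metis
    qed
    then obtain b where b: "\<And>i. i < m \<Longrightarrow> b i \<in> K" "\<And>i. i < m \<Longrightarrow> wlim (\<lambda>n. A n i) (b i)" by metis
    have "wlim (\<lambda>n. \<Sum>j<m. A n j * v j) (\<Sum>j<m. b j * v j)"
      by (rule wlim_sum) (use b(2) wlim_cmult in \<open>auto simp: mult.commute\<close>)
    from wlim_add[OF wlim_const this, of "v m"]
    have l1: "wlim (\<lambda>n. v m + (\<Sum>j<m. A n j * v j)) (v m + (\<Sum>j<m. b j * v j))" .
    have l2: "wlim (\<lambda>n. v m + (\<Sum>j<m. A n j * v j)) 0"
      unfolding wlim_def
    proof
      fix r :: real
      show "\<forall>\<^sub>F n in sequentially. ereal r \<le> w (v m + (\<Sum>j<m. A n j * v j) - 0)"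
        using eventually_ge_at_top[of "nat \<lceil>r\<rceil>"]
      proof eventually_elim
        case (elim n)
        then have "ereal r \<le> ereal (real n)" by (simp add: nat_le_iff) linarith
        from order_trans[OF this less_imp_le[OF A(2)[of n]]] show ?case by simp
      qed
    qed
    define c where "c i = (if i < m then b i else if i = m then 1 else 0)" for i
    have cK: "c i \<in> K" for i using b(1) sf_0[OF K(1)] sf_1[OF K(1)] by (simp add: c_def)
    have "(\<Sum>i<Suc m. c i * v i) = v m + (\<Sum>j<m. b j * v j)"
      by (simp add: c_def add.commute)
    also have "\<dots> = 0" using wlim_unique[OF l1 l2] .
    finally have "c m = 0" by (intro Suc.prems[OF cK]) auto
    then show False by (simp add: c_def)
  qed
  then obtain C' where C': "\<And>a. (\<And>i. a i \<in> K) \<Longrightarrow> w (v m + (\<Sum>j<m. a j * v j)) \<le> ereal C'"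
    by blast
  have vm: "v m \<noteq> 0"
  proof
    assume "v m = 0"
    then have "(\<Sum>i<Suc m. (if i = m then 1 else 0) * v i) = 0" by (auto intro: sum.neutral)
    then have "(if m = m then 1 else 0) = (0::'c)"
      by (intro Suc.prems[of "\<lambda>i. if i = m then 1 else 0" m]) (auto simp: sf_0[OF K(1)] sf_1[OF K(1)])
    then show False by simp
  qed
  then obtain s where s: "w (v m) = ereal s" by (rule w_real)
  \<comment> \<open>\<open>C0\<close> pays for passing from \<open>x\<close> to
    \<open>y = x - a m * v m\<close>: the subtracted term has valuation at least
    \<open>w x - C' + s\<close>.\<close>
  define C0 where "C0 = max 0 (C' - s)"
  define D where "D = max C' (C + C0)"
  have C0: "0 \<le> C0" "C' - s \<le> C0" by (auto simp: C0_def)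
  have D: "C' \<le> D" "C + C0 \<le> D" by (auto simp: D_def)
  have "w (\<Sum>j<Suc m. a j * v j) \<le> w (a i) + ereal D" if a: "\<And>i. a i \<in> K" and i: "i < Suc m" for a i
  proof -
    define x where "x = (\<Sum>j<Suc m. a j * v j)"
    define y where "y = (\<Sum>j<m. a j * v j)"
    have x: "x = y + a m * v m" by (simp add: x_def y_def)
    have xa: "w x \<le> w (a m) + ereal C'"
    proof (cases "a m = 0")
      case False
      have "x = a m * (v m + (\<Sum>j<m. (a j / a m) * v j))"
        using False by (simp add: x y_def sum_distrib_left algebra_simps)
      also have "w \<dots> \<le> w (a m) + ereal C'"
        unfolding w_mult by (intro add_left_mono C' sf_divide[OF K(1)] a)
      finally show ?thesis .
    qed simp
    have "w x \<le> w (a i) + ereal D"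
    proof (cases "i = m")
      case True
      have "w (a m) + ereal C' \<le> w (a m) + ereal D" by (intro add_left_mono) (simp add: D)
      then show ?thesis using xa True by (metis order_trans)
    next
      case False
      then have i': "i < m" using i by simp
      have y1: "w x \<le> w y + ereal C0"
      proof (cases "a m = 0")
        case True
        then show ?thesis using x C0 by (cases "w y") auto
      next
        case False
        then obtain t where t: "w (a m) = ereal t" by (rule w_real)
        have "y = x - a m * v m" using x by simp
        then have "min (w x) (w (a m * v m)) \<le> w y"
          using w_add[of x "- (a m * v m)"] by simp
        then show ?thesis
          using xa unfolding w_mult s t
          using C0 by (cases "w x"; cases "w y") (auto simp: min_def split: if_splits)
      qed
      have "w y \<le> w (a i) + ereal C" unfolding y_def by (rule C[OF a i'])
      then have "w y + ereal C0 \<le> w (a i) + ereal C + ereal C0" by (rule add_right_mono)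
      also have "\<dots> \<le> w (a i) + ereal D"
        using D by (cases "w (a i)") auto
      finally show ?thesis using y1 by (rule order_trans[rotated])
    qed
    then show ?thesis by (simp add: x_def)
  qed
  then show ?case by blast
qed auto

lemma min_poly_coord_bound:
  assumes K: "subfield K ambient" "val_complete w K" and g: "is_min_poly K x g"
  obtains C :: real where "\<And>h i. h \<in> polys_over K \<Longrightarrow> Polynomial.degree h < Polynomial.degree g \<Longrightarrow>
    w (poly h x) \<le> w (Polynomial.coeff h i) + ereal C"
proof -
  let ?m = "Polynomial.degree g"
  have eval: "poly h x = (\<Sum>i<?m. Polynomial.coeff h i * x ^ i)" if "Polynomial.degree h < ?m" for h
    unfolding poly_altdef using that
    by (intro sum.mono_neutral_left) (auto simp: coeff_eq_0)
  have "\<exists>C::real. \<forall>a. (\<forall>i. a i \<in> K) \<longrightarrow> (\<forall>i<?m. w (\<Sum>j<?m. a j * x ^ j) \<le> w (a i) + ereal C)"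
  proof (rule coord_bound[OF K])
    fix a i assume a: "\<And>i. a i \<in> K" "(\<Sum>i<?m. a i * x ^ i) = 0" and i: "i < ?m"
    define h where "h = (\<Sum>i<?m. Polynomial.monom (a i) i)"
    have ch: "Polynomial.coeff h i = (if i < ?m then a i else 0)" for i
      unfolding h_def by (simp add: coeff_sum if_distrib sum.delta cong: if_cong)
    have hK: "h \<in> polys_over K" unfolding polys_over_def using a sf_0[OF K(1)] by (simp add: ch)
    have deg: "Polynomial.degree h < ?m"
      using i ch by (metis degree_lessI gr_implies_not0 gr_zeroI leD)
    have "poly h x = 0" unfolding eval[OF deg] using a(2) by (simp add: ch)
    then have "h = 0" using g hK deg by (force simp: is_min_poly_def)
    then show "a i = 0" using ch[of i] i by simp
  qed
  then obtain C :: real where C: "\<And>a i. (\<And>i. a i \<in> K) \<Longrightarrow> i < ?m \<Longrightarrow> w (\<Sum>j<?m. a j * x ^ j) \<le> w (a i) + ereal C"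
    by blast
  show ?thesis
  proof
    fix h i assume h: "h \<in> polys_over K" "Polynomial.degree h < ?m"
    show "w (poly h x) \<le> w (Polynomial.coeff h i) + ereal C"
    proof (cases "i < ?m")
      case True
      then show ?thesis unfolding eval[OF h(2)] using C polys_over_coeff[OF h(1)] by blast
    next
      case False
      then have "Polynomial.coeff h i = 0" using h(2) by (simp add: coeff_eq_0)
      then show ?thesis by simp
    qed
  qed
qed

text \<open>Reduce \<open>x ^ n\<close> modulo \<open>g\<close>: by the coordinate bound its
  coefficients have valuation at least \<open>n r - C\<close>. Evaluating the same polynomial at
  \<open>\<tau> x\<close>, of valuation \<open>s \<le> 0\<close>, shows that
  \<open>\<tau> x ^ n\<close> has valuation at least \<open>n r - C + m s\<close> with
  \<open>m\<close> the degree of \<open>g\<close>. This contradicts \<open>n s \<le> 0\<close> for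
  large \<open>n\<close>.\<close>

lemma emb_pos:
  assumes K: "subfield K ambient" "val_complete w K" and M: "subfield M ambient" "K \<subseteq> M"
    and \<tau>: "field_emb M \<tau>" "\<And>x. x \<in> K \<Longrightarrow> \<tau> x = x"
    and x: "x \<in> M" and g: "is_min_poly K x g" and pos: "0 < w x"
  shows "0 < w (\<tau> x)"
proof (rule ccontr)
  assume np: "\<not> 0 < w (\<tau> x)"
  have x0: "x \<noteq> 0" using np field_emb_0[OF M(1) \<tau>(1)] by auto
  then have "\<tau> x \<noteq> 0" using field_emb_eq_0[OF M(1) \<tau>(1) x] by simp
  then obtain s where s: "w (\<tau> x) = ereal s" by (rule w_real)
  obtain r where r: "w x = ereal r" using x0 by (rule w_real)
  have rs: "0 < r" "s \<le> 0" using pos np r s by (auto simp: zero_ereal_def)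
  obtain C :: real where C: "\<And>h i. h \<in> polys_over K \<Longrightarrow> Polynomial.degree h < Polynomial.degree g \<Longrightarrow>
    w (poly h x) \<le> w (Polynomial.coeff h i) + ereal C"
    using min_poly_coord_bound[OF K g] by blast
  let ?m = "Polynomial.degree g"
  have bound: "real n * r - C + real ?m * s \<le> real n * s" for n
  proof -
    have "x ^ n \<in> simple_ext K x"
      using sf_power[OF simple_ext_subfield[OF K(1) g]] simple_ext_incl[OF K(1)] by blast
    then obtain h where h: "h \<in> polys_over K" "x ^ n = poly h x" "Polynomial.degree h < ?m"
      using simple_ext_reduced[OF K(1) g] by blast
    have wc: "ereal (real n * r - C) \<le> w (Polynomial.coeff h i)" for i
      using C[OF h(1,3), of i] unfolding h(2)[symmetric] w_power r
      by (cases "w (Polynomial.coeff h i)") auto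
    have "ereal (real n * s) = w (\<tau> x ^ n)" by (simp add: w_power s)
    also have "\<tau> x ^ n = poly h (\<tau> x)"
      using field_emb_fixed_poly[OF K(1) M \<tau> h(1) x] field_emb_power[OF M(1) \<tau>(1) x, of n] h(2) by simp
    also have "ereal (real n * r - C + real ?m * s) \<le> w (poly h (\<tau> x))"
      unfolding poly_altdef
    proof (rule w_sum_ge)
      fix i assume i: "i \<in> {..Polynomial.degree h}"
      have "real ?m * s \<le> real i * s"
        using i h(3) rs(2) by (intro mult_right_mono_neg) auto
      then have "ereal (real ?m * s) \<le> w (\<tau> x ^ i)" by (simp add: w_power s)
      then show "ereal (real n * r - C + real ?m * s) \<le> w (Polynomial.coeff h i * \<tau> x ^ i)"
        by (rule w_mult_ge[OF wc])
    qed
    finally show ?thesis by simp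
  qed
  obtain n :: nat where "(C - real ?m * s) / r < real n" using reals_Archimedean2 by blast
  then have "C - real ?m * s < real n * r" using rs by (simp add: field_simps)
  moreover have "real n * s \<le> 0" using rs by (simp add: mult_nonneg_nonpos)
  ultimately show False using bound[of n] by linarith
qed

text \<open>If the valuations of \<open>x\<close> and \<open>\<tau> x\<close> differed, a fraction
  \<open>p / k\<close> would lie strictly between them. Then \<open>x ^ k / \<pi> powi p\<close> and
  its image would have valuations of opposite sign, which \<open>emb_pos\<close> forbids for the
  element or for its inverse.\<close>

lemma emb_isometry:
  assumes K: "subfield K ambient" "val_complete w K" and M: "subfield M ambient" "K \<subseteq> M"
    and \<tau>: "field_emb M \<tau>" "\<And>x. x \<in> K \<Longrightarrow> \<tau> x = x"
    and alg: "\<And>x. x \<in> M \<Longrightarrow> \<exists>g. is_min_poly K x g" and x: "x \<in> M"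
    and \<pi>: "\<pi> \<in> K" "w \<pi> = 1"
  shows "w (\<tau> x) = w x"
proof (cases "x = 0")
  case True
  then show ?thesis using field_emb_0[OF M(1) \<tau>(1)] by simp
next
  case False
  have \<pi>0: "\<pi> \<noteq> 0" using \<pi>(2) by auto
  have \<tau>x0: "\<tau> x \<noteq> 0" using field_emb_eq_0[OF M(1) \<tau>(1) x] False by simp
  then obtain s where s: "w (\<tau> x) = ereal s" by (rule w_real)
  obtain r where r: "w x = ereal r" using False by (rule w_real)
  have pos: "0 < w (\<tau> y)" if "y \<in> M" "0 < w y" for y
    using alg[OF that(1)] emb_pos[OF K M \<tau> that(1) _ that(2)] by blast
  define y where "y k p = x ^ k / \<pi> powi p" for k :: nat and p
  have \<pi>p: "\<pi> powi p \<in> K" for p using \<pi>(1)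
    by (simp add: power_int_def sf_power[OF K(1)] sf_inverse[OF K(1)] power_inverse)
  have yM: "y k p \<in> M" for k p
    using sf_divide[OF M(1) sf_power[OF M(1) x]] \<pi>p M(2) by (auto simp: y_def)
  have wy: "w (y k p) = ereal (real k * r - of_int p)" for k p
    using \<pi>0 by (simp add: y_def w_divide w_power w_power_int \<pi> r)
  have \<tau>y: "\<tau> (y k p) = \<tau> x ^ k / \<pi> powi p" for k p
    unfolding y_def using field_emb_divide[OF M(1) \<tau>(1) sf_power[OF M(1) x], of "\<pi> powi p"]
      M(2) \<pi>p \<tau>(2)[OF \<pi>p] field_emb_power[OF M(1) \<tau>(1) x] by auto
  have w\<tau>y: "w (\<tau> (y k p)) = ereal (real k * s - of_int p)" for k p
    using \<pi>0 by (simp add: \<tau>y w_divide w_power w_power_int \<pi> s)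
  have y0: "y k p \<noteq> 0" for k p using False \<pi>0 by (simp add: y_def)
  have iy: "\<tau> (inverse (y k p)) = inverse (\<tau> (y k p))" for k p
    by (rule field_emb_inverse[OF M(1) \<tau>(1) yM])
  have \<tau>y0: "\<tau> (y k p) \<noteq> 0" for k p using field_emb_eq_0[OF M(1) \<tau>(1) yM] y0 by simp
  have key: "\<not> (of_int p < real k * r \<and> real k * s < of_int p)" for k p
    using pos[OF yM, of k p] by (auto simp: wy w\<tau>y zero_ereal_def)
  have key2: "\<not> (real k * r < of_int p \<and> of_int p < real k * s)" for k p
    using pos[OF sf_inverse[OF M(1) yM], of k p] y0 \<tau>y0
    by (auto simp: iy w_inverse wy w\<tau>y zero_ereal_def)
  have between: "\<exists>k::nat. \<exists>p::int. real k * a < of_int p \<and> of_int p < real k * b" if ab: "a < b" for a b :: real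
  proof -
    obtain k :: nat where k: "1 / (b - a) < real k" using reals_Archimedean2 by blast
    then have "1 < real k * b - real k * a" using ab by (simp add: field_simps)
    then have "real k * a < of_int (\<lfloor>real k * a\<rfloor> + 1) \<and> of_int (\<lfloor>real k * a\<rfloor> + 1) < real k * b"
      by linarith
    then show ?thesis by blast
  qed
  have "r = s"
    using between[of r s] between[of s r] key key2 by (metis linorder_neqE_linordered_idom)
  then show ?thesis using r s by simp
qed

text \<open>The terms of \<open>h(a)\<close> have distinct valuations and cannot cancel.\<close>

lemma ramified_values:
  assumes N: "subfield N ambient"
    and NZ: "\<And>x. x \<in> N \<Longrightarrow> x \<noteq> 0 \<Longrightarrow> \<exists>k::int. w x = ereal (of_int k)"
    and a: "w a = ereal \<rho>" and m: "\<And>i. 0 < i \<Longrightarrow> i < m \<Longrightarrow> real i * \<rho> \<notin> \<int>"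
    and h: "h \<in> polys_over N" "Polynomial.degree h < m"
  shows "w (poly h a) \<le> w (Polynomial.coeff h i * a ^ i)"
    and "h \<noteq> 0 \<Longrightarrow> \<exists>i<m. Polynomial.coeff h i \<noteq> 0 \<and> w (poly h a) = w (Polynomial.coeff h i * a ^ i)"
proof -
  let ?f = "\<lambda>i. Polynomial.coeff h i * a ^ i"
  have a0: "a \<noteq> 0" using a by auto
  have eval: "poly h a = (\<Sum>i<m. ?f i)"
    unfolding poly_altdef using h(2)
    by (intro sum.mono_neutral_left) (auto simp: coeff_eq_0)
  have ne: "w (?f i) \<noteq> w (?f j)" if ij: "i < j" "j < m" "?f i \<noteq> 0" "?f j \<noteq> 0" for i j
  proof
    assume e: "w (?f i) = w (?f j)"
    obtain k :: int where k: "w (Polynomial.coeff h i) = ereal (of_int k)"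
      using NZ[OF polys_over_coeff[OF h(1)]] ij(3) by auto
    obtain l :: int where l: "w (Polynomial.coeff h j) = ereal (of_int l)"
      using NZ[OF polys_over_coeff[OF h(1)]] ij(4) by auto
    have "of_int k + real i * \<rho> = of_int l + real j * \<rho>"
      using e by (simp add: w_mult w_power k l a)
    then have "real (j - i) * \<rho> = of_int (k - l)" using ij(1) by (simp add: of_nat_diff algebra_simps)
    then have "real (j - i) * \<rho> \<in> \<int>" by simp
    then show False using m[of "j - i"] ij(1,2) by (meson diff_le_self le_less_trans zero_less_diff)
  qed
  have "{..<m} = {} \<or> (\<exists>i\<in>{..<m}. w (sum ?f {..<m}) = w (?f i) \<and> (\<forall>j\<in>{..<m}. w (?f i) \<le> w (?f j)))"
  proof (rule w_sum_distinct)
    fix i j assume "i \<in> {..<m}" "j \<in> {..<m}" "i \<noteq> j" "?f i \<noteq> 0" "?f j \<noteq> 0"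
    then show "w (?f i) \<noteq> w (?f j)" using ne[of i j] ne[of j i] by (metis lessThan_iff linorder_neqE_nat)
  qed simp
  moreover have "{..<m} \<noteq> {}" using h(2) by auto
  ultimately obtain i0 where i0: "i0 < m" "w (poly h a) = w (?f i0)" "\<And>j. j < m \<Longrightarrow> w (?f i0) \<le> w (?f j)"
    unfolding eval by auto
  show "w (poly h a) \<le> w (?f i)"
  proof (cases "i < m")
    case True
    then show ?thesis using i0 by simp
  next
    case False
    then have "Polynomial.coeff h i = 0" using h(2) by (simp add: coeff_eq_0)
    then show ?thesis by simp
  qed
  assume h0: "h \<noteq> 0"
  have "?f i0 \<noteq> 0"
  proof
    assume "?f i0 = 0"
    then have "w (?f i0) = \<infinity>" by (simp only: w_eq_PInf)
    then have "w (?f j) = \<infinity>" if "j < m" for j using i0(3)[OF that] by (simp only: ereal_infty_less_eq)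
    from this[OF h(2)] have "Polynomial.lead_coeff h = 0" using a0 by simp
    then show False using h0 by simp
  qed
  then show "\<exists>i<m. Polynomial.coeff h i \<noteq> 0 \<and> w (poly h a) = w (?f i)" using i0 by auto
qed

text \<open>In the role of Eisenstein's criterion: a nonzero polynomial of degree below
  \<open>m\<close> takes at \<open>a\<close> the valuation of one of its nonzero terms, so it cannot
  vanish there.\<close>

lemma ramified_min_poly:
  assumes N: "subfield N ambient"
    and NZ: "\<And>x. x \<in> N \<Longrightarrow> x \<noteq> 0 \<Longrightarrow> \<exists>k::int. w x = ereal (of_int k)"
    and a: "w a = ereal \<rho>" and m: "\<And>i. 0 < i \<Longrightarrow> i < m \<Longrightarrow> real i * \<rho> \<notin> \<int>"
    and f: "f \<in> polys_over N" "Polynomial.degree f = m" "0 < m" "poly f a = 0"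
  shows "is_min_poly N a (Polynomial.smult (inverse (Polynomial.lead_coeff f)) f)"
  unfolding is_min_poly_def
proof (intro conjI ballI impI)
  have f0: "f \<noteq> 0" using f by auto
  show "Polynomial.smult (inverse (Polynomial.lead_coeff f)) f \<in> polys_over N"
    by (intro polys_over_smult[OF N] sf_inverse[OF N] polys_over_coeff f)
  show "Polynomial.lead_coeff (Polynomial.smult (inverse (Polynomial.lead_coeff f)) f) = 1"
    using f0 by simp
  show "poly (Polynomial.smult (inverse (Polynomial.lead_coeff f)) f) a = 0" using f(4) by simp
  fix h assume h: "h \<in> polys_over N" "h \<noteq> 0" "poly h a = 0"
  have "\<not> Polynomial.degree h < m"
  proof
    assume "Polynomial.degree h < m"
    from ramified_values(2)[OF N NZ a m h(1) this h(2)] obtain i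
      where "Polynomial.coeff h i \<noteq> 0" "w (poly h a) = w (Polynomial.coeff h i * a ^ i)" by auto
    moreover have "a \<noteq> 0" using a by auto
    ultimately show False using h(3) w_eq_PInf[of "Polynomial.coeff h i * a ^ i"] by simp
  qed
  then show "Polynomial.degree (Polynomial.smult (inverse (Polynomial.lead_coeff f)) f) \<le> Polynomial.degree h"
    using f0 f(2) by simp
qed

end

lemma galois_generators_algebraic:
  fixes K :: "'c::alg_closed_field set"
  assumes gen: "galois_generators K S M" and x: "x \<in> M"
  shows "\<exists>g. is_min_poly K x g"
proof -
  interpret galois_generators K S M by (rule gen)
  interpret R: Ring.field "ambient :: 'c ring" by (rule field_ambient)
  have alg: "(R.algebraic over K) x"
    using R.finite_dimension_imp_algebraic[OF K subfieldE(1)[OF M_subfield] finite_dim x] .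
  obtain p where p: "p \<in> carrier (K[X]\<^bsub>ambient\<^esub>)" "p \<noteq> []" "R.eval p x = 0"
    using R.algebraicE[OF subfieldE(1)[OF K] _ alg] by auto
  have pw: "x [^]\<^bsub>ambient\<^esub> n = x ^ n" for n :: nat
    by (induction n) (auto simp: mult.commute)
  have ev: "R.eval ys x = poly (Poly (rev ys)) x" for ys
    by (induction ys) (auto simp: pw Poly_append poly_monom)
  have pol: "set p \<subseteq> K" "hd p \<noteq> 0"
    using p(1,2) unfolding univ_poly_carrier[symmetric] polynomial_def by auto
  define f where "f = Poly (rev p)"
  have "f \<in> polys_over K"
    using pol(1) sf_0[OF K] nth_mem[of _ "rev p"] unfolding f_def polys_over_def
    by (auto simp: coeff_Poly_eq nth_default_def simp del: nth_mem)
  moreover have "f \<noteq> 0"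
  proof
    assume "f = 0"
    then obtain n where "rev p = replicate n 0" unfolding f_def by (auto simp: Poly_eq_0)
    then have "\<forall>y\<in>set (rev p). y = 0" by simp
    then have "\<forall>y\<in>set p. y = 0" by simp
    then show False using pol(2) p(2) by simp
  qed
  moreover have "poly f x = 0" using p(3) ev by (simp add: f_def)
  ultimately show ?thesis using is_min_poly_exists[OF K] by metis
qed

locale valued_closed = valued w for w :: "'c::alg_closed_field \<Rightarrow> ereal"
begin

text \<open>If every nontrivial automorphism is detected on the residue field, the product of the
  \<open>(\<tau> b - \<sigma> b) / (b - \<sigma> b)\<close> over all \<open>\<sigma> \<noteq> 1\<close> is the indicator function of \<open>\<tau> = 1\<close>. It is an
  integral combination of functions \<open>\<tau> \<mapsto> \<tau> c\<close>, so that \<open>x\<close> is an integral combination of traces of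
  integral multiples of \<open>x\<close>.\<close>

lemma unramified_values:
  assumes gen: "galois_generators K S M" and Kc: "val_complete w K"
    and \<pi>: "\<pi> \<in> K" "w \<pi> = 1"
    and KZ: "\<And>x. x \<in> K \<Longrightarrow> x \<noteq> 0 \<Longrightarrow> \<exists>k::int. w x = ereal (of_int k)"
    and mv: "\<And>\<sigma>. \<sigma> \<in> carrier (galois_group M K) \<Longrightarrow> \<sigma> \<noteq> restrict id M \<Longrightarrow> \<exists>b\<in>M. 0 \<le> w b \<and> w (\<sigma> b - b) = 0"
    and x: "x \<in> M" "x \<noteq> 0"
  shows "\<exists>k::int. w x = ereal (of_int k)"
proof -
  interpret galois_generators K S M by (rule gen)
  note alg = galois_generators_algebraic[OF gen]
  let ?G = "carrier (galois_group M K)"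
  note G_iff = galois_group_iff[OF M_subfield]
  \<comment> \<open>Summation against a good \<open>f\<close> rounds valuations up: beyond
    \<open>r - 1\<close> becomes at least the integer \<open>r\<close>. For \<open>f = 1\<close>
    this is the trace, whose values lie in \<open>K\<close> and have integral valuation.\<close>
  define good where "good f \<longleftrightarrow> (\<forall>x\<in>M. \<forall>r::int. ereal (of_int r - 1) < w x \<longrightarrow>
    ereal (of_int r) \<le> w (\<Sum>\<tau>\<in>?G. f \<tau> * \<tau> x))" for f
  have iso: "w (\<sigma> y) = w y" if "\<sigma> \<in> ?G" "y \<in> M" for \<sigma> y
    using that G_iff by (intro emb_isometry[OF K Kc M_subfield K_le _ _ alg _ \<pi>]) auto
  have good1: "good (\<lambda>_. 1)"
    unfolding good_def
  proof (intro ballI allI impI)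
    fix y and r :: int assume y: "y \<in> M" "ereal (of_int r - 1) < w y"
    let ?t = "\<Sum>\<tau>\<in>?G. 1 * \<tau> y"
    show "ereal (of_int r) \<le> w ?t"
    proof (cases "?t = 0")
      case False
      have "?t \<in> K" using galois_trace[OF y(1)] by simp
      then obtain k :: int where k: "w ?t = ereal (of_int k)" using KZ False by blast
      have "w y \<le> w ?t" by (rule w_sum_ge) (use iso y(1) in auto)
      then have "ereal (of_int r - 1) < ereal (of_int k)" using k y(2) by (metis order_less_le_trans)
      then show ?thesis unfolding k by simp
    qed simp
  qed
  \<comment> \<open>The factor \<open>\<tau> b\<close> is absorbed into the argument, as
    \<open>\<tau> b * \<tau> y = \<tau> (b * y)\<close> and \<open>b * y\<close> has at least the
    valuation of \<open>y\<close>. Multiplying by the integral \<open>c\<close> and dividing by the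
    unit \<open>d\<close> preserve the bound.\<close>
  have good_step: "good (\<lambda>\<tau>. f \<tau> * ((\<tau> b - c) / d))"
    if f: "good f" and b: "b \<in> M" "0 \<le> w b" and c: "0 \<le> w c" and d: "w d = 0" for f b c d
    unfolding good_def
  proof (intro ballI allI impI)
    fix y and r :: int assume y: "y \<in> M" "ereal (of_int r - 1) < w y"
    have d0: "d \<noteq> 0" using d by auto
    have "w y \<le> w (b * y)" by (rule w_mult_int_ge[OF b(2)]) simp
    then have "ereal (of_int r - 1) < w (b * y)" using y(2) by simp
    then have 1: "ereal (of_int r) \<le> w (\<Sum>\<tau>\<in>?G. f \<tau> * \<tau> (b * y))"
      using f sf_mult[OF M_subfield b(1) y(1)] unfolding good_def by blast
    have 2: "ereal (of_int r) \<le> w (\<Sum>\<tau>\<in>?G. f \<tau> * \<tau> y)"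
      using f y unfolding good_def by blast
    have "(\<Sum>\<tau>\<in>?G. f \<tau> * ((\<tau> b - c) / d) * \<tau> y) =
      ((\<Sum>\<tau>\<in>?G. f \<tau> * \<tau> (b * y)) - c * (\<Sum>\<tau>\<in>?G. f \<tau> * \<tau> y)) / d"
    proof -
      have "(\<Sum>\<tau>\<in>?G. f \<tau> * \<tau> (b * y)) = (\<Sum>\<tau>\<in>?G. f \<tau> * (\<tau> b * \<tau> y))"
        using field_emb_mult[OF M_subfield _ b(1) y(1)] G_iff by (intro sum.cong) auto
      then show ?thesis
        using d0 by (simp add: sum_distrib_left sum_subtractf[symmetric] sum_divide_distrib algebra_simps diff_divide_distrib)
    qed
    then show "ereal (of_int r) \<le> w (\<Sum>\<tau>\<in>?G. f \<tau> * ((\<tau> b - c) / d) * \<tau> y)"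
      using w_diff_ge[OF 1 w_mult_int_ge[OF c 2]] d d0 by (simp add: w_divide)
  qed
  let ?H = "?G - {restrict id M}"
  obtain b where b: "\<And>\<sigma>. \<sigma> \<in> ?H \<Longrightarrow> b \<sigma> \<in> M" "\<And>\<sigma>. \<sigma> \<in> ?H \<Longrightarrow> 0 \<le> w (b \<sigma>)"
    "\<And>\<sigma>. \<sigma> \<in> ?H \<Longrightarrow> w (\<sigma> (b \<sigma>) - b \<sigma>) = 0"
    using mv by (metis DiffE insertCI)
  have prod: "good (\<lambda>\<tau>. \<Prod>\<sigma>\<in>A. (\<tau> (b \<sigma>) - \<sigma> (b \<sigma>)) / (b \<sigma> - \<sigma> (b \<sigma>)))" if A: "finite A" "A \<subseteq> ?H" for A
    using A
  proof (induction A rule: finite_induct)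
    case empty
    then show ?case using good1 by simp
  next
    case (insert \<sigma> A)
    then have s: "\<sigma> \<in> ?H" and IH: "good (\<lambda>\<tau>. \<Prod>\<sigma>\<in>A. (\<tau> (b \<sigma>) - \<sigma> (b \<sigma>)) / (b \<sigma> - \<sigma> (b \<sigma>)))" by auto
    have "good (\<lambda>\<tau>. (\<Prod>\<sigma>\<in>A. (\<tau> (b \<sigma>) - \<sigma> (b \<sigma>)) / (b \<sigma> - \<sigma> (b \<sigma>))) * ((\<tau> (b \<sigma>) - \<sigma> (b \<sigma>)) / (b \<sigma> - \<sigma> (b \<sigma>))))"
      by (rule good_step[OF IH b(1,2)[OF s]])
        (use iso[of \<sigma> "b \<sigma>"] s b in \<open>auto simp: w_minus_commute\<close>)
    then show ?case using insert.hyps by (simp add: mult.commute)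
  qed
  let ?d = "\<lambda>\<tau>. \<Prod>\<sigma>\<in>?H. (\<tau> (b \<sigma>) - \<sigma> (b \<sigma>)) / (b \<sigma> - \<sigma> (b \<sigma>))"
  have good_d: "good ?d" by (rule prod) (use galois_finite in auto)
  have d: "?d \<tau> = (if \<tau> = restrict id M then 1 else 0)" if t: "\<tau> \<in> ?G" for \<tau>
  proof (cases "\<tau> = restrict id M")
    case True
    have "(\<tau> (b \<sigma>) - \<sigma> (b \<sigma>)) / (b \<sigma> - \<sigma> (b \<sigma>)) = 1" if s: "\<sigma> \<in> ?H" for \<sigma>
    proof -
      have "b \<sigma> - \<sigma> (b \<sigma>) \<noteq> 0" using b(3)[OF s] by auto
      then show ?thesis using True b(1)[OF s] by simp
    qed
    then show ?thesis using True by simp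
  next
    case False
    then show ?thesis using t galois_finite by (auto intro!: prod_zero)
  qed
  have idG: "restrict id M \<in> ?G"
    using K_le unfolding G_iff
    by (auto simp: field_emb_def sf_add[OF M_subfield] sf_mult[OF M_subfield] sf_1[OF M_subfield])
  have sum: "(\<Sum>\<tau>\<in>?G. ?d \<tau> * \<tau> y) = y" if y: "y \<in> M" for y
  proof -
    have "(\<Sum>\<tau>\<in>?G. ?d \<tau> * \<tau> y) = (\<Sum>\<tau>\<in>?G. if \<tau> = restrict id M then y else 0)"
      by (rule sum.cong) (use d y in auto)
    also have "\<dots> = y" using galois_finite idG by (simp add: sum.delta)
    finally show ?thesis .
  qed
  obtain r where r: "w x = ereal r" using x(2) by (rule w_real)
  \<comment> \<open>The indicator of the identity is good and reproduces \<open>x\<close>, so the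
    valuation \<open>r\<close> of \<open>x\<close> is at least its own ceiling.\<close>
  have "ereal (of_int \<lceil>r\<rceil> - 1) < w x" unfolding r by simp linarith
  then have "ereal (of_int \<lceil>r\<rceil>) \<le> w (\<Sum>\<tau>\<in>?G. ?d \<tau> * \<tau> x)"
    using good_d x(1) unfolding good_def by blast
  then have "of_int \<lceil>r\<rceil> \<le> r" unfolding sum[OF x(1)] r by simp
  then have "r = of_int \<lceil>r\<rceil>" by linarith
  then show ?thesis using r by metis
qed

end

section \<open>Drinfeld modules of rank 1 with good reduction\<close>

context valued
begin

text \<open>A lower bound for the Gauss valuation.\<close>

definition poly_ge :: "real \<Rightarrow> 'c poly \<Rightarrow> bool"
  where "poly_ge r f \<longleftrightarrow> (\<forall>i. ereal r \<le> w (Polynomial.coeff f i))"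

lemma poly_ge_add: "poly_ge r f \<Longrightarrow> poly_ge r g \<Longrightarrow> poly_ge r (f + g)"
  by (auto simp: poly_ge_def intro: w_add_ge)

lemma poly_ge_mult: "poly_ge 0 f \<Longrightarrow> poly_ge r g \<Longrightarrow> poly_ge r (f * g)"
  unfolding poly_ge_def coeff_mult
  by (intro allI w_sum_ge w_mult_int_ge) (auto simp: zero_ereal_def)

lemma poly_ge_smult: "0 \<le> w c \<Longrightarrow> poly_ge r f \<Longrightarrow> poly_ge r (Polynomial.smult c f)"
  by (auto simp: poly_ge_def intro: w_mult_int_ge)

lemma poly_ge_1: "poly_ge 0 1"
  by (auto simp: poly_ge_def coeff_1 zero_ereal_def)

lemma poly_ge_pCons: "ereal r \<le> w c \<Longrightarrow> poly_ge r f \<Longrightarrow> poly_ge r (pCons c f)"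
  by (auto simp: poly_ge_def coeff_pCons split: nat.splits)

lemma poly_ge_0: "poly_ge r 0"
  by (auto simp: poly_ge_def)

lemma poly_ge_power: "poly_ge 0 f \<Longrightarrow> poly_ge 0 (f ^ n)"
  by (induction n) (auto intro: poly_ge_1 poly_ge_mult)

lemma poly_ge_monom: "ereal r \<le> w c \<Longrightarrow> poly_ge r (Polynomial.monom c n)"
  by (auto simp: poly_ge_def)

lemma poly_ge_pConsD: "poly_ge r (pCons c f) \<Longrightarrow> ereal r \<le> w c \<and> poly_ge r f"
  unfolding poly_ge_def by (metis coeff_pCons_0 coeff_pCons_Suc)

lemma poly_ge_poly: assumes "poly_ge r f" "0 \<le> w z" shows "ereal r \<le> w (poly f z)"
  unfolding poly_altdef
  using assms by (intro w_sum_ge) (auto simp: poly_ge_def mult.commute[of _ "z ^ _"] intro!: w_mult_int_ge w_power_int_ge)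

lemma poly_ge_diff_poly:
  assumes "poly_ge 0 f" "0 \<le> w x" "0 \<le> w y"
  shows "w (x - y) \<le> w (poly f x - poly f y)"
  using assms
proof (induction f)
  case (pCons c f)
  then have f: "poly_ge 0 f" using poly_ge_pConsD by blast
  have "poly (pCons c f) x - poly (pCons c f) y = x * (poly f x - poly f y) + poly f y * (x - y)"
    by (simp add: algebra_simps)
  then show ?case
    using w_add_ge[OF w_mult_int_ge[OF pCons.prems(2) pCons.IH[OF f pCons.prems(2,3)]]
        w_mult_int_ge[OF _ order.refl]] poly_ge_poly[OF f pCons.prems(3)] by (simp add: zero_ereal_def)
qed simp

text \<open>Outside the closed unit disc the leading term dominates, its coefficient being a unit
  and the others integral.\<close>

lemma poly_large:
  assumes "poly_ge 0 f" "w (Polynomial.lead_coeff f) = 0" "w z = ereal v" "v < 0"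
  shows "w (poly f z) = ereal (real (Polynomial.degree f) * v)"
  using assms
proof (induction f)
  case (pCons c f)
  then have f: "poly_ge 0 f" "ereal 0 \<le> w c" using poly_ge_pConsD by blast+
  show ?case
  proof (cases "f = 0")
    case True
    then show ?thesis using pCons.prems by (simp add: zero_ereal_def)
  next
    case False
    then have IH: "w (poly f z) = ereal (real (Polynomial.degree f) * v)"
      using pCons f by simp
    have e: "w (z * poly f z) = ereal (real (Suc (Polynomial.degree f)) * v)"
      using IH pCons.prems by (simp add: w_mult algebra_simps)
    have "real (Suc (Polynomial.degree f)) * v < 0" using pCons.prems by (intro mult_pos_neg) auto
    then have "w (z * poly f z) < w c" using f(2) e
      by (metis ereal_less_eq(3) less_ereal.simps(1) order_less_le_trans)
    then show ?thesis using w_add_eq'[of "z * poly f z" c] e False by simp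
  qed
qed simp

lemma poly_small:
  assumes "poly_ge 0 f" "Polynomial.coeff f 0 = 0" "w (Polynomial.coeff f 1) = 0" "0 < w z"
  shows "w (poly f z) = w z"
proof -
  obtain g where g: "f = pCons 0 g" using assms(2) by (cases f) auto
  obtain c h where h: "g = pCons c h" by (cases g) auto
  have c: "w c = 0" using assms(3) unfolding g h by simp
  have ph: "poly_ge 0 h"
    using poly_ge_pConsD[of 0 0 g] poly_ge_pConsD[of 0 c h] assms(1) unfolding g h by simp
  have "0 < w (z * poly h z)"
    using poly_ge_poly[OF ph, of z] assms(4) by (simp add: w_mult zero_ereal_def[symmetric] add_pos_nonneg)
  then have "w (c + z * poly h z) = 0" using w_add_eq[of c "z * poly h z"] c by simp
  then show ?thesis unfolding g h by (simp add: w_mult)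
qed

end

section \<open>Arithmetic in characteristic p and the constants of \<F>_q\<close>

lemma freshman_prime_power:
  fixes x y :: "'a::comm_ring_1"
  assumes "Factorial_Ring.prime p" "of_nat p = (0::'a)"
  shows "(x + y) ^ (p ^ k) = x ^ (p ^ k) + y ^ (p ^ k)"
proof (induction k)
  case (Suc k)
  have pr: "(a + b) ^ p = a ^ p + b ^ p" for a b :: 'a
  proof -
    have p0: "p > 0" using assms(1) by (simp add: prime_gt_0_nat)
    have z: "of_nat (p choose i) = (0::'a)" if "0 < i" "i < p" for i
    proof -
      have "p dvd p choose i" by (rule dvd_choose_prime) (use that assms in auto)
      then obtain c where "p choose i = p * c" by (auto elim: dvdE)
      then show ?thesis using assms(2) by simp
    qed
    have "(a + b) ^ p = (\<Sum>i\<le>p. of_nat (p choose i) * a ^ i * b ^ (p - i))" by (rule binomial_ring)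
    also have "\<dots> = (\<Sum>i\<in>{0, p}. of_nat (p choose i) * a ^ i * b ^ (p - i))"
      using z by (intro sum.mono_neutral_right) (auto simp: le_less)
    also have "\<dots> = a ^ p + b ^ p" using p0 by (simp add: add.commute)
    finally show ?thesis .
  qed
  have "(x + y) ^ (p ^ Suc k) = ((x + y) ^ (p ^ k)) ^ p" by (simp add: power_mult[symmetric] mult.commute)
  also have "\<dots> = x ^ (p ^ Suc k) + y ^ (p ^ Suc k)"
    unfolding Suc.IH pr by (simp add: power_mult[symmetric] mult.commute)
  finally show ?case .
qed simp

lemma finite_field_power_card:
  fixes x :: "'a::{field,finite}"
  shows "x \<noteq> 0 \<Longrightarrow> x ^ (CARD('a) - 1) = 1" and "x ^ CARD('a) = x"
proof -
  show 1: "x ^ (CARD('a) - 1) = 1" if "x \<noteq> 0" for x :: 'a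
  proof -
    have "bij_betw ((*) x) (UNIV - {0}) (UNIV - {0})"
      by (rule bij_betw_byWitness[where f' = "\<lambda>y. y / x"]) (use that in auto)
    then have "(\<Prod>y\<in>UNIV - {0}. x * y) = \<Prod>(UNIV - {0})"
      by (rule prod.reindex_bij_betw)
    then have "x ^ card (UNIV - {0::'a}) * \<Prod>(UNIV - {0}) = \<Prod>(UNIV - {0::'a})"
      by (simp add: prod.distrib)
    moreover have "\<Prod>(UNIV - {0::'a}) \<noteq> 0" by (subst prod_zero_iff) auto
    ultimately show ?thesis by simp
  qed
  show "x ^ CARD('a) = x"
  proof (cases "x = 0")
    case False
    have "x ^ CARD('a) = x ^ Suc (CARD('a) - 1)" by simp
    also have "\<dots> = x" using 1[OF False] by (simp only: power_Suc mult_1_right)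
    finally show ?thesis .
  qed simp
qed

locale constants = valued_closed w for w :: "'c::alg_closed_field \<Rightarrow> ereal" +
  fixes \<gamma> :: "'q::{field,finite} poly \<Rightarrow> 'c" and p m q :: nat
  assumes \<gamma>_add: "\<gamma> (a + b) = \<gamma> a + \<gamma> b" and \<gamma>_mult: "\<gamma> (a * b) = \<gamma> a * \<gamma> b"
    and \<gamma>_1: "\<gamma> 1 = 1" and \<gamma>_inj: "inj \<gamma>"
    and p: "Factorial_Ring.prime p" and q: "q = p ^ m" and card_q: "CARD('q) = q"
    and w_t: "0 \<le> w (\<gamma> [:0, 1:])"
begin

lemma \<gamma>_0: "\<gamma> 0 = 0" using \<gamma>_add[of 0 0] by (metis add.right_neutral add_left_cancel)

lemma \<gamma>_eq_0: "\<gamma> a = 0 \<longleftrightarrow> a = 0" using \<gamma>_inj \<gamma>_0 by (metis injD)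

lemma \<gamma>_power: "\<gamma> (a ^ n) = \<gamma> a ^ n" by (induction n) (auto simp: \<gamma>_1 \<gamma>_mult)

lemma \<gamma>_of_nat: "\<gamma> (of_nat n) = of_nat n" by (induction n) (auto simp: \<gamma>_1 \<gamma>_0 \<gamma>_add)

lemma q_ge_2: "2 \<le> q"
proof -
  have "card {0, 1 :: 'q} \<le> CARD('q)" by (rule card_mono) auto
  then show ?thesis using card_q by simp
qed

text \<open>Translation by 1 permutes the finite field, so comparing the sums of all its elements
  gives \<open>q = 0\<close>, and with \<open>q = p ^ m\<close> also \<open>p = 0\<close>.\<close>

lemma of_nat_p: "of_nat p = (0::'c)"
proof -
  have "(\<Sum>x\<in>(UNIV::'q set). x + 1) = (\<Sum>x\<in>(UNIV::'q set). x)"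
    by (rule sum.reindex_bij_betw[of "\<lambda>x. x + 1"])
      (rule bij_betw_byWitness[where f' = "\<lambda>y. y - 1"], auto)
  then have "of_nat q = (0::'q)" by (simp add: sum.distrib card_q)
  then have "of_nat p ^ m = (0::'q)" by (simp add: q)
  then have "of_nat p = (0::'q)" by simp
  then have "of_nat p = (0::'q poly)" by (simp add: of_nat_poly)
  then show ?thesis using \<gamma>_of_nat[of p] \<gamma>_0 by simp
qed

lemma m_pos: "0 < m" using q q_ge_2 by (cases m) auto

lemma of_nat_q: "of_nat q = (0::'c)"
  using of_nat_p m_pos by (simp add: q)

lemma freshman: "(x + y) ^ (q ^ k) = x ^ (q ^ k) + (y ^ (q ^ k) :: 'c)"
  unfolding q power_mult[symmetric] by (rule freshman_prime_power[OF p of_nat_p])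

lemma of_nat_eq_0_iff: "of_nat n = (0::'c) \<longleftrightarrow> p dvd n"
proof
  assume n: "of_nat n = (0::'c)"
  show "p dvd n"
  proof (rule ccontr)
    assume "\<not> p dvd n"
    then have "coprime p n" using p by (simp add: prime_imp_coprime_nat)
    then obtain a b where "a * int p + b * int n = 1"
      by (metis coprime_int_iff coprime_iff_gcd_eq_1 bezout_int mult.commute gcd.commute)
    then have "of_int (a * int p + b * int n) = (1::'c)" by simp
    then show False using n of_nat_p by simp
  qed
next
  assume "p dvd n"
  then show "of_nat n = (0::'c)" using of_nat_p by (auto elim!: dvdE)
qed

lemma w_unit_power:
  assumes "x ^ n = 1" "0 < n" shows "w x = 0"
proof -
  have "x \<noteq> 0" using assms by (auto simp: power_0_left)
  then obtain r where r: "w x = ereal r" by (rule w_real)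
  then show ?thesis using w_power[of x n] assms by (simp add: zero_ereal_def)
qed

lemma const_power: "c \<noteq> 0 \<Longrightarrow> \<gamma> [:c:] ^ (q - 1) = 1" "\<gamma> [:c:] ^ (q ^ k) = \<gamma> [:c:]"
proof -
  show "\<gamma> [:c:] ^ (q - 1) = 1" if "c \<noteq> 0" for c
  proof -
    have "[:c:] ^ (q - 1) = 1"
      using finite_field_power_card(1)[OF that] card_q by (simp add: poly_const_pow one_pCons)
    then show ?thesis using \<gamma>_power \<gamma>_1 by metis
  qed
  have 1: "\<gamma> [:c:] ^ q = \<gamma> [:c:]"
  proof -
    have "[:c:] ^ q = [:c:]"
      using finite_field_power_card(2)[of c] card_q by (simp add: poly_const_pow)
    then show ?thesis using \<gamma>_power by metis
  qed
  show "\<gamma> [:c:] ^ (q ^ k) = \<gamma> [:c:]"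
    by (induction k) (auto simp: 1 power_mult)
qed

lemma w_const: "c \<noteq> 0 \<Longrightarrow> w (\<gamma> [:c:]) = 0"
  using w_unit_power[OF const_power(1)] q_ge_2 by simp

lemma w_\<gamma>: "0 \<le> w (\<gamma> a)"
proof (induction a)
  case (pCons c a)
  have e: "pCons c a = [:c:] + [:0, 1:] * a" by simp
  have "0 \<le> w (\<gamma> [:c:])" using w_const[of c] \<gamma>_0 by (cases "c = 0") auto
  then show ?case unfolding e \<gamma>_add \<gamma>_mult using w_t pCons.IH
    by (intro w_add_ge w_mult_int)
qed (simp add: \<gamma>_0)

text \<open>The nonzero constants already supply \<open>q - 1\<close> roots of
  \<open>X ^ (q - 1) - 1\<close>, so there are no others.\<close>

lemma root_of_unity:
  assumes "(x::'c) ^ (q - 1) = 1"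
  obtains c where "c \<noteq> 0" "x = \<gamma> [:c:]"
proof -
  let ?f = "Polynomial.monom 1 (q - 1) - 1 :: 'c poly"
  let ?C = "(\<lambda>c. \<gamma> [:c:]) ` (UNIV - {0})"
  have deg: "Polynomial.degree ?f \<le> q - 1"
    by (rule degree_diff_le) (auto simp: degree_monom_le)
  have f0: "?f \<noteq> 0"
  proof
    assume "?f = 0"
    then have "Polynomial.coeff ?f 0 = 0" by simp
    then show False using q_ge_2 by simp
  qed
  have sub: "?C \<subseteq> {x. poly ?f x = 0}" using const_power(1) by (auto simp: poly_monom)
  have "inj_on (\<lambda>c. \<gamma> [:c:]) (UNIV - {0})"
    using \<gamma>_inj by (auto intro!: inj_onI dest: injD)
  then have "card ?C = q - 1" by (simp add: card_image card_Diff_singleton card_q)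
  then have "card {x. poly ?f x = 0} \<le> card ?C"
    using card_poly_roots_bound[OF f0] deg by simp
  then have "?C = {x. poly ?f x = 0}"
    by (intro card_seteq poly_roots_finite f0 sub)
  moreover have "x \<in> {x. poly ?f x = 0}" using assms by (simp add: poly_monom)
  ultimately show ?thesis using that by blast
qed

lemma root_of_unity_diff:
  assumes "(x::'c) ^ (q - 1) = 1" "x \<noteq> 1" shows "w (x - 1) = 0"
proof -
  obtain c where c: "c \<noteq> 0" "x = \<gamma> [:c:]" using root_of_unity[OF assms(1)] .
  have "\<gamma> [:c:] = \<gamma> [:c - 1:] + \<gamma> 1" by (simp add: one_pCons flip: \<gamma>_add)
  then have "x - 1 = \<gamma> [:c - 1:]" using c \<gamma>_1 by simp
  moreover have "c - 1 \<noteq> 0" using assms(2) c(2) \<gamma>_1 by (auto simp: one_pCons)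
  ultimately show ?thesis using w_const by simp
qed

text \<open>The form in which the transcendence of \<open>t\<close> is used:
  \<open>t ^ i - t\<close> is the divisor in the recursion for the coefficients of the
  exponential.\<close>

lemma t_power: assumes "2 \<le> i" shows "\<gamma> [:0, 1:] ^ i \<noteq> \<gamma> [:0, 1:]"
proof
  assume "\<gamma> [:0, 1:] ^ i = \<gamma> [:0, 1:]"
  then have "[:0, 1 :: 'q:] ^ i = [:0, 1:]" unfolding \<gamma>_power[symmetric] using \<gamma>_inj by (auto dest: injD)
  then have "Polynomial.degree ([:0, 1 :: 'q:] ^ i) = 1" by simp
  then show False using assms by (simp add: degree_power_eq)
qed

lemma q_poly_additive:
  assumes "f \<in> q_polys q K"
  shows "poly f (x + y) = poly f x + poly f (y :: 'c)"
proof -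
  have "Polynomial.coeff f i * (x + y) ^ i = Polynomial.coeff f i * x ^ i + Polynomial.coeff f i * y ^ i" for i
  proof (cases "Polynomial.coeff f i = 0")
    case False
    then obtain k where "i = q ^ k" using assms by (auto simp: q_polys_def)
    then show ?thesis using freshman by (simp add: distrib_left)
  qed simp
  then show ?thesis by (simp add: poly_altdef sum.distrib)
qed

text \<open>Every exponent other than 1 is a positive power of \<open>q\<close> and vanishes in
  characteristic \<open>p\<close>. A constant derivative makes separability immediate.\<close>

lemma q_poly_pderiv:
  assumes "f \<in> q_polys q (K :: 'c set)"
  shows "pderiv f = [:Polynomial.coeff f 1:]"
proof (rule poly_eqI)
  fix i
  show "Polynomial.coeff (pderiv f) i = Polynomial.coeff [:Polynomial.coeff f 1:] i"
  proof (cases i)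
    case 0
    then show ?thesis by (simp add: coeff_pderiv)
  next
    case (Suc j)
    have "of_nat (Suc i) * Polynomial.coeff f (Suc i) = 0"
    proof (cases "Polynomial.coeff f (Suc i) = 0")
      case False
      then obtain k where k: "Suc i = q ^ k" using assms by (auto simp: q_polys_def)
      then have "0 < k" using Suc by (cases k) auto
      then have "of_nat (Suc i) = (0::'c)" unfolding k by (simp add: of_nat_q)
      then show ?thesis by simp
    qed simp
    then show ?thesis using Suc by (simp add: coeff_pderiv)
  qed
qed

end

locale good_rank1 = constants w \<gamma> p m q for w :: "'c::alg_closed_field \<Rightarrow> ereal"
    and \<gamma> :: "'q::{field,finite} poly \<Rightarrow> 'c" and p m q +
  fixes K :: "'c set" and \<psi> :: "'q poly \<Rightarrow> 'c poly" and b1 :: 'c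
  assumes K: "subfield K ambient"
    and \<psi>: "drinfeld_module \<gamma> K 1 \<psi>"
    and \<psi>_t: "\<psi> [:0, 1:] = Polynomial.monom (\<gamma> [:0, 1:]) 1 + Polynomial.monom b1 q"
    and b1: "w b1 = 0"
begin

abbreviation act :: "'q poly \<Rightarrow> 'c \<Rightarrow> 'c" where "act a z \<equiv> poly (\<psi> a) z"

lemma \<psi>_q_polys: "\<psi> a \<in> q_polys q K"
  and \<psi>_add: "\<psi> (a + b) = \<psi> a + \<psi> b"
  and \<psi>_mult: "\<psi> (a * b) = pcompose (\<psi> a) (\<psi> b)"
  and \<psi>_coeff_1: "Polynomial.coeff (\<psi> a) 1 = \<gamma> a"
  and \<psi>_degree: "a \<noteq> 0 \<Longrightarrow> Polynomial.degree (\<psi> a) = q ^ Polynomial.degree a"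
  using \<psi> unfolding drinfeld_module_def card_q by auto

lemma \<psi>_polys_over: "\<psi> a \<in> polys_over K"
  using \<psi>_q_polys by (auto simp: q_polys_def polys_over_def)

lemma \<psi>_coeff_0: "Polynomial.coeff (\<psi> a) 0 = 0"
proof (rule ccontr)
  assume "Polynomial.coeff (\<psi> a) 0 \<noteq> 0"
  then obtain k where "0 = q ^ k" using \<psi>_q_polys unfolding q_polys_def by blast
  then show False using q_ge_2 by auto
qed

lemma act_add: "act a (x + y) = act a x + act a y"
  by (rule q_poly_additive[OF \<psi>_q_polys])

lemma act_0: "act a 0 = 0"
  by (simp add: poly_0_coeff_0 \<psi>_coeff_0)

lemma act_minus: "act a (- x) = - act a x"
  using act_add[of a x "- x"] act_0 by (simp add: add_eq_0_iff2)

lemma act_diff: "act a (x - y) = act a x - act a y"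
  using act_add[of a x "- y"] act_minus by simp

lemma act_mult: "act (a * b) x = act a (act b x)"
  by (simp add: \<psi>_mult poly_pcompose)

lemma \<psi>_const: "\<psi> [:c:] = Polynomial.monom (\<gamma> [:c:]) 1"
proof (cases "c = 0")
  case True
  have "\<psi> 0 = 0" using \<psi>_add[of 0 0] by (metis add.right_neutral add_left_cancel)
  then show ?thesis using True \<gamma>_0 by simp
next
  case False
  then have "Polynomial.degree (\<psi> [:c:]) = 1" using \<psi>_degree[of "[:c:]"] by simp
  then show ?thesis
  proof (intro poly_eqI)
    fix n :: nat
    consider "n = 0" | "n = 1" | "1 < n" by linarith
    then show "Polynomial.coeff (\<psi> [:c:]) n = Polynomial.coeff (Polynomial.monom (\<gamma> [:c:]) 1) n"
      by cases (use \<psi>_coeff_0 \<psi>_coeff_1 \<open>Polynomial.degree (\<psi> [:c:]) = 1\<close> in \<open>auto simp: coeff_eq_0\<close>)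
  qed
qed

lemma act_const: "act [:c:] x = \<gamma> [:c:] * x"
  by (simp add: \<psi>_const poly_monom)

lemma act_1: "act 1 x = x"
  using act_const[of 1 x] \<gamma>_1 by (simp add: one_pCons)

lemma act_zero: "act 0 x = 0"
  using act_const[of 0 x] \<gamma>_0 by simp

lemma pcompose_monom: "pcompose (Polynomial.monom c n) g = Polynomial.smult c (g ^ n)" for g :: "'c poly"
  by (induction n) (auto simp: monom_0 monom_Suc pcompose_pCons pcompose_const)

lemma \<psi>_pCons: "\<psi> (pCons c a) = Polynomial.monom (\<gamma> [:c:]) 1 +
    (Polynomial.smult (\<gamma> [:0, 1:]) (\<psi> a) + Polynomial.smult b1 (\<psi> a ^ q))"
proof -
  have "pCons c a = [:c:] + [:0, 1:] * a" by simp
  then have "\<psi> (pCons c a) = \<psi> [:c:] + pcompose (\<psi> [:0, 1:]) (\<psi> a)" by (metis \<psi>_add \<psi>_mult)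
  then show ?thesis by (simp only: \<psi>_const \<psi>_t pcompose_add pcompose_monom power_one_right)
qed

lemma \<psi>_integral: "poly_ge 0 (\<psi> a)"
proof (induction a)
  case 0
  then show ?case using \<psi>_const[of 0] \<gamma>_0 by (simp add: poly_ge_0)
next
  case (pCons c a)
  then show ?case unfolding \<psi>_pCons
    by (intro poly_ge_add poly_ge_smult poly_ge_power poly_ge_monom)
      (use w_\<gamma> b1 in \<open>auto simp: zero_ereal_def\<close>)
qed

text \<open>In Horner form the top term of \<open>\<psi> (pCons c a)\<close> comes from
  \<open>b1\<close> times the \<open>q\<close>-th power of \<open>\<psi> a\<close>, so the unit
  \<open>b1\<close> propagates.\<close>

lemma \<psi>_lead: "a \<noteq> 0 \<Longrightarrow> w (Polynomial.lead_coeff (\<psi> a)) = 0"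
proof (induction a)
  case (pCons c a)
  show ?case
  proof (cases "a = 0")
    case True
    then show ?thesis using pCons.hyps w_const[of c] by (simp add: \<psi>_const degree_monom_eq \<gamma>_eq_0)
  next
    case False
    let ?n = "q ^ Suc (Polynomial.degree a)"
    have d: "Polynomial.degree (\<psi> (pCons c a)) = ?n" using \<psi>_degree[of "pCons c a"] False by simp
    have da: "Polynomial.degree (\<psi> a) = q ^ Polynomial.degree a" by (rule \<psi>_degree[OF False])
    have l1: "1 < ?n" using q_ge_2 by (intro one_less_power) auto
    have l2: "q ^ Polynomial.degree a < ?n" using q_ge_2 by simp
    have l3: "Polynomial.degree (\<psi> a) * q = ?n" using da by simp
    have "Polynomial.coeff (\<psi> a ^ q) ?n = Polynomial.lead_coeff (\<psi> a) ^ q"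
    proof -
      have "\<psi> a \<noteq> 0" using da q_ge_2 by auto
      then have "Polynomial.degree (\<psi> a ^ q) = ?n"
        using degree_power_eq[of "\<psi> a" q] l3 by (simp only: mult.commute not_False_eq_True simp_thms)
      then show ?thesis using lead_coeff_power[of "\<psi> a" q] by (simp only:)
    qed
    moreover have "Polynomial.coeff (\<psi> a) ?n = 0" using l2 da by (intro coeff_eq_0) simp
    ultimately have "Polynomial.lead_coeff (\<psi> (pCons c a)) = b1 * Polynomial.lead_coeff (\<psi> a) ^ q"
      unfolding d unfolding \<psi>_pCons using l1 q_ge_2 by simp
    then show ?thesis using pCons.IH[OF False] b1 by (simp add: w_mult w_power)
  qed
qed simp

lemma act_large: "a \<noteq> 0 \<Longrightarrow> w z = ereal v \<Longrightarrow> v < 0 \<Longrightarrow> w (act a z) = ereal (real (q ^ Polynomial.degree a) * v)"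
  using poly_large[OF \<psi>_integral \<psi>_lead] \<psi>_degree by metis

lemma act_small: "w (\<gamma> a) = 0 \<Longrightarrow> 0 < w z \<Longrightarrow> w (act a z) = w z"
  using poly_small[OF \<psi>_integral \<psi>_coeff_0] \<psi>_coeff_1 by metis

lemma act_integral: "0 \<le> w z \<Longrightarrow> 0 \<le> w (act a z)"
  using poly_ge_poly[OF \<psi>_integral] by (simp add: zero_ereal_def)

lemma act_preimage:
  assumes "a \<noteq> 0" "w (act a z) = ereal v" "v < 0"
  shows "w z = ereal (v / real (q ^ Polynomial.degree a))"
proof -
  have n: "\<not> 0 \<le> w z" using act_integral[of z a] assms by (auto simp: zero_ereal_def)
  then have "z \<noteq> 0" by auto
  then obtain r where r: "w z = ereal r" by (rule w_real)
  then have "r < 0" using n by (simp add: zero_ereal_def)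
  then show ?thesis using act_large[OF assms(1) r] assms(2) q_ge_2 r by (simp add: field_simps)
qed

text \<open>The action multiplies a negative valuation by a power of \<open>q\<close> and, when
  \<open>\<gamma> a\<close> is a unit, preserves a positive one; neither allows the value 0.\<close>

lemma torsion_w:
  assumes "w (\<gamma> a) = 0" "z \<in> torsion \<psi> a" "z \<noteq> 0"
  shows "w z = 0"
proof -
  have a0: "a \<noteq> 0" using assms(1) \<gamma>_0 by auto
  obtain r where r: "w z = ereal r" using assms(3) by (rule w_real)
  have z: "act a z = 0" using assms(2) by (simp add: torsion_def)
  have "\<not> r < 0" using act_large[OF a0 r] z by auto
  moreover have "\<not> 0 < r" using act_small[OF assms(1), of z] r z by (auto simp: zero_ereal_def)
  ultimately show ?thesis using r by (simp add: zero_ereal_def)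
qed

lemma act_mult_commute: "act a (act b z) = act b (act a z)"
  by (metis act_mult mult.commute)

lemma act_const_mult: "act a (\<gamma> [:c:] * z) = \<gamma> [:c:] * act a z"
  using act_mult_commute[of a "[:c:]" z] by (simp add: act_const)

lemma \<psi>_pderiv: "pderiv (\<psi> a) = [:\<gamma> a:]"
  using q_poly_pderiv[OF \<psi>_q_polys] \<psi>_coeff_1 by simp

lemma act_closed: "subfield M ambient \<Longrightarrow> K \<subseteq> M \<Longrightarrow> z \<in> M \<Longrightarrow> act a z \<in> M"
  using polys_over_poly[of M "\<psi> a" z] polys_over_mono[of K M] \<psi>_polys_over[of a] by blast

text \<open>If \<open>s = act a \<mu>\<close> for a generator \<open>\<mu>\<close>, then
  \<open>s\<close> is larger than \<open>\<mu>\<close> by the factor \<open>q ^ degree a\<close>.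
  Minimality forces \<open>a\<close> to be a nonzero constant, which is invertible.\<close>

lemma smb_generates:
  assumes lat: "rank1_lattice w \<psi> \<Lambda>" and neg: "\<And>\<mu>. \<mu> \<in> \<Lambda> - {0} \<Longrightarrow> w \<mu> < 0" and smb: "is_smb w \<Lambda> s"
  shows "\<Lambda> = range (\<lambda>a. act a s)"
proof -
  obtain \<mu> where \<mu>: "inj (\<lambda>a. act a \<mu>)" "\<Lambda> = range (\<lambda>a. act a \<mu>)"
    using lat unfolding rank1_lattice_def by blast
  have s: "s \<in> \<Lambda>" "s \<noteq> 0" "\<And>\<nu>. \<nu> \<in> \<Lambda> \<Longrightarrow> \<nu> \<noteq> 0 \<Longrightarrow> - w s \<le> - w \<nu>"
    using smb by (auto simp: is_smb_def)
  have \<mu>0: "\<mu> \<noteq> 0" using injD[OF \<mu>(1), of 0 1] by (auto simp: act_0)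
  have \<mu>L: "\<mu> \<in> \<Lambda>" unfolding \<mu>(2) using act_1 by (metis rangeI)
  obtain r where r: "w \<mu> = ereal r" using \<mu>0 by (rule w_real)
  have r0: "r < 0" using neg[of \<mu>] \<mu>L \<mu>0 r by (simp add: zero_ereal_def)
  obtain a where a: "s = act a \<mu>" using s(1) \<mu>(2) by auto
  have a0: "a \<noteq> 0" using a s(2) act_zero by auto
  have "w s = ereal (real (q ^ Polynomial.degree a) * r)" unfolding a by (rule act_large[OF a0 r r0])
  then have "- (real (q ^ Polynomial.degree a) * r) \<le> - r"
    using s(3)[OF \<mu>L \<mu>0] r by simp
  then have "real (q ^ Polynomial.degree a) \<le> real 1"
    using r0 by (simp add: mult_le_cancel_right1 del: of_nat_power)
  then have "q ^ Polynomial.degree a \<le> 1" by (simp only: of_nat_le_iff)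
  moreover have "1 < q ^ Polynomial.degree a" if "0 < Polynomial.degree a"
    using q_ge_2 that by (intro one_less_power) auto
  ultimately have "Polynomial.degree a = 0" by (metis leD neq0_conv)
  then obtain c where c: "a = [:c:]" "c \<noteq> 0" using a0 by (metis degree_eq_zeroE pCons_0_0)
  have \<mu>s: "\<mu> = act [:inverse c:] s"
    unfolding a c act_mult[symmetric] using c(2) act_1 by (simp add: one_pCons)
  have "act b \<mu> \<in> range (\<lambda>a. act a s)" for b
    unfolding \<mu>s act_mult[symmetric] by blast
  moreover have "act b s \<in> \<Lambda>" for b unfolding a act_mult[symmetric] \<mu>(2) by blast
  ultimately show ?thesis using \<mu>(2) by auto
qed

end

section \<open>The lattice of a Tate uniformization\<close>

context valued
begin

text \<open>On a circle \<open>w z = 1 / M\<close> where no two terms tie, \<open>f(z)\<close> has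
  the least valuation among its terms, so each term inherits the bound. Ties may be unavoidable at
  valuation 0, hence the smaller disc; its price \<open>i / M\<close> is at most \<open>i\<close>,
  whatever \<open>f\<close> is.\<close>

lemma coeff_bound_of_poly_bound:
  assumes pi: "w \<pi> = 1" and f: "\<And>z. 0 \<le> w z \<Longrightarrow> ereal r \<le> w (poly f z)"
    and root: "\<And>n. 0 < n \<Longrightarrow> \<exists>z. z ^ n = \<pi>"
  shows "ereal (r - real i) \<le> w (Polynomial.coeff f i)"
proof (cases "Polynomial.coeff f i = 0")
  case False
  let ?c = "Polynomial.coeff f" and ?n = "Polynomial.degree f"
  define v where "v j = real_of_ereal (w (?c j))" for j
  have v: "w (?c j) = ereal (v j)" if "?c j \<noteq> 0" for j
    unfolding v_def by (rule w_real[OF that]) simp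
  \<comment> \<open>The \<open>M\<close> to avoid: for \<open>j < k\<close> the equation has at most
    one solution. The meaningless \<open>v j\<close> of a zero coefficient can only enlarge this
    finite set.\<close>
  define B where "B = (\<Union>j\<le>?n. \<Union>k\<le>?n. {M::nat. 0 < M \<and> j < k \<and> v j + real j / real M = v k + real k / real M})"
  have "finite {M::nat. 0 < M \<and> j < k \<and> v j + real j / real M = v k + real k / real M}" for j k
  proof (rule finite_subset)
    show "{M::nat. 0 < M \<and> j < k \<and> v j + real j / real M = v k + real k / real M}
      \<subseteq> {nat \<lfloor>(real k - real j) / (v j - v k)\<rfloor>}"
    proof
      fix M :: nat assume "M \<in> {M::nat. 0 < M \<and> j < k \<and> v j + real j / real M = v k + real k / real M}"
      then have M: "0 < M" "j < k" "v j + real j / real M = v k + real k / real M" by auto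
      have "(v j + real j / real M) * real M = (v k + real k / real M) * real M" by (simp only: M(3))
      then have e: "(v j - v k) * real M = real k - real j" using M(1) by (simp add: algebra_simps)
      then have "v j - v k \<noteq> 0" using M(2) by auto
      then have "(real k - real j) / (v j - v k) = real M" by (simp flip: e)
      then show "M \<in> {nat \<lfloor>(real k - real j) / (v j - v k)\<rfloor>}" by (simp only: floor_of_nat nat_int singletonI)
    qed
  qed auto
  then have "finite B" unfolding B_def by auto
  then obtain M where M: "M \<notin> B" "0 < M"
    using ex_new_if_finite[of "insert 0 B"] infinite_UNIV_nat by auto
  obtain z where z: "z ^ M = \<pi>" using root[OF M(2)] by blast
  have z0: "z \<noteq> 0" using z pi M(2) by (auto simp: power_0_left)
  then obtain s where s: "w z = ereal s" by (rule w_real)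
  have "ereal (real M) * w z = 1" using w_power[of z M] z pi by simp
  then have "real M * s = 1" by (simp add: s one_ereal_def)
  then have "s = 1 / real M" using M(2) by (metis nonzero_mult_div_cancel_left of_nat_0_less_iff less_irrefl)
  then have wz: "w z = ereal (1 / real M)" using s by simp
  have wt: "w (?c j * z ^ j) = ereal (v j + real j / real M)" if "?c j \<noteq> 0" for j
    by (simp add: w_mult w_power v[OF that] wz)
  have ne: "w (?c j * z ^ j) \<noteq> w (?c k * z ^ k)" if jk: "j < k" "k \<le> ?n" "?c j * z ^ j \<noteq> 0" "?c k * z ^ k \<noteq> 0" for j k
  proof
    assume e: "w (?c j * z ^ j) = w (?c k * z ^ k)"
    have "v j + real j / real M = v k + real k / real M" using e wt jk by auto
    then have "M \<in> B" unfolding B_def using jk M(2) by auto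
    then show False using M(1) by simp
  qed
  have "{..?n} = {} \<or> (\<exists>j\<in>{..?n}. w (\<Sum>j\<le>?n. ?c j * z ^ j) = w (?c j * z ^ j) \<and> (\<forall>k\<in>{..?n}. w (?c j * z ^ j) \<le> w (?c k * z ^ k)))"
  proof (rule w_sum_distinct)
    fix j k assume "j \<in> {..?n}" "k \<in> {..?n}" "j \<noteq> k" "?c j * z ^ j \<noteq> 0" "?c k * z ^ k \<noteq> 0"
    then show "w (?c j * z ^ j) \<noteq> w (?c k * z ^ k)" using ne[of j k] ne[of k j] by (metis atMost_iff linorder_neqE_nat)
  qed simp
  moreover have "i \<le> ?n" using False by (rule le_degree)
  ultimately have "w (poly f z) \<le> w (?c i * z ^ i)" unfolding poly_altdef by fastforce
  moreover have "0 \<le> w z" unfolding wz by simp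
  then have "ereal r \<le> w (poly f z)" by (rule f)
  ultimately have "ereal r \<le> ereal (v i + real i / real M)" unfolding wt[OF False] by (rule order_trans[rotated])
  moreover have "real i / real M \<le> real i" using M(2) divide_left_mono[of 1 "real M" "real i"] by simp
  ultimately show ?thesis unfolding v[OF False] by simp
qed simp

text \<open>Coefficientwise convergence for the valuation, as opposed to the \<open>X\<close>-adic
  topology of formal power series.\<close>

definition fconv :: "(nat \<Rightarrow> 'c fps) \<Rightarrow> 'c fps \<Rightarrow> bool"
  where "fconv F G \<longleftrightarrow> (\<forall>i. wlim (\<lambda>n. fps_nth (F n) i) (fps_nth G i))"

lemma fconv_const: "fconv (\<lambda>_. F) F"
  by (simp add: fconv_def wlim_const)

lemma fconv_add: "fconv F G \<Longrightarrow> fconv F' G' \<Longrightarrow> fconv (\<lambda>n. F n + F' n) (G + G')"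
  by (simp add: fconv_def wlim_add)

lemma fconv_diff: "fconv F G \<Longrightarrow> fconv F' G' \<Longrightarrow> fconv (\<lambda>n. F n - F' n) (G - G')"
  by (simp add: fconv_def wlim_diff)

lemma fconv_mult: "fconv F G \<Longrightarrow> fconv F' G' \<Longrightarrow> fconv (\<lambda>n. F n * F' n) (G * G')"
  unfolding fconv_def fps_mult_nth by (intro allI wlim_sum wlim_mult) blast+

lemma fconv_power: "fconv F G \<Longrightarrow> fconv (\<lambda>n. F n ^ k) (G ^ k)"
proof (induction k)
  case 0
  show ?case unfolding power_0 by (rule fconv_const)
next
  case (Suc k)
  show ?case unfolding power_Suc by (rule fconv_mult[OF Suc.prems Suc.IH[OF Suc.prems]])
qed

lemma fconv_compose: "fconv F G \<Longrightarrow> fconv (\<lambda>n. F n oo P) (G oo P)"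
  unfolding fconv_def fps_compose_nth by (intro allI wlim_sum wlim_mult wlim_const) blast

lemma fconv_unique: "fconv F G \<Longrightarrow> fconv F G' \<Longrightarrow> G = G'"
proof (rule fps_ext)
  fix i assume "fconv F G" "fconv F G'"
  then have "wlim (\<lambda>n. fps_nth (F n) i) (fps_nth G i)" "wlim (\<lambda>n. fps_nth (F n) i) (fps_nth G' i)"
    by (simp_all add: fconv_def)
  then show "fps_nth G i = fps_nth G' i" by (rule wlim_unique)
qed

end

lemma fps_nth_power_in_subfield:
  assumes N: "subfield N ambient" and F: "\<And>i. i \<le> n \<Longrightarrow> fps_nth F i \<in> N" and "i \<le> n"
  shows "fps_nth (F ^ k) i \<in> N"
  using assms(3)
proof (induction k arbitrary: i)
  case 0
  then show ?case by (simp add: sf_0[OF N] sf_1[OF N])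
next
  case (Suc k)
  show ?case
    unfolding power_Suc fps_mult_nth
  proof (rule sf_sum[OF N])
    fix j assume "j \<in> {0..i}"
    then show "fps_nth F j * fps_nth (F ^ k) (i - j) \<in> N"
      using Suc.prems by (intro sf_mult[OF N] F Suc.IH) auto
  qed
qed

text \<open>Newton's identities as a logarithmic derivative: \<open>X P' / P\<close> is minus the
  generating series of the power sums, written here without the division.\<close>

lemma newton_power_sums:
  fixes S :: "'c::field set"
  assumes "finite S"
  shows "fps_X * fps_deriv (\<Prod>\<mu>\<in>S. 1 - fps_const (inverse \<mu>) * fps_X) =
    - (Abs_fps (\<lambda>k. if k = 0 then 0 else \<Sum>\<mu>\<in>S. inverse \<mu> ^ k) * (\<Prod>\<mu>\<in>S. 1 - fps_const (inverse \<mu>) * fps_X))"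
  using assms
proof (induction S rule: finite_induct)
  case empty
  have "Abs_fps (\<lambda>k. if k = 0 then 0 else \<Sum>\<mu>\<in>({} :: 'c set). inverse \<mu> ^ k) = 0"
    by (rule fps_ext) simp
  then show ?case by simp
next
  case (insert a S)
  let ?b = "inverse a" and ?P = "\<Prod>\<mu>\<in>S. 1 - fps_const (inverse \<mu>) * fps_X"
  let ?A = "Abs_fps (\<lambda>k. if k = 0 then 0 else ?b ^ k)"
  let ?G = "\<lambda>S. Abs_fps (\<lambda>k. if k = 0 then 0 else \<Sum>\<mu>\<in>S. inverse \<mu> ^ k)"
  \<comment> \<open>\<open>?A\<close> is the geometric series without its constant term.\<close>
  have A: "?A * (1 - fps_const ?b * fps_X) = fps_const ?b * fps_X"
  proof (rule fps_ext)
    fix k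
    show "fps_nth (?A * (1 - fps_const ?b * fps_X)) k = fps_nth (fps_const ?b * fps_X) k"
    proof (cases k)
      case (Suc j)
      have "?A * (1 - fps_const ?b * fps_X) = ?A - fps_const ?b * (?A * fps_X)"
        by (simp add: algebra_simps)
      then have "fps_nth (?A * (1 - fps_const ?b * fps_X)) k = fps_nth ?A k - ?b * fps_nth ?A j"
        using Suc by (simp only: fps_sub_nth fps_mult_left_const_nth fps_X_mult_right_nth) simp
      then show ?thesis using Suc by simp
    qed simp
  qed
  have G: "?G (insert a S) = ?A + ?G S" by (rule fps_ext) (use insert in simp)
  have P: "(\<Prod>\<mu>\<in>insert a S. 1 - fps_const (inverse \<mu>) * fps_X) = (1 - fps_const ?b * fps_X) * ?P"
    using insert by simp
  have "fps_X * fps_deriv ((1 - fps_const ?b * fps_X) * ?P) =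
    - (fps_const ?b * fps_X) * ?P + (1 - fps_const ?b * fps_X) * (fps_X * fps_deriv ?P)"
    by (simp add: algebra_simps)
  also have "\<dots> = - (?A * (1 - fps_const ?b * fps_X)) * ?P +
      (1 - fps_const ?b * fps_X) * - (?G S * ?P)"
    unfolding A insert.IH ..
  also have "\<dots> = - ((?A + ?G S) * ((1 - fps_const ?b * fps_X) * ?P))"
    by (simp add: algebra_simps)
  finally show ?case unfolding P G .
qed

locale tate_lattice = good_rank1 w \<gamma> p m q K \<psi> b1 for w :: "'c::alg_closed_field \<Rightarrow> ereal"
    and \<gamma> :: "'q::{field,finite} poly \<Rightarrow> 'c" and p m q K \<psi> b1 +
  fixes \<Lambda> :: "'c set" and s \<pi> :: 'c and R :: real and e :: "'c \<Rightarrow> 'c" and \<phi>t :: "'c poly" and a1 a2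
  assumes K_complete: "val_complete w K" and C_complete: "val_complete w UNIV"
    and \<pi>: "\<pi> \<in> K" "w \<pi> = 1"
    and \<Lambda>: "\<Lambda> = range (\<lambda>a. act a s)"
    and \<Lambda>_finite: "finite {z \<in> \<Lambda>. ereal r \<le> w z}"
    and w_s: "w s = ereal (- R)" and R_pos: "0 < R"
    and e: "lattice_exponential w \<Lambda> e"
    and e_act: "e (act [:0, 1:] z) = poly \<phi>t (e z)"
    and \<phi>t: "\<phi>t = Polynomial.monom (\<gamma> [:0, 1:]) 1 + Polynomial.monom a1 q + Polynomial.monom a2 (q ^ 2)"
    and a12: "a1 \<in> K" "a2 \<in> K" "w a1 = 0" "0 < w a2"
    and \<gamma>_K: "\<gamma> a \<in> K" and b1_K: "b1 \<in> K"
begin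

lemma s_nonzero: "s \<noteq> 0" using w_s by auto

lemma \<Lambda>_w: "a \<noteq> 0 \<Longrightarrow> w (act a s) = ereal (- real (q ^ Polynomial.degree a) * R)"
  using act_large[OF _ w_s] R_pos by simp

text \<open>The first shell of the lattice, the nonzero points of minimal size. By
  \<open>\<Lambda>_cases\<close> any other nonzero point has size at least
  \<open>q * R\<close>.\<close>

definition small_points :: "'c set"
  where "small_points = (\<lambda>c. \<gamma> [:c:] * s) ` (UNIV - {0})"

lemma \<Lambda>_cases:
  assumes "\<mu> \<in> \<Lambda> - {0}"
  obtains "\<mu> \<in> small_points" | "w \<mu> \<le> ereal (- (real q * R))"
proof -
  obtain a where a: "\<mu> = act a s" "a \<noteq> 0" using assms act_zero unfolding \<Lambda> by auto
  show ?thesis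
  proof (cases "Polynomial.degree a = 0")
    case True
    then obtain c where "a = [:c:]" "c \<noteq> 0" using a(2) by (metis degree_eq_zeroE pCons_0_0)
    then show ?thesis using that(1) a(1) act_const by (auto simp: small_points_def)
  next
    case False
    have "q \<le> q ^ Polynomial.degree a" using q_ge_2 False by (intro self_le_power) auto
    then have "real q * R \<le> real (q ^ Polynomial.degree a) * R"
      using R_pos by (intro mult_right_mono) (simp_all only: of_nat_le_iff less_imp_le)
    then show ?thesis using that(2) \<Lambda>_w[OF a(2)] a(1) by simp
  qed
qed

lemma small_points:
  assumes "\<mu> \<in> small_points"
  shows "\<mu> \<in> \<Lambda> - {0}" "w \<mu> = ereal (- R)"
proof -
  obtain c where c: "\<mu> = \<gamma> [:c:] * s" "c \<noteq> 0" using assms by (auto simp: small_points_def)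
  show w: "w \<mu> = ereal (- R)" using w_const[OF c(2)] w_s by (simp add: c(1) w_mult)
  have "\<mu> = act [:c:] s" by (simp add: act_const c(1))
  then show "\<mu> \<in> \<Lambda> - {0}" using w unfolding \<Lambda> by auto
qed

lemma small_points_inj: "inj_on (\<lambda>c. \<gamma> [:c:] * s) (UNIV - {0})"
proof (rule inj_onI)
  fix x y assume "\<gamma> [:x:] * s = \<gamma> [:y:] * s"
  then have "\<gamma> [:x:] = \<gamma> [:y:]" using s_nonzero by simp
  then show "x = y" using injD[OF \<gamma>_inj] by fastforce
qed

lemma card_small_points: "card small_points = q - 1"
  unfolding small_points_def by (subst card_image[OF small_points_inj]) (simp add: card_Diff_singleton card_q)

lemma \<Lambda>_w_le:
  assumes "\<mu> \<in> \<Lambda> - {0}"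
  shows "w \<mu> \<le> ereal (- R)"
  using assms
proof (cases rule: \<Lambda>_cases)
  case 1
  then show ?thesis using small_points(2) by simp
next
  case 2
  have "1 * R \<le> real q * R" using q_ge_2 R_pos by (intro mult_right_mono) auto
  then have "ereal (- (real q * R)) \<le> ereal (- R)" by simp
  with 2 show ?thesis by (rule order_trans)
qed

section \<open>Truncations of the exponential and its power series\<close>

definition W :: "nat \<Rightarrow> 'c set"
  where "W N = {\<mu> \<in> \<Lambda> - {0}. ereal (- real N) \<le> w \<mu>}"

text \<open>Partial products of \<open>e(z) / z\<close> over growing balls: a sequence of
  polynomials in place of the net of finite subsets, so that coefficients have limits.\<close>

definition H :: "nat \<Rightarrow> 'c poly"
  where "H N = (\<Prod>\<mu>\<in>W N. [:1, - inverse \<mu>:])"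

lemma finite_W: "finite (W N)"
  by (rule finite_subset[OF _ \<Lambda>_finite[of "- real N"]]) (auto simp: W_def)

lemma W_mono: "N \<le> N' \<Longrightarrow> W N \<subseteq> W N'"
proof
  fix \<mu> assume N: "N \<le> N'" and \<mu>: "\<mu> \<in> W N"
  have "ereal (- real N') \<le> ereal (- real N)" using N by simp
  also have "\<dots> \<le> w \<mu>" using \<mu> by (simp add: W_def)
  finally show "\<mu> \<in> W N'" using \<mu> by (simp add: W_def)
qed

lemma w_inverse_ge: assumes "\<mu> \<in> \<Lambda> - {0}" "w \<mu> \<le> ereal (- r)" shows "ereal r \<le> w (inverse \<mu>)"
proof -
  have \<mu>0: "\<mu> \<noteq> 0" using assms(1) by auto
  then obtain v where v: "w \<mu> = ereal v" by (rule w_real)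
  then show ?thesis using assms(2) \<mu>0 by (simp add: w_inverse)
qed

lemma w_inverse_pos: "\<mu> \<in> \<Lambda> - {0} \<Longrightarrow> 0 \<le> w (inverse \<mu>)"
proof -
  assume \<mu>: "\<mu> \<in> \<Lambda> - {0}"
  have "0 \<le> ereal R" using R_pos by simp
  also have "\<dots> \<le> w (inverse \<mu>)" by (rule w_inverse_ge[OF \<mu> \<Lambda>_w_le[OF \<mu>]])
  finally show ?thesis .
qed

lemma prod_ge_0: assumes "finite S" "S \<subseteq> \<Lambda> - {0}" shows "poly_ge 0 (\<Prod>\<mu>\<in>S. [:1, - inverse \<mu>:])"
  using assms
proof (induction S rule: finite_induct)
  case (insert \<mu> S)
  then show ?case using w_inverse_pos[of \<mu>] unfolding prod.insert[OF insert.hyps]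
    by (intro poly_ge_mult poly_ge_pCons poly_ge_0) (auto simp: zero_ereal_def)
qed (simp add: poly_ge_1)

lemma prod_near_1:
  assumes "finite S" "S \<subseteq> \<Lambda> - {0}" "\<And>\<mu>. \<mu> \<in> S \<Longrightarrow> w \<mu> \<le> ereal (- r)"
  shows "poly_ge r ((\<Prod>\<mu>\<in>S. [:1, - inverse \<mu>:]) - 1)"
  using assms
proof (induction S rule: finite_induct)
  case (insert \<mu> S)
  let ?P = "\<Prod>\<mu>\<in>S. [:1, - inverse \<mu>:]"
  have eq: "(\<Prod>\<mu>\<in>insert \<mu> S. [:1, - inverse \<mu>:]) - 1 = (?P - 1) + ?P * [:0, - inverse \<mu>:]"
    using insert.hyps by (simp add: algebra_simps one_pCons)
  have "poly_ge r (?P - 1)" using insert by auto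
  moreover have "poly_ge r (?P * [:0, - inverse \<mu>:])"
    using insert w_inverse_ge[of \<mu> r] by (intro poly_ge_mult prod_ge_0 poly_ge_pCons poly_ge_0) auto
  ultimately show ?case unfolding eq by (rule poly_ge_add)
qed (simp add: poly_ge_0)

lemma H_integral: "poly_ge 0 (H N)"
  unfolding H_def by (rule prod_ge_0[OF finite_W]) (auto simp: W_def)

text \<open>Each additional factor \<open>1 - z / \<mu>\<close> comes from a point outside the ball,
  for which \<open>1 / \<mu>\<close> has valuation at least \<open>N\<close>.\<close>

lemma H_diff: assumes "N \<le> N'" shows "poly_ge (real N) (H N' - H N)"
proof -
  let ?S = "W N' - W N"
  have "H N' = (\<Prod>\<mu>\<in>?S. [:1, - inverse \<mu>:]) * H N"
    unfolding H_def by (rule prod.subset_diff[OF W_mono[OF assms] finite_W])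
  then have eq: "H N' - H N = H N * ((\<Prod>\<mu>\<in>?S. [:1, - inverse \<mu>:]) - 1)" by (simp add: algebra_simps)
  have "w \<mu> \<le> ereal (- real N)" if "\<mu> \<in> ?S" for \<mu> using that by (auto simp: W_def)
  then show ?thesis unfolding eq
    by (intro poly_ge_mult H_integral prod_near_1) (auto simp: finite_W, auto simp: W_def)
qed

lemma H_limit: "\<exists>h. fconv (\<lambda>N. fps_of_poly (H N)) h"
proof -
  have "\<exists>l. wlim (\<lambda>N. Polynomial.coeff (H N) i) l" for i
  proof -
    have "\<exists>N. \<forall>m\<ge>N. \<forall>n\<ge>N. ereal r < w (Polynomial.coeff (H m) i - Polynomial.coeff (H n) i)" for r
    proof (intro exI allI impI)
      fix k n assume kn: "nat \<lceil>r\<rceil> + 1 \<le> k" "nat \<lceil>r\<rceil> + 1 \<le> n"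
      let ?N = "nat \<lceil>r\<rceil> + 1"
      have "ereal (real ?N) \<le> w ((Polynomial.coeff (H k) i - Polynomial.coeff (H ?N) i) - (Polynomial.coeff (H n) i - Polynomial.coeff (H ?N) i))"
        by (rule w_diff_ge)
          (use H_diff[OF kn(1)] H_diff[OF kn(2)] in \<open>auto simp: poly_ge_def simp del: of_nat_add\<close>)
      then have "ereal (real ?N) \<le> w (Polynomial.coeff (H k) i - Polynomial.coeff (H n) i)" by simp
      moreover have "ereal r < ereal (real ?N)" by simp linarith
      ultimately show "ereal r < w (Polynomial.coeff (H k) i - Polynomial.coeff (H n) i)"
        by (rule order_less_le_trans[rotated])
    qed
    then show ?thesis using wlim_complete[OF C_complete, of "\<lambda>N. Polynomial.coeff (H N) i"] by blast
  qed
  then obtain l where "\<And>i. wlim (\<lambda>N. Polynomial.coeff (H N) i) (l i)" by metis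
  then have "fconv (\<lambda>N. fps_of_poly (H N)) (Abs_fps l)" by (simp add: fconv_def)
  then show ?thesis ..
qed

definition h :: "'c fps" where "h = (SOME h. fconv (\<lambda>N. fps_of_poly (H N)) h)"

lemma h: "fconv (\<lambda>N. fps_of_poly (H N)) h"
  unfolding h_def using someI_ex[OF H_limit] .

lemma exponential_eventually:
  obtains S where "finite S" "S \<subseteq> \<Lambda> - {0}"
    "\<And>T. finite T \<Longrightarrow> S \<subseteq> T \<Longrightarrow> T \<subseteq> \<Lambda> - {0} \<Longrightarrow> ereal r < w (z * (\<Prod>\<mu>\<in>T. 1 - z / \<mu>) - e z)"
proof -
  have "((\<lambda>S. w (z * (\<Prod>\<mu>\<in>S. 1 - z / \<mu>) - e z)) \<longlongrightarrow> \<infinity>) (finite_subsets_at_top (\<Lambda> - {0}))"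
    using e unfolding lattice_exponential_def by blast
  then have "\<forall>\<^sub>F S in finite_subsets_at_top (\<Lambda> - {0}). ereal r < w (z * (\<Prod>\<mu>\<in>S. 1 - z / \<mu>) - e z)"
    unfolding tendsto_PInfty by blast
  then show ?thesis unfolding eventually_finite_subsets_at_top using that by metis
qed

lemma subset_W:
  assumes "finite S" "S \<subseteq> \<Lambda> - {0}"
  obtains N where "N0 \<le> N" "S \<subseteq> W N"
proof -
  have "\<exists>N. S \<subseteq> W N" using assms
  proof (induction S rule: finite_induct)
    case (insert \<mu> S)
    then obtain N where N: "S \<subseteq> W N" by auto
    obtain v where v: "w \<mu> = ereal v" by (rule w_real[of \<mu>]) (use insert in auto)
    let ?M = "max N (nat \<lceil>- v\<rceil>)"
    have "- v \<le> real (nat \<lceil>- v\<rceil>)" by linarith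
    then have "- real ?M \<le> v" by linarith
    then have "\<mu> \<in> W ?M" using insert v by (simp add: W_def)
    moreover have "S \<subseteq> W ?M" using N W_mono[of N ?M] by auto
    ultimately show ?case by blast
  qed auto
  then obtain N where "S \<subseteq> W N" by blast
  then have "S \<subseteq> W (max N N0)" using W_mono[of N "max N N0"] by auto
  then show ?thesis by (rule that[rotated]) simp
qed

lemma poly_H: "poly (H N) z = (\<Prod>\<mu>\<in>W N. 1 - z / \<mu>)"
  by (simp add: H_def poly_prod divide_inverse)

text \<open>Convergence of the net is not uniform in \<open>z\<close>, but the bound is: the finite
  set needed for a given \<open>z\<close> is swallowed by some \<open>W N'\<close>, and
  \<open>H N' - H N\<close> is small on the whole unit disc.\<close>

lemma e_approx:
  assumes z: "0 \<le> w z"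
  shows "ereal (real N) \<le> w (z * poly (H N) z - e z)"
proof -
  obtain S where S: "finite S" "S \<subseteq> \<Lambda> - {0}"
    "\<And>T. finite T \<Longrightarrow> S \<subseteq> T \<Longrightarrow> T \<subseteq> \<Lambda> - {0} \<Longrightarrow> ereal (real N) < w (z * (\<Prod>\<mu>\<in>T. 1 - z / \<mu>) - e z)"
    by (rule exponential_eventually[of "real N" z]) (rule that)
  obtain N' where N': "N \<le> N'" "S \<subseteq> W N'" using subset_W[OF S(1,2)] .
  have 1: "ereal (real N) \<le> w (z * poly (H N') z - e z)"
    unfolding poly_H by (rule less_imp_le, rule S(3)) (use finite_W N' in \<open>auto simp: W_def\<close>)
  have 2: "ereal (real N) \<le> w (z * poly (H N' - H N) z)"
    using w_mult_int_ge[OF z poly_ge_poly[OF H_diff[OF N'(1)] z]] .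
  have eq: "z * poly (H N) z - e z = (z * poly (H N') z - e z) - z * poly (H N' - H N) z"
    by (simp add: algebra_simps)
  show ?thesis unfolding eq by (rule w_diff_ge[OF 1 2])
qed

lemma \<phi>t_integral: "poly_ge 0 \<phi>t"
  unfolding \<phi>t by (intro poly_ge_add poly_ge_monom) (use a12 w_\<gamma> in \<open>auto simp: zero_ereal_def\<close>)

text \<open>The functional equation of the exponential as an identity of power series; it determines
  the coefficients recursively since \<open>t\<close> is transcendental.\<close>

lemma functional_equation:
  defines "\<Psi> \<equiv> fps_of_poly (\<psi> [:0, 1:])"
  shows "(fps_X * h) oo \<Psi> = fps_const (\<gamma> [:0, 1:]) * (fps_X * h) +
    fps_const a1 * (fps_X * h) ^ q + fps_const a2 * (fps_X * h) ^ (q ^ 2)" (is "?L = ?R")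
proof -
  let ?E = "\<lambda>N. [:0, 1:] * H N"
  \<comment> \<open>The defect of the functional equation for the truncation. At an integral
    \<open>z\<close> the exact equation for \<open>e\<close> cancels, and two truncation errors
    remain.\<close>
  define Q where "Q N = pcompose (?E N) (\<psi> [:0, 1:]) - pcompose \<phi>t (?E N)" for N
  have E: "fps_of_poly (?E N) = fps_X * fps_of_poly (H N)" for N
    by (simp only: fps_of_poly_mult fps_of_poly_fps_X)
  have Q: "fps_of_poly (Q N) = ((fps_X * fps_of_poly (H N)) oo \<Psi>) -
      (fps_const (\<gamma> [:0, 1:]) * (fps_X * fps_of_poly (H N)) +
    fps_const a1 * (fps_X * fps_of_poly (H N)) ^ q + fps_const a2 * (fps_X * fps_of_poly (H N)) ^ (q ^ 2))" for N
    unfolding Q_def \<Psi>_def \<phi>t pcompose_add pcompose_monom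
    by (simp only: fps_of_poly_diff fps_of_poly_add fps_of_poly_smult fps_of_poly_power E
        fps_of_poly_pcompose \<psi>_coeff_0 power_one_right)
  have "ereal (real N) \<le> w (poly (Q N) z)" if z: "0 \<le> w z" for N z
  proof -
    let ?z = "act [:0, 1:] z"
    have z': "0 \<le> w ?z" by (rule act_integral[OF z])
    have eN: "0 \<le> w (poly (?E N) z)"
      using w_mult_int[OF z, of "poly (H N) z"] poly_ge_poly[OF H_integral z] by (simp add: zero_ereal_def)
    have ez: "0 \<le> w (e z)"
      using w_diff_ge[OF eN, of "z * poly (H N) z - e z"] e_approx[OF z, of N]
      by (simp add: order_trans[of 0 "ereal (real N)"])
    have 1: "ereal (real N) \<le> w (poly (?E N) ?z - e ?z)" using e_approx[OF z'] by simp
    have "ereal (real N) \<le> w (poly (?E N) z - e z)" using e_approx[OF z] by simp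
    also have "\<dots> \<le> w (poly \<phi>t (poly (?E N) z) - poly \<phi>t (e z))"
      by (rule poly_ge_diff_poly[OF \<phi>t_integral eN ez])
    finally have 2: "ereal (real N) \<le> w (poly \<phi>t (poly (?E N) z) - poly \<phi>t (e z))" .
    have "poly (Q N) z = (poly (?E N) ?z - e ?z) - (poly \<phi>t (poly (?E N) z) - poly \<phi>t (e z))"
      by (simp add: Q_def poly_pcompose e_act)
    then show ?thesis using w_diff_ge[OF 1 2] by simp
  qed
  \<comment> \<open>From values to coefficients: the loss \<open>i\<close> is fixed while
    \<open>N\<close> grows, so each coefficient of the defect tends to 0.\<close>
  then have Qc: "ereal (real N - real i) \<le> w (Polynomial.coeff (Q N) i)" for N i
    by (rule coeff_bound_of_poly_bound[OF \<pi>(2)]) (use nth_root_exists in auto)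
  have "fconv (\<lambda>N. fps_of_poly (Q N)) 0"
    unfolding fconv_def wlim_def
  proof (intro allI)
    fix i and r :: real
    show "\<forall>\<^sub>F N in sequentially. ereal r \<le> w (fps_nth (fps_of_poly (Q N)) i - fps_nth 0 i)"
      using eventually_ge_at_top[of "nat \<lceil>r + real i\<rceil>"]
    proof eventually_elim
      case (elim N)
      then have "r + real i \<le> real N" by linarith
      then have "ereal r \<le> ereal (real N - real i)" by simp
      from order_trans[OF this Qc] show ?case by simp
    qed
  qed
  moreover have "fconv (\<lambda>N. fps_of_poly (Q N)) (?L - ?R)"
    unfolding Q by (intro fconv_diff fconv_add fconv_mult fconv_power fconv_compose fconv_const h)
  ultimately have "0 = ?L - ?R" by (rule fconv_unique)
  then show ?thesis by simp
qed

lemma h_0: "fps_nth h 0 = 1"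
proof -
  have "Polynomial.coeff (H N) 0 = 1" for N
    unfolding poly_0_coeff_0[symmetric] poly_H by simp
  moreover have "wlim (\<lambda>N. Polynomial.coeff (H N) 0) (fps_nth h 0)" using h by (simp add: fconv_def)
  ultimately have "wlim (\<lambda>_. 1) (fps_nth h 0)" by simp
  from wlim_unique[OF this wlim_const] show ?thesis .
qed

text \<open>In degree \<open>j + 1\<close> the coefficient \<open>h_j\<close> occurs twice, with
  factor \<open>t ^ (j + 1)\<close> from the composition and with factor \<open>t\<close> from the
  linear term. Everything else involves earlier coefficients: powers of \<open>X * h\<close> with
  exponent at least 2 shift the index down.\<close>

lemma h_in_K: "fps_nth h j \<in> K"
proof (induction j rule: less_induct)
  case (less j)
  show ?case
  proof (cases "j = 0")
    case True
    then show ?thesis using h_0 sf_1[OF K] by simp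
  next
    case False
    let ?\<Psi> = "fps_of_poly (\<psi> [:0, 1:])" and ?E = "fps_X * h" and ?i = "Suc j" and ?t = "\<gamma> [:0, 1:]"
    have \<Psi>K: "fps_nth (?\<Psi> ^ k) i \<in> K" for k i
      by (rule fps_nth_power_in_subfield[OF K _ order.refl]) (simp add: polys_over_coeff[OF \<psi>_polys_over])
    have Ek: "fps_nth ?E k \<in> K" if "k \<le> j" for k
      using less.IH[of "k - 1"] that False sf_0[OF K] by (cases k) auto
    have L: "fps_nth (?E oo ?\<Psi>) ?i = (\<Sum>k\<le>j. fps_nth ?E k * fps_nth (?\<Psi> ^ k) ?i) + fps_nth h j * ?t ^ ?i"
    proof -
      have "fps_nth (?\<Psi> ^ ?i) ?i = ?t ^ ?i"
        using startsby_zero_power_nth_same[of ?\<Psi> ?i] \<psi>_coeff_0 \<psi>_coeff_1 by simp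
      then show ?thesis by (simp add: fps_compose_nth atLeast0AtMost)
    qed
    have pw: "fps_nth (?E ^ k) ?i \<in> K" if "2 \<le> k" for k
    proof (cases "?i < k")
      case True
      then show ?thesis by (simp add: power_mult_distrib fps_X_power_mult_nth sf_0[OF K])
    next
      case False
      have "fps_nth (h ^ k) (?i - k) \<in> K"
        by (rule fps_nth_power_in_subfield[OF K _ order.refl], rule less.IH) (use that False in auto)
      then show ?thesis using False by (simp add: power_mult_distrib fps_X_power_mult_nth)
    qed
    have q2: "2 \<le> q ^ 2" using q_ge_2 power_increasing[of 1 2 q] by simp
    have "fps_nth h j * ?t ^ ?i - ?t * fps_nth h j =
      a1 * fps_nth (?E ^ q) ?i + a2 * fps_nth (?E ^ (q ^ 2)) ?i - (\<Sum>k\<le>j. fps_nth ?E k * fps_nth (?\<Psi> ^ k) ?i)"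
      using arg_cong[OF functional_equation, of "\<lambda>F. fps_nth F ?i"] L by (simp add: algebra_simps)
    also have "\<dots> \<in> K"
      by (intro sf_diff[OF K] sf_add[OF K] sf_mult[OF K] sf_sum[OF K] a12 pw q_ge_2 q2 Ek \<Psi>K) simp
    finally have "(?t ^ ?i - ?t) * fps_nth h j \<in> K" by (simp add: algebra_simps)
    moreover have "?t ^ ?i - ?t \<in> K" by (intro sf_diff[OF K] sf_power[OF K] \<gamma>_K)
    moreover have "?t ^ ?i - ?t \<noteq> 0" using t_power[of ?i] False by simp
    ultimately show ?thesis using sf_divide[OF K, of "(?t ^ ?i - ?t) * fps_nth h j" "?t ^ ?i - ?t"] by simp
  qed
qed

section \<open>Power sums of the reciprocal lattice points\<close>

definition power_sum :: "nat \<Rightarrow> nat \<Rightarrow> 'c"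
  where "power_sum N k = (\<Sum>\<mu>\<in>W N. inverse \<mu> ^ k)"

text \<open>Newton's identities are solved for the power sums, not for the coefficients; in this
  direction there is no division by \<open>k\<close>, which could be 0 in characteristic
  \<open>p\<close>.\<close>

lemma power_sum_limit: "0 < k \<Longrightarrow> \<exists>g\<in>K. wlim (\<lambda>N. power_sum N k) g"
proof (induction k rule: less_induct)
  case (less k)
  let ?h = "\<lambda>N i. Polynomial.coeff (H N) i"
  have Hp: "fps_of_poly (H N) = (\<Prod>\<mu>\<in>W N. 1 - fps_const (inverse \<mu>) * fps_X)" for N
    by (simp add: H_def fps_of_poly_prod fps_of_poly_linear' flip: fps_const_neg)
  let ?G = "\<lambda>N. Abs_fps (\<lambda>k. if k = 0 then 0 else power_sum N k)"
  have newton: "power_sum N k = - (of_nat k * ?h N k) - (\<Sum>i\<in>{1..<k}. power_sum N i * ?h N (k - i))" for N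
  proof -
    have "fps_X * fps_deriv (fps_of_poly (H N)) = - (?G N * fps_of_poly (H N))"
      unfolding Hp power_sum_def by (rule newton_power_sums[OF finite_W])
    from arg_cong[OF this, of "\<lambda>F. fps_nth F k"]
    have "of_nat k * ?h N k = - (\<Sum>i=0..k. (if i = 0 then 0 else power_sum N i) * ?h N (k - i))"
      using less.prems by (simp add: fps_mult_nth[of "?G N"])
    also have "{0..k} = insert 0 (insert k {1..<k})" using less.prems by auto
    also have "(\<Sum>i\<in>\<dots>. (if i = 0 then 0 else power_sum N i) * ?h N (k - i)) =
      power_sum N k * ?h N 0 + (\<Sum>i\<in>{1..<k}. power_sum N i * ?h N (k - i))"
      using less.prems by simp
    also have "?h N 0 = 1" unfolding poly_0_coeff_0[symmetric] poly_H by simp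
    finally have "of_nat k * ?h N k = - (power_sum N k * 1 + (\<Sum>i\<in>{1..<k}. power_sum N i * ?h N (k - i)))" .
    then show ?thesis by (simp only:) simp
  qed
  have "\<exists>g\<in>K. wlim (\<lambda>N. power_sum N i) g" if "i \<in> {1..<k}" for i using less.IH[of i] that by auto
  then obtain g where g: "\<And>i. i \<in> {1..<k} \<Longrightarrow> g i \<in> K" "\<And>i. i \<in> {1..<k} \<Longrightarrow> wlim (\<lambda>N. power_sum N i) (g i)"
    by metis
  have hl: "wlim (\<lambda>N. ?h N i) (fps_nth h i)" for i using h by (simp add: fconv_def)
  have "wlim (\<lambda>N. power_sum N k) (- (of_nat k * fps_nth h k) - (\<Sum>i\<in>{1..<k}. g i * fps_nth h (k - i)))"
    unfolding newton by (intro wlim_diff wlim_minus wlim_cmult hl wlim_sum wlim_mult g)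
  moreover have "- (of_nat k * fps_nth h k) - (\<Sum>i\<in>{1..<k}. g i * fps_nth h (k - i)) \<in> K"
    by (intro sf_diff[OF K] sf_uminus[OF K] sf_mult[OF K] sf_of_nat[OF K] sf_sum[OF K] h_in_K g)
  ultimately show ?case by blast
qed

text \<open>When \<open>q - 1\<close> divides \<open>k\<close>, all \<open>q - 1\<close> points of
  the first shell contribute the same \<open>1 / s ^ k\<close>, in total \<open>- 1 / s ^ k\<close>
  because \<open>q = 0\<close>. Every other point contributes valuation at least
  \<open>k q R\<close>.\<close>

lemma power_sum_main_term:
  assumes k: "(q - 1) dvd k" "0 < k" and g: "wlim (\<lambda>N. power_sum N k) g"
  shows "ereal (real k * (real q * R)) \<le> w (g + inverse s ^ k)"
proof (rule wlim_ge)
  show "wlim (\<lambda>N. power_sum N k + inverse s ^ k) (g + inverse s ^ k)"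
    by (intro wlim_add g wlim_const)
  show "\<forall>\<^sub>F N in sequentially. ereal (real k * (real q * R)) \<le> w (power_sum N k + inverse s ^ k)"
    using eventually_ge_at_top[of "nat \<lceil>R\<rceil>"]
  proof eventually_elim
    case (elim N)
    then have "R \<le> real N" by linarith
    then have sub: "small_points \<subseteq> W N" using small_points by (auto simp: W_def)
    have "(\<Sum>\<mu>\<in>small_points. inverse \<mu> ^ k) = (\<Sum>c\<in>UNIV - {0}. inverse (\<gamma> [:c:] * s) ^ k)"
      unfolding small_points_def by (rule sum.reindex[OF small_points_inj, unfolded o_def])
    also have "\<dots> = (\<Sum>c\<in>UNIV - {0::'q}. inverse s ^ k)"
    proof (rule sum.cong[OF refl])
      fix c :: 'q assume c: "c \<in> UNIV - {0}"
      obtain l where "k = (q - 1) * l" using k(1) by (auto elim: dvdE)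
      then have "\<gamma> [:c:] ^ k = 1" using const_power(1)[of c] c by (simp add: power_mult)
      then show "inverse (\<gamma> [:c:] * s) ^ k = inverse s ^ k"
        by (simp add: power_mult_distrib power_inverse)
    qed
    also have "\<dots> = of_nat (q - 1) * inverse s ^ k" by (simp add: card_Diff_singleton card_q)
    also have "of_nat (q - 1) = (- 1 :: 'c)" using of_nat_q q_ge_2 by (simp add: of_nat_diff)
    finally have main: "(\<Sum>\<mu>\<in>small_points. inverse \<mu> ^ k) = - (inverse s ^ k)" by simp
    have "power_sum N k = (\<Sum>\<mu>\<in>W N - small_points. inverse \<mu> ^ k) + (\<Sum>\<mu>\<in>small_points. inverse \<mu> ^ k)"
      unfolding power_sum_def by (rule sum.subset_diff[OF sub finite_W])
    then have eq: "power_sum N k + inverse s ^ k = (\<Sum>\<mu>\<in>W N - small_points. inverse \<mu> ^ k)"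
      using main by simp
    show ?case
      unfolding eq
    proof (rule w_sum_ge)
      fix \<mu> assume \<mu>: "\<mu> \<in> W N - small_points"
      then have L: "\<mu> \<in> \<Lambda> - {0}" by (auto simp: W_def)
      have "w \<mu> \<le> ereal (- (real q * R))" using \<mu> by (cases rule: \<Lambda>_cases[OF L]) auto
      then have "ereal (real q * R) \<le> w (inverse \<mu>)" by (rule w_inverse_ge[OF L])
      then have "ereal (real k) * ereal (real q * R) \<le> ereal (real k) * w (inverse \<mu>)"
        by (intro ereal_mult_left_mono) auto
      then show "ereal (real k * (real q * R)) \<le> w (inverse \<mu> ^ k)" by (simp only: w_power times_ereal.simps)
    qed
  qed
qed

text \<open>Bernoulli's method: consecutive power sums of the \<open>1 / \<mu>\<close> have quotients converging to the
  dominant \<open>1 / s ^ (q - 1)\<close>.\<close>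

lemma s_power_in_K: "s ^ (q - 1) \<in> K"
proof -
  define y where "y = inverse s ^ (q - 1)"
  define \<delta> where "\<delta> = real (q - 1) * R"
  have \<delta>: "0 < \<delta>" using q_ge_2 R_pos by (simp add: \<delta>_def)
  have wy: "w y = ereal \<delta>" using s_nonzero w_s by (simp add: y_def w_power w_inverse \<delta>_def)
  have y0: "y \<noteq> 0" using s_nonzero by (simp add: y_def)
  have "\<exists>g. \<forall>n>0. g n \<in> K \<and> wlim (\<lambda>N. power_sum N ((q - 1) * n)) (g n)"
  proof (intro choice allI)
    fix n
    show "\<exists>g. 0 < n \<longrightarrow> g \<in> K \<and> wlim (\<lambda>N. power_sum N ((q - 1) * n)) g"
      using power_sum_limit[of "(q - 1) * n"] q_ge_2 by auto
  qed
  then obtain g where g: "\<And>n. 0 < n \<Longrightarrow> g n \<in> K" "\<And>n. 0 < n \<Longrightarrow> wlim (\<lambda>N. power_sum N ((q - 1) * n)) (g n)"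
    by blast
  \<comment> \<open>The error has valuation at least \<open>q n \<delta>\<close>, and
    \<open>q \<ge> 2\<close> makes this twice the valuation of \<open>y ^ n\<close>; thus
    \<open>g n\<close> is \<open>- y ^ n\<close> up to a relative error that tends to 0.\<close>
  have gy: "ereal (2 * real n * \<delta>) \<le> w (g n + y ^ n)" if n: "0 < n" for n
  proof -
    have "ereal (real ((q - 1) * n) * (real q * R)) \<le> w (g n + inverse s ^ ((q - 1) * n))"
      by (rule power_sum_main_term[OF _ _ g(2)[OF n]]) (use q_ge_2 n in auto)
    moreover have "2 * real n * \<delta> \<le> real ((q - 1) * n) * (real q * R)"
    proof -
      have "2 * (real n * \<delta>) \<le> real q * (real n * \<delta>)" using \<delta> q_ge_2 by (intro mult_right_mono) auto
      also have "\<dots> = real ((q - 1) * n) * (real q * R)" by (simp only: \<delta>_def of_nat_mult mult_ac)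
      finally show ?thesis by simp
    qed
    then have "ereal (2 * real n * \<delta>) \<le> ereal (real ((q - 1) * n) * (real q * R))" by (simp only: ereal_less_eq)
    ultimately show ?thesis unfolding y_def power_mult by (rule order_trans[rotated])
  qed
  have wg: "w (g n) = ereal (real n * \<delta>)" if n: "0 < n" for n
  proof -
    have "w (- (y ^ n)) = ereal (real n * \<delta>)" by (simp add: w_power wy)
    moreover have "ereal (real n * \<delta>) < ereal (2 * real n * \<delta>)" using n \<delta> by simp
    ultimately have "w (- (y ^ n)) < w (g n + y ^ n)" using gy[OF n] by (metis order_less_le_trans)
    then have "w (- (y ^ n) + (g n + y ^ n)) = w (- (y ^ n))" by (rule w_add_eq)
    then show ?thesis by (simp add: w_power wy)
  qed
  let ?x = "\<lambda>n. g (Suc (Suc n)) / g (Suc n)"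
  have approx: "ereal (real (Suc n) * \<delta>) \<le> w (?x n - y)" for n
  proof -
    have g0: "g (Suc n) \<noteq> 0" using wg[of "Suc n"] by auto
    \<comment> \<open>The main terms cancel, so that only the errors estimated in \<open>gy\<close>
      are left in the numerator.\<close>
    have eq: "?x n - y = ((g (Suc (Suc n)) + y ^ Suc (Suc n)) - y * (g (Suc n) + y ^ Suc n)) / g (Suc n)"
      using g0 by (simp add: field_simps)
    have "ereal (2 * real (Suc n) * \<delta>) \<le> ereal (2 * real (Suc (Suc n)) * \<delta>)"
      using \<delta> by (simp add: mult_right_mono)
    also have "\<dots> \<le> w (g (Suc (Suc n)) + y ^ Suc (Suc n))" by (rule gy) simp
    finally have 1: "ereal (2 * real (Suc n) * \<delta>) \<le> w (g (Suc (Suc n)) + y ^ Suc (Suc n))" .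
    have 2: "ereal (2 * real (Suc n) * \<delta>) \<le> w (y * (g (Suc n) + y ^ Suc n))"
      by (rule w_mult_int_ge[OF _ gy]) (use wy \<delta> in auto)
    have "ereal (2 * real (Suc n) * \<delta>) - ereal (real (Suc n) * \<delta>) \<le>
      w ((g (Suc (Suc n)) + y ^ Suc (Suc n)) - y * (g (Suc n) + y ^ Suc n)) - w (g (Suc n))"
      unfolding wg[of "Suc n", simplified] using w_diff_ge[OF 1 2]
      by (intro ereal_minus_mono) auto
    then show ?thesis unfolding eq w_divide[OF g0] by (simp add: algebra_simps)
  qed
  have "wlim ?x y"
    unfolding wlim_def
  proof
    fix r :: real
    show "\<forall>\<^sub>F n in sequentially. ereal r \<le> w (?x n - y)"
      using eventually_ge_at_top[of "nat \<lceil>r / \<delta>\<rceil>"]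
    proof eventually_elim
      case (elim n)
      then have "r / \<delta> \<le> real (Suc n)" by linarith
      then have "ereal r \<le> ereal (real (Suc n) * \<delta>)" using \<delta> by (simp add: field_simps)
      then show ?case using approx by (rule order_trans)
    qed
  qed
  then have "y \<in> K" by (rule wlim_closed[OF K_complete, rotated]) (auto intro!: sf_divide[OF K] g)
  then have "inverse y \<in> K" by (rule sf_inverse[OF K])
  then show ?thesis by (simp add: y_def power_inverse)
qed

text \<open>A factor \<open>1 - z / \<mu>\<close> has valuation 0 if \<open>\<mu>\<close> is larger
  than \<open>z\<close>, and \<open>w z - w \<mu>\<close> if it is smaller; \<open>ne\<close>
  excludes ties. A finite product containing all of \<open>A\<close> therefore has the stated
  valuation, and once it approximates \<open>e z\<close> beyond that valuation, \<open>e z\<close>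
  has it too.\<close>

lemma e_value:
  assumes z: "w z = ereal v" and ne: "\<And>\<mu>. \<mu> \<in> \<Lambda> - {0} \<Longrightarrow> w \<mu> \<noteq> ereal v"
    and A: "A = {\<mu> \<in> \<Lambda> - {0}. ereal v < w \<mu>}" and wA: "\<And>\<mu>. \<mu> \<in> A \<Longrightarrow> w \<mu> = ereal r"
  shows "w (e z) = ereal (v + real (card A) * (v - r))"
proof -
  have z0: "z \<noteq> 0" using z by auto
  have fA: "finite A" unfolding A by (rule finite_subset[OF _ \<Lambda>_finite[of v]]) auto
  let ?v = "v + real (card A) * (v - r)"
  obtain S where S: "finite S" "S \<subseteq> \<Lambda> - {0}"
    "\<And>T. finite T \<Longrightarrow> S \<subseteq> T \<Longrightarrow> T \<subseteq> \<Lambda> - {0} \<Longrightarrow> ereal ?v < w (z * (\<Prod>\<mu>\<in>T. 1 - z / \<mu>) - e z)"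
    by (rule exponential_eventually[of ?v z]) (rule that)
  let ?T = "S \<union> A"
  have f: "w (1 - z / \<mu>) = ereal (if \<mu> \<in> A then v - r else 0)" if \<mu>: "\<mu> \<in> ?T" for \<mu>
  proof -
    have L: "\<mu> \<in> \<Lambda> - {0}" using \<mu> S(2) A by blast
    then have "\<mu> \<noteq> 0" by simp
    then obtain u where u: "w \<mu> = ereal u" by (rule w_real)
    have d: "w (z / \<mu>) = ereal (v - u)" using L by (simp add: w_divide z u)
    show ?thesis
    proof (cases "\<mu> \<in> A")
      case True
      then have "u = r" using wA[OF True] u by simp
      moreover have "v < u" using True u unfolding A by simp
      ultimately have "u = r" "v < r" by simp_all
      then show ?thesis using True d w_diff_eq'[of "z / \<mu>" 1] by (simp add: zero_ereal_def)
    next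
      case False
      then have "\<not> ereal v < w \<mu>" using L unfolding A by simp
      then have "u < v" using u ne[OF L] by simp
      then show ?thesis using False d w_diff_eq[of 1 "z / \<mu>"] by (simp add: zero_ereal_def)
    qed
  qed
  have "w (z * (\<Prod>\<mu>\<in>?T. 1 - z / \<mu>)) = ereal v + (\<Sum>\<mu>\<in>?T. ereal (if \<mu> \<in> A then v - r else 0))"
    by (simp only: w_mult w_prod z f cong: sum.cong)
  also have "(\<Sum>\<mu>\<in>?T. ereal (if \<mu> \<in> A then v - r else 0)) = ereal (real (card A) * (v - r))"
  proof -
    have "(\<Sum>\<mu>\<in>?T. if \<mu> \<in> A then v - r else 0) = (\<Sum>\<mu>\<in>A. v - r)"
      using S(1) fA by (intro sum.mono_neutral_cong_right) auto
    then show ?thesis by (simp add: sum_ereal)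
  qed
  finally have P: "w (z * (\<Prod>\<mu>\<in>?T. 1 - z / \<mu>)) = ereal ?v" by simp
  have "ereal ?v < w (z * (\<Prod>\<mu>\<in>?T. 1 - z / \<mu>) - e z)"
  proof (rule S(3))
    show "finite ?T" using S(1) fA by simp
    show "?T \<subseteq> \<Lambda> - {0}" using S(2) A by blast
  qed simp
  then have "w (z * (\<Prod>\<mu>\<in>?T. 1 - z / \<mu>) - (z * (\<Prod>\<mu>\<in>?T. 1 - z / \<mu>) - e z)) = ereal ?v"
    using P by (subst w_diff_eq) auto
  then show ?thesis by simp
qed

text \<open>At \<open>w z = v\<close> with \<open>v = - 3 R / 4\<close> no nonzero lattice point is
  as small as \<open>z\<close>, so \<open>w (e z) = v\<close>. The image
  \<open>act [:0, 1:] z\<close> has valuation \<open>q v\<close>, strictly between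
  \<open>- q R\<close> and \<open>- R\<close>, so just the \<open>q - 1\<close> points of the first
  shell count. The resulting value of \<open>\<phi>t\<close> at \<open>e z\<close> is larger in size
  than its first two terms permit; the term with \<open>a2\<close> must account for it.\<close>

lemma w_a2: "w a2 = ereal (real (q - 1) * R)"
proof -
  \<comment> \<open>Any valuation strictly between \<open>-R\<close> and \<open>-R / q\<close> will do.\<close>
  obtain z where z: "z ^ 4 = s ^ 3" using nth_root_exists[of 4 "s ^ 3"] by auto
  have z0: "z \<noteq> 0" using z s_nonzero by auto
  then obtain v where v: "w z = ereal v" by (rule w_real)
  have "ereal (real 4) * ereal v = ereal (real 3) * ereal (- R)"
    unfolding v[symmetric] w_s[symmetric] w_power[symmetric] z ..
  then have "4 * v = - (3 * R)" by simp
  then have vR: "v = - 3 * R / 4" by simp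
  have q2: "2 \<le> real q" using q_ge_2 by simp
  have qR: "2 * R \<le> real q * R" using q2 R_pos by (intro mult_right_mono) auto
  have nz: "w \<mu> \<noteq> ereal v \<and> \<not> ereal v < w \<mu>" if "\<mu> \<in> \<Lambda> - {0}" for \<mu>
  proof -
    have "ereal (- R) < ereal v" using R_pos vR by simp
    then have "w \<mu> < ereal v" using \<Lambda>_w_le[OF that] by (metis order_le_less_trans)
    then show ?thesis by auto
  qed
  let ?x = "e z" and ?z = "act [:0, 1:] z"
  have em: "{} = {\<mu> \<in> \<Lambda> - {0}. ereal v < w \<mu>}" using nz by blast
  have "w ?x = ereal (v + real (card ({} :: 'c set)) * (v - 0))"
    by (rule e_value[OF v _ em]) (use nz in blast)+
  then have x: "w ?x = ereal v" by simp
  have z': "w ?z = ereal (real q * v)" using act_large[OF _ v, of "[:0, 1:]"] R_pos vR by simp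
  have big: "ereal (- R) > ereal (real q * v)" "ereal (- (real q * R)) < ereal (real q * v)"
  proof -
    have qv: "real q * v = - (3 / 4) * (real q * R)" by (simp add: vR)
    have "0 < real q * R" using qR R_pos by linarith
    then show "ereal (- R) > ereal (real q * v)" "ereal (- (real q * R)) < ereal (real q * v)"
      unfolding qv using qR R_pos by simp_all
  qed
  have sp: "small_points = {\<mu> \<in> \<Lambda> - {0}. ereal (real q * v) < w \<mu>}"
  proof (intro equalityI subsetI)
    fix \<mu> assume "\<mu> \<in> small_points"
    then show "\<mu> \<in> {\<mu> \<in> \<Lambda> - {0}. ereal (real q * v) < w \<mu>}"
      using small_points[of \<mu>] big(1) by (simp only: mem_Collect_eq)
  next
    fix \<mu> assume \<mu>: "\<mu> \<in> {\<mu> \<in> \<Lambda> - {0}. ereal (real q * v) < w \<mu>}"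
    then have \<mu>L: "\<mu> \<in> \<Lambda> - {0}" by simp
    have "\<not> w \<mu> \<le> ereal (- (real q * R))"
      using \<mu> big(2) by (metis (mono_tags, lifting) mem_Collect_eq not_le order_less_trans)
    then show "\<mu> \<in> small_points" using \<Lambda>_cases[OF \<mu>L] by blast
  qed
  have "w (e ?z) = ereal (real q * v + real (card small_points) * (real q * v - - R))"
  proof (rule e_value[OF z' _ sp])
    fix \<mu> assume "\<mu> \<in> \<Lambda> - {0}"
    then show "w \<mu> \<noteq> ereal (real q * v)"
    proof (cases rule: \<Lambda>_cases)
      case 1
      then show ?thesis using small_points(2)[OF 1] big(1) by simp
    next
      case 2
      then show ?thesis using big(2) by (metis not_le)
    qed
  qed (rule small_points(2))
  then have wez: "w (poly \<phi>t ?x) = ereal (real q * v + (real q - 1) * (real q * v + R))"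
    using q_ge_2 by (simp add: card_small_points e_act of_nat_diff)
  let ?y = "\<gamma> [:0, 1:] * ?x + a1 * ?x ^ q"
  have wy: "w ?y = ereal (real q * v)"
  proof -
    have "w (a1 * ?x ^ q) = ereal (real q * v)" using a12 by (simp add: w_mult w_power x)
    moreover have "ereal v \<le> w (\<gamma> [:0, 1:] * ?x)" by (rule w_mult_int_ge[OF w_t]) (simp add: x)
    moreover have "ereal (real q * v) < ereal v"
    proof -
      have "real q * v \<le> 2 * v" using q2 vR R_pos by (intro mult_right_mono_neg) auto
      then show ?thesis using vR R_pos by simp
    qed
    ultimately have "w (a1 * ?x ^ q) < w (\<gamma> [:0, 1:] * ?x)" by (metis order_less_le_trans)
    from w_add_eq'[OF this] show ?thesis using \<open>w (a1 * ?x ^ q) = ereal (real q * v)\<close> by simp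
  qed
  have total: "poly \<phi>t ?x - ?y = a2 * ?x ^ (q ^ 2)" by (simp add: \<phi>t poly_monom)
  have lt: "real q * v + (real q - 1) * (real q * v + R) < real q * v"
  proof -
    have "real q * v + R < 0" using big(1) by simp
    then have "(real q - 1) * (real q * v + R) < 0" using q2 by (intro mult_pos_neg) auto
    then show ?thesis by simp
  qed
  have "w (poly \<phi>t ?x) < w ?y" unfolding wez wy using lt by (simp only: less_ereal.simps)
  from w_diff_eq[OF this]
  have wa: "w (a2 * ?x ^ (q ^ 2)) = ereal (real q * v + (real q - 1) * (real q * v + R))"
    unfolding total wez .
  then have "a2 * ?x ^ (q ^ 2) \<noteq> 0" by (metis PInfty_neq_ereal(1) w_eq_PInf)
  then have "a2 \<noteq> 0" by auto
  then obtain r where r: "w a2 = ereal r" by (rule w_real)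
  from wa have "r + real q ^ 2 * v = real q * v + (real q - 1) * (real q * v + R)"
    by (simp add: w_mult w_power x r)
  then have "r = (real q - 1) * R" by (simp add: algebra_simps power2_eq_square)
  then show ?thesis using r q_ge_2 by (simp add: of_nat_diff)
qed

end

section \<open>Herbrand functions of two-step filtrations\<close>

text \<open>The left endpoint is left free because ramification groups are constant on intervals
  open on the left, the index being rounded up.\<close>

lemma has_integral_step:
  fixes f :: "real \<Rightarrow> real"
  assumes "\<And>s. a < s \<Longrightarrow> s \<le> b \<Longrightarrow> f s = c" "a \<le> b"
  shows "(f has_integral c * (b - a)) {a..b}"
proof -
  have "((\<lambda>_. c) has_integral c * (b - a)) {a..b}"
    using has_integral_const_real[of c a b] assms(2) by (simp add: mult.commute)
  then show ?thesis
    by (rule has_integral_spike_finite[of "{a}", rotated 2]) (use assms(1) in auto)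
qed

lemma integral_two_steps:
  fixes f :: "real \<Rightarrow> real"
  assumes "\<And>s. 0 < s \<Longrightarrow> s \<le> a \<Longrightarrow> f s = c" "\<And>s. a < s \<Longrightarrow> f s = d" "0 \<le> a" "0 \<le> x"
  shows "integral {0..x} f = (if x \<le> a then c * x else c * a + d * (x - a))"
proof (cases "x \<le> a")
  case True
  have "(f has_integral c * (x - 0)) {0..x}"
    by (rule has_integral_step) (use assms True in auto)
  then show ?thesis using True by (simp add: integral_unique)
next
  case False
  have "(f has_integral c * (a - 0)) {0..a}" by (rule has_integral_step) (use assms in auto)
  moreover have "(f has_integral d * (x - a)) {a..x}" by (rule has_integral_step) (use assms False in auto)
  ultimately have "(f has_integral c * (a - 0) + d * (x - a)) {0..x}"
    using assms(3) False by (intro has_integral_combine[of 0 a x]) auto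
  then show ?thesis using False by (simp add: integral_unique)
qed

text \<open>\<open>E\<close> is the tame index, \<open>Q\<close> the order of the wild part and
  \<open>A\<close> its only break. \<open>herbrand_phi\<close> is then piecewise linear with slopes
  \<open>1 / E\<close> and \<open>1 / (E * Q)\<close>, and its strict monotonicity gives
  \<open>the_inv_into\<close> in the upper numbering a determined value.\<close>

lemma herbrand_psi_two_steps:
  fixes w :: "'c::field \<Rightarrow> ereal" and M K :: "'c set" and E Q A :: nat
  assumes pos: "0 < E" "0 < Q"
    and c0: "card (lower_ram_group w M K 0) = E * Q"
    and c1: "\<And>x. 0 < x \<Longrightarrow> x \<le> real A \<Longrightarrow> card (lower_ram_group w M K x) = Q"
    and c2: "\<And>x. real A < x \<Longrightarrow> card (lower_ram_group w M K x) = 1"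
    and R: "real E * R = real A"
  shows "-1 \<le> y \<Longrightarrow> y \<le> 0 \<Longrightarrow> herbrand_psi w M K y = y"
    and "0 \<le> y \<Longrightarrow> y \<le> R \<Longrightarrow> herbrand_psi w M K y = real E * y"
    and "R \<le> y \<Longrightarrow> herbrand_psi w M K y = real Q * real E * y - (real Q - 1) * real E * R"
proof -
  have Epos: "0 < real E" "0 < real Q" using pos by auto
  have R0: "0 \<le> R" using R Epos by (metis of_nat_0_le_iff zero_le_mult_iff less_le_not_le)
  have phi: "herbrand_phi w M K x = (if x \<le> 0 then x else if x \<le> real A then x / real E
      else R + (x - real A) / (real E * real Q))" for x
  proof (cases "x \<le> 0")
    case False
    have "integral {0..x} (\<lambda>s. real (card (lower_ram_group w M K s)) / real (card (lower_ram_group w M K 0))) =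
      (if x \<le> real A then (1 / real E) * x else (1 / real E) * real A + (1 / (real E * real Q)) * (x - real A))"
      by (rule integral_two_steps) (use c0 c1 c2 False Epos in auto)
    moreover have "(1 / real E) * real A = R" using R Epos by (simp add: field_simps)
    ultimately show ?thesis using False by (simp add: herbrand_phi_def)
  qed (simp add: herbrand_phi_def)
  have mono: "strict_mono (herbrand_phi w M K)"
  proof (rule strict_monoI)
    fix x y :: real assume xy: "x < y"
    have A1: "x / real E \<le> R" if "x \<le> real A" for x
      using that Epos R by (simp add: field_simps)
    have A2: "0 < (y - real A) / (real E * real Q)" if "real A < y" for y
      using that Epos by simp
    have A3: "x / real E < y / real E" using xy Epos by (simp add: divide_strict_right_mono)
    have A4: "(x - real A) / (real E * real Q) < (y - real A) / (real E * real Q)"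
      using xy Epos by (simp add: divide_strict_right_mono)
    have A5: "0 < y / real E" if "0 < y" using that Epos by simp
    show "herbrand_phi w M K x < herbrand_phi w M K y"
      unfolding phi using xy A1[of x] A2[of y] A3 A4 A5 R0 by auto
  qed
  then have inj: "inj_on (herbrand_phi w M K) {-1..}"
    using strict_mono_imp_inj_on inj_on_subset by blast
  \<comment> \<open>The explicit inverse of \<open>herbrand_phi\<close> for
    \<open>y \<ge> 0\<close>; it translates upper into lower indices.\<close>
  define lo where "lo y = (if y \<le> R then real E * y else real A + real E * real Q * (y - R))" for y
  have lo0: "0 \<le> lo y" if "0 \<le> y" for y using that Epos by (auto simp: lo_def)
  have loR: "lo y \<le> real A \<longleftrightarrow> y \<le> R" for y
  proof (cases "y \<le> R")
    case True
    then have "real E * y \<le> real E * R" using Epos by simp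
    then show ?thesis using True R by (simp add: lo_def)
  next
    case False
    then have "0 < real E * real Q * (y - R)" using Epos by simp
    then show ?thesis using False by (simp add: lo_def)
  qed
  have phi_lo: "herbrand_phi w M K (lo y) = y" if y: "0 \<le> y" for y
  proof (cases "y \<le> R")
    case True
    then have "lo y \<le> real A" using loR by simp
    then show ?thesis unfolding phi using True y Epos by (auto simp: lo_def mult_le_0_iff)
  next
    case False
    then have "\<not> lo y \<le> real A" using loR by simp
    moreover have "\<not> lo y \<le> 0" using calculation lo0[OF y] by linarith
    ultimately show ?thesis unfolding phi using False Epos by (simp add: lo_def)
  qed
  have up: "upper_ram_group w M K y = lower_ram_group w M K (lo y)" if y: "0 \<le> y" for y
  proof -
    have "the_inv_into {-1..} (herbrand_phi w M K) (herbrand_phi w M K (lo y)) = lo y"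
      by (rule the_inv_into_f_f[OF inj]) (use lo0[OF y] in auto)
    then show ?thesis by (simp add: upper_ram_group_def phi_lo[OF y])
  qed
  have u0: "card (upper_ram_group w M K 0) = E * Q"
    using up[of 0] R0 c0 by (simp add: lo_def)
  have u1: "card (upper_ram_group w M K s) = Q" if "0 < s" "s \<le> R" for s
  proof -
    have "0 < lo s" using that Epos by (simp add: lo_def)
    then show ?thesis using up[of s] c1[of "lo s"] loR[of s] that by simp
  qed
  have u2: "card (upper_ram_group w M K s) = 1" if "R < s" for s
    using up[of s] c2[of "lo s"] loR[of s] that R0 by simp
  have psi: "herbrand_psi w M K y = (if y \<le> R then real E * y else real E * R + real E * real Q * (y - R))"
    if y: "0 < y" for y
  proof -
    have "integral {0..y} (\<lambda>s. real (card (upper_ram_group w M K 0)) / real (card (upper_ram_group w M K s))) =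
      (if y \<le> R then real E * y else real E * R + (real E * real Q) * (y - R))"
      by (rule integral_two_steps) (use u0 u1 u2 y R0 Epos in auto)
    then show ?thesis using y by (simp add: herbrand_psi_def)
  qed
  have neg: "herbrand_psi w M K y = y" if "y \<le> 0" for y using that by (simp add: herbrand_psi_def)
  show "-1 \<le> y \<Longrightarrow> y \<le> 0 \<Longrightarrow> herbrand_psi w M K y = y" using neg .
  show "0 \<le> y \<Longrightarrow> y \<le> R \<Longrightarrow> herbrand_psi w M K y = real E * y"
    using psi[of y] neg[of y] by (cases "y = 0") auto
  show "herbrand_psi w M K y = real Q * real E * y - (real Q - 1) * real E * R" if "R \<le> y"
  proof (cases "y = 0")
    case True
    then show ?thesis using that R0 neg[of y] by simp
  next
    case False
    then have "0 < y" using that R0 by simp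
    then show ?thesis using psi[of y] that by (cases "y = R") (auto simp: algebra_simps)
  qed
qed

section \<open>Ramification indices from value groups\<close>

text \<open>The multiples \<open>i * \<rho>\<close> with \<open>i < m\<close> represent the cosets
  of the integers; two of them are distinct because a difference \<open>(j - i) * \<rho>\<close> is
  never integral.\<close>

lemma ram_index_eq:
  assumes K: "value_group w K = \<int>" and M: "value_group w M = {of_int z + real i * \<rho> | z i. i < m}"
    and m: "0 < m" "\<And>i. 0 < i \<Longrightarrow> i < m \<Longrightarrow> real i * \<rho> \<notin> \<int>"
  shows "ram_index w K M = m"
proof -
  let ?C = "\<lambda>i. {of_int z + real i * \<rho> | z. True}"
  have coset: "{h + (of_int z + real i * \<rho>) | h. h \<in> \<int>} = ?C i" for z i
  proof (intro equalityI subsetI)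
    fix x assume "x \<in> {h + (of_int z + real i * \<rho>) | h. h \<in> \<int>}"
    then obtain l :: int where "x = of_int l + (of_int z + real i * \<rho>)" by (auto elim: Ints_cases)
    then have "x = of_int (l + z) + real i * \<rho>" by simp
    then show "x \<in> ?C i" by blast
  next
    fix x assume "x \<in> ?C i"
    then obtain l where "x = of_int l + real i * \<rho>" by blast
    then have "x = of_int (l - z) + (of_int z + real i * \<rho>)" by simp
    then show "x \<in> {h + (of_int z + real i * \<rho>) | h. h \<in> \<int>}" using Ints_of_int by blast
  qed
  have "(rcosets\<^bsub>additive_group (value_group w M)\<^esub> (value_group w K)) =
      (\<lambda>a. {h + a | h. h \<in> \<int>}) ` value_group w M"
    by (auto simp: RCOSETS_def r_coset_def additive_group_def K)
  also have "\<dots> = ?C ` {..<m}"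
  proof (intro equalityI subsetI)
    fix lo assume "lo \<in> (\<lambda>a. {h + a | h. h \<in> \<int>}) ` value_group w M"
    then obtain z i where "i < m" "lo = {h + (of_int z + real i * \<rho>) | h. h \<in> \<int>}" unfolding M by blast
    then show "lo \<in> ?C ` {..<m}" unfolding coset by blast
  next
    fix lo assume "lo \<in> ?C ` {..<m}"
    then obtain i where i: "i < m" "lo = {h + (of_int 0 + real i * \<rho>) | h. h \<in> \<int>}" unfolding coset by blast
    moreover have "of_int 0 + real i * \<rho> \<in> value_group w M" unfolding M using i(1) by blast
    ultimately show "lo \<in> (\<lambda>a. {h + a | h. h \<in> \<int>}) ` value_group w M" by blast
  qed
  also have "card \<dots> = m"
  proof -
    have ne: "?C i \<noteq> ?C j" if ij: "i < j" "j < m" for i j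
    proof
      assume "?C i = ?C j"
      moreover have "real j * \<rho> = of_int 0 + real j * \<rho>" by simp
      then have "real j * \<rho> \<in> ?C j" by blast
      ultimately have "real j * \<rho> \<in> ?C i" by (simp only:)
      then obtain z where "real j * \<rho> = of_int z + real i * \<rho>" by blast
      then have "real (j - i) * \<rho> = of_int z" using ij by (simp add: of_nat_diff algebra_simps)
      then have "real (j - i) * \<rho> \<in> \<int>" by (simp only: Ints_of_int)
      moreover have "0 < j - i" "j - i < m" using ij by auto
      ultimately show False using m(2) by blast
    qed
    have "inj_on ?C {..<m}"
    proof (rule inj_onI)
      fix i j assume "i \<in> {..<m}" "j \<in> {..<m}" "?C i = ?C j"
      then show "i = j" using ne[of i j] ne[of j i] by (metis lessThan_iff linorder_neqE_nat)
    qed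
    then show ?thesis by (simp add: card_image)
  qed
  finally show ?thesis by (simp add: ram_index_def)
qed

context valued
begin

lemma value_group_ramified:
  assumes N: "subfield N ambient"
    and NZ: "\<And>x. x \<in> N \<Longrightarrow> x \<noteq> 0 \<Longrightarrow> \<exists>k::int. w x = ereal (of_int k)"
    and a: "w a = ereal \<rho>" and m: "\<And>i. 0 < i \<Longrightarrow> i < m \<Longrightarrow> real i * \<rho> \<notin> \<int>"
    and g: "is_min_poly N a g" "Polynomial.degree g = m"
    and M: "subfield M ambient" "M \<subseteq> simple_ext N a" "a \<in> M" "\<pi> \<in> M" "w \<pi> = 1"
  shows "value_group w M = {of_int z + real i * \<rho> | z i. i < m}"
proof (intro equalityI subsetI)
  fix v assume "v \<in> value_group w M"
  then obtain x where x: "x \<in> M" "x \<noteq> 0" "w x = ereal v" by (auto simp: value_group_def)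
  have "x \<in> simple_ext N a" using M(2) x(1) by blast
  then obtain f where f: "f \<in> polys_over N" "x = poly f a" "Polynomial.degree f < m"
    unfolding g(2)[symmetric] by (rule simple_ext_reduced[OF N g(1)])
  have "f \<noteq> 0" using f(2) x(2) by auto
  from ramified_values(2)[OF N NZ a m f(1,3) this]
  obtain i where i: "i < m" "Polynomial.coeff f i \<noteq> 0" "w x = w (Polynomial.coeff f i * a ^ i)"
    using f(2) by blast
  obtain k :: int where "w (Polynomial.coeff f i) = ereal (of_int k)"
    using NZ[OF polys_over_coeff[OF f(1)] i(2)] by blast
  then have "v = of_int k + real i * \<rho>" using i(3) x(3) by (simp add: w_mult w_power a)
  then show "v \<in> {of_int z + real i * \<rho> | z i. i < m}" using i(1) by blast
next
  fix v assume "v \<in> {of_int z + real i * \<rho> | z i. i < m}"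
  then obtain z i where v: "v = of_int z + real i * \<rho>" by blast
  have a0: "a \<noteq> 0" and \<pi>0: "\<pi> \<noteq> 0" using a M(5) by auto
  let ?x = "\<pi> powi z * a ^ i"
  have "?x \<in> M" using M(3,4)
    by (simp add: power_int_def sf_mult[OF M(1)] sf_power[OF M(1)] sf_inverse[OF M(1)])
  moreover have "?x \<noteq> 0" using a0 \<pi>0 by simp
  moreover have "w ?x = ereal v" using \<pi>0 by (simp add: w_mult w_power w_power_int a M(5) v)
  ultimately show "v \<in> value_group w M" unfolding value_group_def by blast
qed

text \<open>In \<open>\<epsilon> ^ i - 1 = (\<epsilon> - 1) * (1 + \<epsilon> + \<dots>)\<close> the
  second factor is congruent to the unit \<open>i\<close>.\<close>

lemma w_power_minus_1:
  assumes "0 < w (\<epsilon> - 1)" "w (of_nat i) = 0"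
  shows "w (\<epsilon> ^ i - 1) = w (\<epsilon> - 1)"
proof -
  have small: "0 < w (\<epsilon> ^ k - 1)" for k
  proof (induction k)
    case (Suc k)
    have "w (1 + (\<epsilon> - 1)) = w 1" by (rule w_add_eq) (use assms(1) in simp)
    then have "w \<epsilon> = 0" by simp
    then have "0 < w (\<epsilon> * (\<epsilon> ^ k - 1))" using Suc by (simp add: w_mult)
    then have "0 < w (\<epsilon> * (\<epsilon> ^ k - 1) + (\<epsilon> - 1))" using assms(1) by (rule w_add_gt)
    then show ?case by (simp add: algebra_simps)
  qed simp
  have e1: "(\<Sum>k<i. \<epsilon> ^ k) = of_nat i + (\<Sum>k<i. \<epsilon> ^ k - 1)" by (simp add: sum_subtractf)
  have "0 < w (\<Sum>k<i. \<epsilon> ^ k - 1)"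
  proof (induction i)
    case (Suc i)
    then show ?case using small[of i] by (simp add: w_add_gt)
  qed simp
  then have "w (\<Sum>k<i. \<epsilon> ^ k) = 0"
    unfolding e1 using w_add_eq[of "of_nat i" "\<Sum>k<i. \<epsilon> ^ k - 1"] assms(2) by simp
  moreover have "\<epsilon> ^ i - 1 = (\<epsilon> - 1) * (\<Sum>k<i. \<epsilon> ^ k)" by (rule power_diff_1_eq)
  ultimately show ?thesis by (simp add: w_mult)
qed

lemma w_power_minus_1_ge:
  assumes "0 \<le> w \<epsilon>" shows "w (\<epsilon> - 1) \<le> w (\<epsilon> ^ i - 1)"
proof -
  have "0 \<le> w (\<Sum>k<i. \<epsilon> ^ k)" by (rule w_sum_ge) (rule w_power_int_ge[OF assms])
  moreover have "\<epsilon> ^ i - 1 = (\<Sum>k<i. \<epsilon> ^ k) * (\<epsilon> - 1)" by (simp add: power_diff_1_eq mult.commute)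
  ultimately show ?thesis by (simp only: w_mult_int_ge order.refl)
qed

end

lemma galois_group_id:
  fixes M :: "'c::field set"
  assumes M: "subfield M ambient" "K \<subseteq> M"
  shows "restrict id M \<in> carrier (galois_group M K)"
  using M(2) unfolding galois_group_iff[OF M(1)]
  by (auto simp: field_emb_def sf_add[OF M(1)] sf_mult[OF M(1)] sf_1[OF M(1)])

lemma galois_group_fixed_subfield:
  fixes M :: "'c::field set"
  assumes M: "subfield M ambient" and \<sigma>: "\<sigma> \<in> carrier (galois_group M K)"
    and S: "K \<subseteq> M" "S \<subseteq> M" "\<And>x. x \<in> S \<Longrightarrow> \<sigma> x = x"
  shows "\<sigma> \<in> carrier (galois_group M (field_adjoin K S))"
proof -
  have emb: "field_emb M \<sigma>" "\<And>x. x \<in> K \<Longrightarrow> \<sigma> x = x" using \<sigma> by (auto simp: galois_group_iff[OF M])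
  have id: "field_emb M id" by (simp add: field_emb_def)
  have "subfield {x \<in> M. id x = \<sigma> x} ambient"
    by (rule field_emb_equalizer_subfield[OF M emb(1) id]) auto
  moreover have "K \<subseteq> {x \<in> M. id x = \<sigma> x}" "S \<subseteq> {x \<in> M. id x = \<sigma> x}" using S emb(2) by auto
  ultimately have "field_adjoin K S \<subseteq> {x \<in> M. id x = \<sigma> x}" by (rule field_adjoin_least)
  then show ?thesis using \<sigma> unfolding galois_group_iff[OF M] by auto
qed

section \<open>Ramification of the division field\<close>

text \<open>Applied with \<open>U = u\<^sup>n\<close>, \<open>N = n d\<close> and \<open>r = -w(j)\<close>.\<close>

locale tate_ramification = tate_lattice w \<gamma> p m q K \<psi> b1 \<Lambda> s \<pi> R e \<phi>t a1 a2
    for w :: "'c::alg_closed_field \<Rightarrow> ereal"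
    and \<gamma> :: "'q::{field,finite} poly \<Rightarrow> 'c" and p m q K \<psi> b1 \<Lambda> s \<pi> R e \<phi>t a1 a2 +
  fixes U :: "'q poly" and N :: nat and \<omega> :: 'c and r :: int
  assumes KZ: "x \<in> K \<Longrightarrow> x \<noteq> 0 \<Longrightarrow> \<exists>k::int. w x = ereal (of_int k)"
    and w_U: "w (\<gamma> U) = 0" and deg_U: "Polynomial.degree U = N" and N_pos: "0 < N"
    and act_\<omega>: "act U \<omega> = s"
    and r: "real (q - 1) * R = of_int r" "\<not> int p dvd r"
begin

text \<open>\<open>E0\<close>, the order of \<open>R\<close> modulo \<open>\<int>\<close>, turns out to be the ramification index of \<open>L/K\<close>.\<close>

definition E0 :: nat where "E0 = (LEAST i. 0 < i \<and> real i * R \<in> \<int>)"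
text \<open>The floor only changes the type, as \<open>E0 * R\<close> is an integer (lemma
  \<open>A\<close>). This number is the wild break in the lower numbering.\<close>

definition A :: nat where "A = nat \<lfloor>real E0 * R\<rfloor>"
definition Q :: nat where "Q = q ^ N"

lemma E0_props: "0 < E0 \<and> real E0 * R \<in> \<int>"
  unfolding E0_def by (rule LeastI[of _ "q - 1"]) (use r(1) q_ge_2 in auto)

lemma E0_pos: "0 < E0" using E0_props by simp

lemma A: "real E0 * R = real A"
proof -
  obtain z where z: "real E0 * R = of_int z" using E0_props by (auto elim: Ints_cases)
  moreover have "0 \<le> real E0 * R" using R_pos by simp
  ultimately show ?thesis by (simp add: A_def)
qed

lemma E0_dvd: assumes "real i * R \<in> \<int>" shows "E0 dvd i"
proof (rule ccontr)
  assume "\<not> E0 dvd i"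
  then have pos: "0 < i mod E0" by (simp add: dvd_eq_mod_eq_0)
  have "i mod E0 = i - i div E0 * E0" by (simp add: minus_div_mult_eq_mod)
  then have "real (i mod E0) = real i - real (i div E0) * real E0"
    by (simp add: of_nat_diff)
  then have "real (i mod E0) * R = real i * R - real (i div E0) * (real E0 * R)"
    by (simp only: left_diff_distrib mult.assoc)
  also have "\<dots> \<in> \<int>" unfolding A by (intro Ints_diff assms Ints_mult[OF Ints_of_nat Ints_of_nat])
  finally have "E0 \<le> i mod E0" unfolding E0_def using pos by (intro Least_le) (simp add: E0_def)
  then show False using mod_less_divisor[OF E0_pos, of i] by linarith
qed

lemma E0_dvd_q: "E0 dvd q - 1"
  by (rule E0_dvd) (simp only: r(1) Ints_of_int)

text \<open>Since \<open>E0\<close> divides \<open>q - 1\<close>, the integer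
  \<open>r = (q - 1) * R\<close> is a multiple of \<open>A\<close>; so the condition on
  \<open>r\<close> passes to \<open>A\<close>.\<close>

lemma not_p_dvd_A: "\<not> p dvd A"
proof
  assume "p dvd A"
  obtain k where k: "q - 1 = E0 * k" using E0_dvd_q by (auto elim: dvdE)
  have "of_int r = real k * (real E0 * R)" unfolding r(1)[symmetric] k by simp
  then have "of_int r = real (k * A)" unfolding A by simp
  then have "r = int (k * A)" by (metis of_int_eq_iff of_int_of_nat_eq)
  then show False using r(2) \<open>p dvd A\<close> by (metis dvd_mult int_dvd_int_iff)
qed

lemma Q_eq: "Q = p ^ (m * N)"
  unfolding Q_def by (subst q) (simp add: power_mult)

lemma p_dvd_Q: "p dvd Q"
  unfolding Q_eq using N_pos m_pos by (intro dvd_power) simp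

lemma Q_pos: "0 < Q" using q_ge_2 by (simp add: Q_def)

lemma coprime_A_Q: "coprime A Q"
proof -
  have "coprime p A" using not_p_dvd_A p by (simp add: prime_imp_coprime_nat)
  then show ?thesis unfolding Q_eq by (simp add: coprime_commute)
qed

text \<open>\<open>E0\<close> is the exact denominator of \<open>R\<close>; cancelling a common
  factor would produce a smaller one.\<close>

lemma coprime_A_E0: "coprime A E0"
proof -
  let ?g = "gcd A E0"
  obtain b where b: "E0 = ?g * b" by (metis dvdE gcd_dvd2)
  obtain c where c: "A = ?g * c" by (metis dvdE gcd_dvd1)
  have g0: "0 < ?g" using E0_pos by simp
  have "real ?g * (real b * R) = real ?g * real c"
    using A arg_cong[OF b, of real] arg_cong[OF c, of real] by simp
  then have "real b * R = real c" using E0_pos by simp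
  then have "E0 dvd b" by (intro E0_dvd) simp
  moreover have "0 < b" using b E0_pos by (metis gr0I mult_0_right)
  ultimately have "E0 \<le> b" by (rule dvd_imp_le)
  then have "?g * b \<le> 1 * b" using b by simp
  then have "?g \<le> 1" using \<open>0 < b\<close> by (simp only: mult_le_cancel2)
  then have "?g = 1" using g0 by linarith
  then show ?thesis by (simp only: coprime_iff_gcd_eq_1)
qed

lemma coprime_A: "coprime A (E0 * Q)"
  using coprime_A_Q coprime_A_E0 by simp

text \<open>\<open>A / (E0 * Q)\<close> is \<open>R / Q\<close> in lowest terms.\<close>

lemma E0Q_dvd: assumes "real i * (R / real Q) \<in> \<int>" shows "E0 * Q dvd i"
proof -
  obtain z where z: "real i * (R / real Q) = of_int z" using assms by (auto elim: Ints_cases)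
  then have iR: "real i * R = of_int z * real Q" using Q_pos by (simp add: field_simps)
  have "real i * R \<in> \<int>" unfolding iR by simp
  then have "E0 dvd i" by (rule E0_dvd)
  then obtain k where k: "i = E0 * k" by (auto elim: dvdE)
  have "real (k * A) = real k * (real E0 * R)" by (simp add: A)
  also have "\<dots> = real i * R" by (simp add: k)
  finally have "real (k * A) = of_int z * real Q" unfolding iR .
  then have "of_int (int (k * A)) = (of_int (z * int Q) :: real)" by simp
  then have "int (k * A) = z * int Q" by (simp only: of_int_eq_iff)
  then have "int Q dvd int (k * A)" by simp
  then have "Q dvd k * A" by (simp only: int_dvd_int_iff)
  then have "Q dvd k" using coprime_A_Q by (simp add: coprime_commute coprime_dvd_mult_left_iff)
  then show ?thesis unfolding k by simp
qed

lemma w_\<omega>: "w \<omega> = ereal (- (R / real Q))"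
proof -
  have "U \<noteq> 0" using deg_U N_pos by auto
  moreover have "w (act U \<omega>) = ereal (- R)" using act_\<omega> w_s by simp
  ultimately have "w \<omega> = ereal (- R / real (q ^ Polynomial.degree U))"
    using R_pos by (intro act_preimage) auto
  then show ?thesis by (simp add: deg_U Q_def)
qed

lemma \<omega>_nonint: "0 < i \<Longrightarrow> i < E0 * Q \<Longrightarrow> real i * - (R / real Q) \<notin> \<int>"
proof
  assume i: "0 < i" "i < E0 * Q" "real i * - (R / real Q) \<in> \<int>"
  then have "- (real i * - (R / real Q)) \<in> \<int>" by (simp only: Ints_minus)
  then have "E0 * Q dvd i" by (intro E0Q_dvd) simp
  then show False using i by (auto dest: dvd_imp_le)
qed

lemma s_nonint: "0 < i \<Longrightarrow> i < E0 \<Longrightarrow> real i * - R \<notin> \<int>"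
proof
  assume i: "0 < i" "i < E0" "real i * - R \<in> \<int>"
  then have "- (real i * - R) \<in> \<int>" by (simp only: Ints_minus)
  then have "E0 dvd i" by (intro E0_dvd) simp
  then show False using i by (auto dest: dvd_imp_le)
qed

section \<open>Torsion points and the fields \<open>M0\<close> and \<open>Ln\<close>\<close>

lemma \<gamma>U: "\<gamma> U \<noteq> 0" using w_U by auto

lemma U_nonzero: "U \<noteq> 0" using deg_U N_pos by auto

abbreviation T :: "'c set" where "T \<equiv> torsion \<psi> U"

lemma T_iff: "z \<in> T \<longleftrightarrow> act U z = 0" by (simp add: torsion_def)

lemma T_diff: "x \<in> T \<Longrightarrow> y \<in> T \<Longrightarrow> x - y \<in> T"
  by (simp add: T_iff act_diff)

lemma T_w: "\<zeta> \<in> T \<Longrightarrow> \<zeta> \<noteq> 0 \<Longrightarrow> w \<zeta> = 0"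
  by (rule torsion_w[OF w_U])

lemma T_w_ge: "\<zeta> \<in> T \<Longrightarrow> 0 \<le> w \<zeta>"
  using T_w by (cases "\<zeta> = 0") auto

lemma \<psi>U_degree: "Polynomial.degree (\<psi> U) = Q"
  using \<psi>_degree[OF U_nonzero] by (simp add: deg_U Q_def)

lemma \<psi>U_nonzero: "\<psi> U \<noteq> 0"
  using \<psi>U_degree Q_pos by auto

lemma card_T: "card T = Q"
  unfolding torsion_def \<psi>U_degree[symmetric]
  by (rule card_roots_separable[OF \<psi>U_nonzero]) (simp add: \<psi>_pderiv \<gamma>U)

lemma finite_T: "finite T"
  using poly_roots_finite[OF \<psi>U_nonzero] by (simp add: torsion_def)

lemma of_nat_q1: "of_nat (q - 1) \<noteq> (0::'c)"
  using of_nat_q q_ge_2 by (simp add: of_nat_diff)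

lemma same_power:
  assumes "x ^ (q - 1) = y ^ (q - 1)" "y \<noteq> (0::'c)"
  obtains c where "c \<noteq> 0" "x = \<gamma> [:c:] * y"
proof -
  have "(x / y) ^ (q - 1) = 1" using assms by (simp add: power_divide)
  then obtain c where "c \<noteq> 0" "x / y = \<gamma> [:c:]" by (rule root_of_unity)
  then show ?thesis using that assms(2) by (simp add: field_simps)
qed

lemma separable_radical:
  assumes D: "D \<in> K" "D \<noteq> 0" and z: "z ^ (q - 1) = D"
  shows "\<exists>f\<in>polys_over K. f \<noteq> 0 \<and> poly f z = 0 \<and> {z. poly f z = 0} = {x. x ^ (q - 1) = D} \<and>
    (\<forall>z. poly f z = 0 \<longrightarrow> poly (pderiv f) z \<noteq> 0)"
proof (intro bexI conjI allI impI)
  let ?f = "Polynomial.monom 1 (q - 1) - [:D:]"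
  have ev: "poly ?f x = x ^ (q - 1) - D" for x by (simp add: poly_monom)
  show "?f \<in> polys_over K"
    by (intro polys_over_diff[OF K] polys_over_monom[OF K] polys_over_const[OF K] D sf_1[OF K])
  show "poly ?f z = 0" unfolding ev using z by simp
  show "{z. poly ?f z = 0} = {x. x ^ (q - 1) = D}" unfolding ev by simp
  show "poly (pderiv ?f) x \<noteq> 0" if "poly ?f x = 0" for x
  proof -
    have "x \<noteq> 0" using that D(2) q_ge_2 unfolding ev by (auto simp: power_0_left)
    then show ?thesis using of_nat_q1 by (simp add: pderiv_diff pderiv_monom poly_monom pderiv_pCons)
  qed
  show "?f \<noteq> 0"
  proof
    assume "?f = 0"
    then have "poly ?f 0 = 0" by simp
    then show False unfolding ev using D(2) q_ge_2 by (simp add: power_0_left)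
  qed
qed

text \<open>\<open>s ^ E0\<close> is the least positive power of \<open>s\<close> with integral
  valuation. It is taken together with its multiples by constants, the full root set of a separable
  polynomial over \<open>K\<close>.\<close>

definition S0 :: "'c set"
  where "S0 = T \<union> {x. x ^ (q - 1) = (s ^ E0) ^ (q - 1)}"

text \<open>The maximal unramified subextension of the division field.\<close>

definition M0 :: "'c set" where "M0 = field_adjoin K S0"

text \<open>The \<open>U\<close>-division points of the whole first shell. Those of \<open>s\<close>
  alone need not be stable over \<open>K\<close>, since only \<open>s ^ (q - 1)\<close> is known to
  lie there.\<close>

definition SL :: "'c set" where "SL = {z. act U z ^ (q - 1) = s ^ (q - 1)}"

text \<open>Generated over \<open>K\<close> by finitely many elements, to fit
  \<open>galois_generators\<close>; \<open>Ln_eq\<close> identifies it with the division field over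
  \<open>L\<close>.\<close>

definition Ln :: "'c set" where "Ln = field_adjoin K SL"

lemma sE_power: "(s ^ E0) ^ (q - 1) \<in> K" "(s ^ E0) ^ (q - 1) \<noteq> 0"
proof -
  have "(s ^ E0) ^ (q - 1) = (s ^ (q - 1)) ^ E0" by (simp add: power_mult[symmetric] mult.commute)
  then show "(s ^ E0) ^ (q - 1) \<in> K" using sf_power[OF K s_power_in_K] by simp
  show "(s ^ E0) ^ (q - 1) \<noteq> 0" using s_nonzero by simp
qed

lemma separable_S0: "separable_set K S0"
  unfolding separable_set_def
proof (intro conjI ballI)
  obtain f where "f \<noteq> 0" "{z. poly f z = 0} = {x. x ^ (q - 1) = (s ^ E0) ^ (q - 1)}"
    using separable_radical[OF sE_power refl] by blast
  then have "finite {x. x ^ (q - 1) = (s ^ E0) ^ (q - 1)}" using poly_roots_finite[of f] by simp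
  then show "finite S0" using finite_T by (simp add: S0_def)
next
  fix x assume "x \<in> S0"
  then consider "x \<in> T" | "x ^ (q - 1) = (s ^ E0) ^ (q - 1)" by (auto simp: S0_def)
  then show "\<exists>f\<in>polys_over K. f \<noteq> 0 \<and> poly f x = 0 \<and> {z. poly f z = 0} \<subseteq> S0 \<and>
       (\<forall>z. poly f z = 0 \<longrightarrow> poly (pderiv f) z \<noteq> 0)"
  proof cases
    case 1
    then show ?thesis
      using \<psi>_polys_over[of U] \<psi>U_nonzero \<gamma>U
      by (intro bexI[of _ "\<psi> U"]) (auto simp: \<psi>_pderiv S0_def torsion_def)
  next
    case 2
    then show ?thesis using separable_radical[OF sE_power 2] unfolding S0_def by blast
  qed
qed

lemma gen_M0: "galois_generators K S0 M0"
  by (rule galois_generators.intro[OF K separable_S0 M0_def])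

lemma separable_SL: "separable_set K SL"
proof -
  let ?f = "\<psi> U ^ (q - 1) - [:s ^ (q - 1):]"
  have ev: "poly ?f x = act U x ^ (q - 1) - s ^ (q - 1)" for x by simp
  have f0: "?f \<noteq> 0"
  proof
    assume "?f = 0"
    then have "poly ?f 0 = 0" by simp
    then show False unfolding ev act_0 using s_nonzero q_ge_2 by (simp add: power_0_left)
  qed
  have fK: "?f \<in> polys_over K"
    by (intro polys_over_diff[OF K] polys_over_power[OF K] polys_over_const[OF K] \<psi>_polys_over s_power_in_K)
  have eq: "{z. poly ?f z = 0} = SL" unfolding SL_def ev by simp
  have der: "poly (pderiv ?f) z \<noteq> 0" if "poly ?f z = 0" for z
  proof -
    have "act U z ^ (q - 1) \<noteq> 0" using that s_nonzero unfolding ev by simp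
    then have "act U z \<noteq> 0" using q_ge_2 by (auto simp: power_0_left)
    then show ?thesis
      using of_nat_q1 \<gamma>U by (simp add: pderiv_diff pderiv_power pderiv_pCons \<psi>_pderiv)
  qed
  show ?thesis
    unfolding separable_set_def
  proof (intro conjI ballI)
    show "finite SL" using poly_roots_finite[OF f0] eq by simp
    fix z assume z: "z \<in> SL"
    have "poly ?f z = 0" using z eq by blast
    then show "\<exists>f\<in>polys_over K. f \<noteq> 0 \<and> poly f z = 0 \<and> {z. poly f z = 0} \<subseteq> SL \<and>
       (\<forall>z. poly f z = 0 \<longrightarrow> poly (pderiv f) z \<noteq> 0)"
      using f0 fK eq der by blast
  qed
qed

lemma gen_Ln: "galois_generators K SL Ln"
  by (rule galois_generators.intro[OF K separable_SL Ln_def])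

lemma sf_Ln: "subfield Ln ambient" and K_Ln: "K \<subseteq> Ln" and SL_Ln: "SL \<subseteq> Ln"
  using galois_generators.M_subfield[OF gen_Ln] galois_generators.K_le[OF gen_Ln]
    galois_generators.S_le[OF gen_Ln] .

lemma sf_M0: "subfield M0 ambient" and K_M0: "K \<subseteq> M0" and S0_M0: "S0 \<subseteq> M0"
  using galois_generators.M_subfield[OF gen_M0] galois_generators.K_le[OF gen_M0]
    galois_generators.S_le[OF gen_M0] .

lemma T_M0: "T \<subseteq> M0" and sE_M0: "s ^ E0 \<in> M0"
  using S0_M0 by (auto simp: S0_def)

lemma gen_mid:
  assumes "subfield M ambient" "K \<subseteq> M" "M \<subseteq> Ln"
  shows "galois_generators M SL Ln"
proof (rule galois_generators.intro)
  show "subfield M ambient" by fact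
  show "separable_set M SL" by (rule separable_set_mono[OF assms(2) separable_SL])
  show "Ln = field_adjoin M SL"
  proof
    show "field_adjoin M SL \<subseteq> Ln" by (rule field_adjoin_least[OF sf_Ln assms(3) SL_Ln])
    show "Ln \<subseteq> field_adjoin M SL"
      unfolding Ln_def
      by (rule field_adjoin_least[OF field_adjoin_subfield])
        (use assms(2) field_adjoin_incl[where N=M and S=SL] in blast)+
  qed
qed

lemma \<gamma>_M: "K \<subseteq> M \<Longrightarrow> \<gamma> a \<in> M" using \<gamma>_K by blast

lemma \<omega>_SL: "\<omega> \<in> SL" by (simp add: SL_def act_\<omega>)

lemma \<omega>_T_SL: "\<zeta> \<in> T \<Longrightarrow> \<omega> + \<zeta> \<in> SL" by (simp add: SL_def act_add T_iff act_\<omega>)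

lemma \<omega>_Ln: "\<omega> \<in> Ln" using \<omega>_SL SL_Ln by blast

lemma T_Ln: "T \<subseteq> Ln"
proof
  fix \<zeta> assume "\<zeta> \<in> T"
  then have "\<omega> + \<zeta> \<in> Ln" using \<omega>_T_SL SL_Ln by blast
  then have "(\<omega> + \<zeta>) - \<omega> \<in> Ln" by (rule sf_diff[OF sf_Ln _ \<omega>_Ln])
  then show "\<zeta> \<in> Ln" by simp
qed

lemma s_Ln: "s \<in> Ln" using act_closed[OF sf_Ln K_Ln \<omega>_Ln, of U] act_\<omega> by simp

lemma \<Lambda>_Ln: "\<Lambda> \<subseteq> Ln"
  unfolding \<Lambda> using act_closed[OF sf_Ln K_Ln s_Ln] by blast

lemma SL_cases:
  assumes "z \<in> SL"
  obtains c \<zeta> where "c \<noteq> 0" "\<zeta> \<in> T" "z = \<gamma> [:c:] * \<omega> + \<zeta>" "act U z = \<gamma> [:c:] * s"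
proof -
  have "act U z ^ (q - 1) = s ^ (q - 1)" using assms by (simp add: SL_def)
  then obtain c where c: "c \<noteq> 0" "act U z = \<gamma> [:c:] * s" using s_nonzero by (rule same_power)
  have "z - \<gamma> [:c:] * \<omega> \<in> T"
    by (simp add: T_iff act_diff act_const_mult act_\<omega> c)
  then show ?thesis using that[OF c(1) _ _ c(2), of "z - \<gamma> [:c:] * \<omega>"] by simp
qed

lemma S0_Ln: "S0 \<subseteq> Ln"
proof
  fix x assume "x \<in> S0"
  then consider "x \<in> T" | "x ^ (q - 1) = (s ^ E0) ^ (q - 1)" by (auto simp: S0_def)
  then show "x \<in> Ln"
  proof cases
    case 1
    then show ?thesis using T_Ln by blast
  next
    case 2
    have "s ^ E0 \<noteq> 0" using s_nonzero by simp
    with 2 obtain c where "x = \<gamma> [:c:] * s ^ E0" by (rule same_power)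
    then show ?thesis using sf_mult[OF sf_Ln \<gamma>_M[OF K_Ln] sf_power[OF sf_Ln s_Ln]] by simp
  qed
qed

lemma M0_Ln: "M0 \<subseteq> Ln"
  unfolding M0_def by (rule field_adjoin_least[OF sf_Ln K_Ln S0_Ln])

text \<open>A difference of torsion points is again a torsion point, hence a unit if nonzero. A
  radical is scaled to a unit by \<open>\<pi> ^ A\<close>, and \<sigma> multiplies it by a constant
  other than 1. The field \<open>M\<close> is left general: \<open>M0\<close> is treated to see that
  it is unramified, and \<open>Ln\<close> to see that inertia fixes \<open>S0\<close>.\<close>

lemma detect:
  assumes M: "subfield M ambient" "K \<subseteq> M" "S0 \<subseteq> M" and \<sigma>: "\<sigma> \<in> carrier (galois_group M K)"
    and x: "x \<in> S0" "\<sigma> x \<noteq> x"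
  shows "\<exists>b\<in>M. 0 \<le> w b \<and> w (\<sigma> b - b) = 0"
proof -
  have emb: "field_emb M \<sigma>" "\<And>x. x \<in> K \<Longrightarrow> \<sigma> x = x" using \<sigma> by (auto simp: galois_group_iff[OF M(1)])
  have xM: "x \<in> M" using x M(3) by blast
  consider "x \<in> T" | "x ^ (q - 1) = (s ^ E0) ^ (q - 1)" using x(1) by (auto simp: S0_def)
  then show ?thesis
  proof cases
    case 1
    have "act U (\<sigma> x) = \<sigma> (act U x)"
      by (rule field_emb_fixed_poly[OF K M(1,2) emb \<psi>_polys_over xM, symmetric])
    then have "\<sigma> x \<in> T" using 1 field_emb_0[OF M(1) emb(1)] by (simp add: T_iff)
    then have "w (\<sigma> x - x) = 0" using T_w[OF T_diff[OF _ 1]] x(2) by simp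
    then show ?thesis using T_w_ge[OF 1] xM by blast
  next
    case 2
    have x0: "x \<noteq> 0" using 2 s_nonzero q_ge_2 by (auto simp: power_0_left)
    have "s ^ E0 \<noteq> 0" using s_nonzero by simp
    with 2 obtain c where c: "c \<noteq> 0" "x = \<gamma> [:c:] * s ^ E0" by (rule same_power)
    have wx: "w x = ereal (- real A)"
      using w_const[OF c(1)] A by (simp add: c(2) w_mult w_power w_s)
    have "\<sigma> x ^ (q - 1) = \<sigma> (x ^ (q - 1))" by (rule field_emb_power[OF M(1) emb(1) xM, symmetric])
    also have "\<dots> = x ^ (q - 1)" using 2 sE_power emb(2) by simp
    finally have p1: "(\<sigma> x / x) ^ (q - 1) = 1" using x0 by (simp add: power_divide)
    have "\<sigma> x / x \<noteq> 1" using x(2) x0 by simp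
    from root_of_unity_diff[OF p1 this] have d: "w (\<sigma> x / x - 1) = 0" .
    let ?b = "x * \<pi> ^ A"
    have \<pi>A: "\<pi> ^ A \<in> K" by (rule sf_power[OF K \<pi>(1)])
    have bM: "?b \<in> M" using sf_mult[OF M(1) xM] \<pi>A M(2) by blast
    have wb: "w ?b = 0" by (simp add: w_mult w_power \<pi>(2) wx zero_ereal_def)
    have "\<sigma> ?b = \<sigma> x * \<pi> ^ A"
      using field_emb_mult[OF M(1) emb(1) xM, of "\<pi> ^ A"] \<pi>A M(2) emb(2)[OF \<pi>A] by auto
    then have "\<sigma> ?b - ?b = (\<sigma> x / x - 1) * ?b" using x0 by (simp add: field_simps)
    then have "w (\<sigma> ?b - ?b) = 0" using d wb by (simp only: w_mult) simp
    then show ?thesis using bM wb by (intro bexI[of _ ?b]) auto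
  qed
qed

lemma M0Z: assumes "x \<in> M0" "x \<noteq> 0" shows "\<exists>k::int. w x = ereal (of_int k)"
proof (rule unramified_values[OF gen_M0 K_complete \<pi> KZ _ assms])
  fix \<sigma> assume \<sigma>: "\<sigma> \<in> carrier (galois_group M0 K)" "\<sigma> \<noteq> restrict id M0"
  have "\<exists>x\<in>S0. \<sigma> x \<noteq> x"
  proof (rule ccontr)
    assume n: "\<not> (\<exists>x\<in>S0. \<sigma> x \<noteq> x)"
    have "\<sigma> = restrict id M0"
      by (rule galois_generators.galois_eqI[OF gen_M0 \<sigma>(1) galois_group_id[OF sf_M0 K_M0]])
        (use n S0_M0 in auto)
    then show False using \<sigma>(2) by simp
  qed
  then show "\<exists>b\<in>M0. 0 \<le> w b \<and> w (\<sigma> b - b) = 0"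
    using detect[OF sf_M0 K_M0 S0_M0 \<sigma>(1)] by blast
qed

definition f\<omega> :: "'c poly" where "f\<omega> = \<psi> U ^ E0 - [:s ^ E0:]"

lemma poly_f\<omega>: "poly f\<omega> z = act U z ^ E0 - s ^ E0"
  by (simp add: f\<omega>_def)

lemma f\<omega>_M0: "f\<omega> \<in> polys_over M0"
  unfolding f\<omega>_def using \<psi>_polys_over polys_over_mono[OF K_M0]
  by (intro polys_over_diff[OF sf_M0] polys_over_power[OF sf_M0] polys_over_const[OF sf_M0] sE_M0) blast

lemma degree_f\<omega>: "Polynomial.degree f\<omega> = E0 * Q"
proof -
  have d: "Polynomial.degree (\<psi> U ^ E0) = E0 * Q"
    using degree_power_eq[OF \<psi>U_nonzero] \<psi>U_degree by simp
  have "f\<omega> = [:- (s ^ E0):] + \<psi> U ^ E0" by (simp add: f\<omega>_def)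
  also have "Polynomial.degree \<dots> = E0 * Q"
    using d E0_pos Q_pos by (subst degree_add_eq_right) auto
  finally show ?thesis .
qed

lemma f\<omega>_nonzero: "f\<omega> \<noteq> 0"
  using degree_f\<omega> E0_pos Q_pos by auto

lemma not_p_dvd_E0: "\<not> p dvd E0"
proof
  assume "p dvd E0"
  then have "of_nat E0 = (0::'c)" by (simp add: of_nat_eq_0_iff)
  then have "of_nat (q - 1) = (0::'c)" using E0_dvd_q by (auto elim!: dvdE)
  then show False using of_nat_q1 by simp
qed

lemma card_f\<omega>: "card {z. poly f\<omega> z = 0} = E0 * Q"
  unfolding degree_f\<omega>[symmetric]
proof (rule card_roots_separable[OF f\<omega>_nonzero])
  fix z assume "poly f\<omega> z = 0"
  then have "act U z ^ E0 \<noteq> 0" using s_nonzero by (simp add: poly_f\<omega>)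
  then have "act U z \<noteq> 0" using E0_pos by (auto simp: power_0_left)
  then show "poly (pderiv f\<omega>) z \<noteq> 0"
    using not_p_dvd_E0 \<gamma>U by (simp add: f\<omega>_def pderiv_diff pderiv_power pderiv_pCons \<psi>_pderiv of_nat_eq_0_iff)
qed

abbreviation g\<omega> :: "'c poly"
  where "g\<omega> \<equiv> Polynomial.smult (inverse (Polynomial.lead_coeff f\<omega>)) f\<omega>"

lemma min_poly_\<omega>: "is_min_poly M0 \<omega> g\<omega>" and degree_g\<omega>: "Polynomial.degree g\<omega> = E0 * Q"
proof -
  show "is_min_poly M0 \<omega> g\<omega>"
    by (rule ramified_min_poly[OF sf_M0 M0Z w_\<omega> \<omega>_nonint f\<omega>_M0 degree_f\<omega>])
      (use E0_pos Q_pos in \<open>auto simp: poly_f\<omega> act_\<omega>\<close>)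
  have "inverse (Polynomial.lead_coeff f\<omega>) \<noteq> 0" using f\<omega>_nonzero by simp
  then show "Polynomial.degree g\<omega> = E0 * Q" by (simp only: degree_smult_eq degree_f\<omega> if_False)
qed

lemma Ln_simple: "Ln \<subseteq> simple_ext M0 \<omega>"
  unfolding Ln_def
proof (rule field_adjoin_least)
  show sf: "subfield (simple_ext M0 \<omega>) ambient" by (rule simple_ext_subfield[OF sf_M0 min_poly_\<omega>])
  note incl = simple_ext_incl[OF sf_M0, of \<omega>]
  show "K \<subseteq> simple_ext M0 \<omega>" using K_M0 incl(1) by blast
  show "SL \<subseteq> simple_ext M0 \<omega>"
  proof
    fix z assume "z \<in> SL"
    then obtain c \<zeta> where z: "\<zeta> \<in> T" "z = \<gamma> [:c:] * \<omega> + \<zeta>" by (rule SL_cases)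
    have "\<gamma> [:c:] \<in> simple_ext M0 \<omega>" "\<zeta> \<in> simple_ext M0 \<omega>"
      using \<gamma>_M[OF K_M0] z(1) T_M0 incl(1) by blast+
    then show "z \<in> simple_ext M0 \<omega>"
      unfolding z(2) by (intro sf_add[OF sf] sf_mult[OF sf] incl(2))
  qed
qed

lemma value_group_K: "value_group w K = \<int>"
proof (intro equalityI subsetI)
  fix v assume "v \<in> value_group w K"
  then obtain x where "x \<in> K" "x \<noteq> 0" "w x = ereal v" by (auto simp: value_group_def)
  then show "v \<in> \<int>" using KZ[of x] by auto
next
  fix v :: real assume "v \<in> \<int>"
  then obtain z where z: "v = of_int z" by (auto elim: Ints_cases)
  have \<pi>0: "\<pi> \<noteq> 0" using \<pi>(2) by auto
  have "\<pi> powi z \<in> K" using \<pi>(1) by (simp add: power_int_def sf_power[OF K] sf_inverse[OF K])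
  moreover have "w (\<pi> powi z) = ereal v" using \<pi>0 by (simp add: w_power_int \<pi>(2) z)
  moreover have "\<pi> powi z \<noteq> 0" using \<pi>0 by simp
  ultimately show "v \<in> value_group w K" unfolding value_group_def by blast
qed

lemma ram_index_Ln: "ram_index w K Ln = E0 * Q"
proof (rule ram_index_eq[OF value_group_K _ _ \<omega>_nonint])
  show "value_group w Ln = {of_int z + real i * - (R / real Q) | z i. i < E0 * Q}"
    by (rule value_group_ramified[OF sf_M0 M0Z w_\<omega> \<omega>_nonint min_poly_\<omega> degree_g\<omega> sf_Ln Ln_simple \<omega>_Ln subsetD[OF K_Ln \<pi>(1)] \<pi>(2)])
qed (use E0_pos Q_pos in simp)

lemma ram_index_L: "ram_index w K (field_adjoin K \<Lambda>) = E0"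
proof (rule ram_index_eq[OF value_group_K _ _ s_nonint])
  let ?L = "field_adjoin K \<Lambda>" and ?f = "Polynomial.monom 1 E0 - [:s ^ E0:]"
  have f: "?f \<in> polys_over M0"
    by (intro polys_over_diff[OF sf_M0] polys_over_monom[OF sf_M0] polys_over_const[OF sf_M0] sE_M0 sf_1[OF sf_M0])
  have deg: "Polynomial.degree ?f = E0"
  proof -
    have "?f = [:- (s ^ E0):] + Polynomial.monom 1 E0" by simp
    also have "Polynomial.degree \<dots> = E0"
      using E0_pos by (subst degree_add_eq_right) (auto simp: degree_monom_eq)
    finally show ?thesis .
  qed
  have f0: "?f \<noteq> 0" using deg E0_pos by auto
  have ev: "poly ?f x = x ^ E0 - s ^ E0" for x by (simp add: poly_monom)
  have root: "poly ?f s = 0" unfolding ev by simp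
  let ?g = "Polynomial.smult (inverse (Polynomial.lead_coeff ?f)) ?f"
  have g: "is_min_poly M0 s ?g"
    by (rule ramified_min_poly[OF sf_M0 M0Z w_s s_nonint f deg E0_pos root])
  have "inverse (Polynomial.lead_coeff ?f) \<noteq> 0"
    using f0 by (simp only: inverse_nonzero_iff_nonzero leading_coeff_0_iff not_False_eq_True)
  then have degg: "Polynomial.degree ?g = E0" by (simp only: degree_smult_eq deg if_False)
  note incl = simple_ext_incl[OF sf_M0, of s]
  have sf: "subfield (simple_ext M0 s) ambient" by (rule simple_ext_subfield[OF sf_M0 g])
  have K_s: "K \<subseteq> simple_ext M0 s" using K_M0 incl(1) by blast
  have L: "?L \<subseteq> simple_ext M0 s"
  proof (rule field_adjoin_least[OF sf K_s])
    show "\<Lambda> \<subseteq> simple_ext M0 s" unfolding \<Lambda> using act_closed[OF sf K_s incl(2)] by blast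
  qed
  have "s \<in> \<Lambda>" unfolding \<Lambda> using act_1 by (metis rangeI)
  then have sL: "s \<in> ?L" using field_adjoin_incl(2)[where S=\<Lambda> and N=K] by blast
  have "\<pi> \<in> ?L" using \<pi>(1) field_adjoin_incl(1)[where S=\<Lambda> and N=K] by blast
  from value_group_ramified[OF sf_M0 M0Z w_s s_nonint g degg field_adjoin_subfield L sL this \<pi>(2)]
  show "value_group w ?L = {of_int z + real i * - R | z i. i < E0}" .
qed (use E0_pos in simp)

text \<open>A division point of \<open>act a s\<close> differs from \<open>act a \<omega>\<close> by
  a torsion point, so \<open>\<omega>\<close> and the torsion generate them all.\<close>

lemma Ln_eq: "field_adjoin (field_adjoin K \<Lambda>) (division_lattice \<psi> U \<Lambda>) = Ln"
proof
  let ?L = "field_adjoin K \<Lambda>" and ?V = "division_lattice \<psi> U \<Lambda>"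
  have V_iff: "z \<in> ?V \<longleftrightarrow> act U z \<in> \<Lambda>" for z by (auto simp: division_lattice_def)
  show "field_adjoin ?L ?V \<subseteq> Ln"
  proof (rule field_adjoin_least[OF sf_Ln])
    show "?L \<subseteq> Ln" by (rule field_adjoin_least[OF sf_Ln K_Ln \<Lambda>_Ln])
    show "?V \<subseteq> Ln"
    proof
      fix z assume "z \<in> ?V"
      then have "act U z \<in> \<Lambda>" by (simp only: V_iff)
      then obtain a where a: "act U z = act a s" unfolding \<Lambda> by blast
      have "z - act a \<omega> \<in> T"
        by (simp add: T_iff act_diff a act_mult_commute[of U a] act_\<omega>)
      then have "z - act a \<omega> \<in> Ln" using T_Ln by blast
      then have "(z - act a \<omega>) + act a \<omega> \<in> Ln"
        by (rule sf_add[OF sf_Ln _ act_closed[OF sf_Ln K_Ln \<omega>_Ln]])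
      then show "z \<in> Ln" by simp
    qed
  qed
  show "Ln \<subseteq> field_adjoin ?L ?V"
    unfolding Ln_def
  proof (rule field_adjoin_least[OF field_adjoin_subfield])
    show "K \<subseteq> field_adjoin ?L ?V"
      using field_adjoin_incl(1)[where S=\<Lambda> and N=K] field_adjoin_incl(1)[where S="?V" and N="?L"] by blast
    have "SL \<subseteq> ?V"
    proof
      fix z assume "z \<in> SL"
      then obtain c where "act U z = \<gamma> [:c:] * s" by (rule SL_cases)
      then have "act U z = act [:c:] s" by (simp add: act_const)
      then have "act U z \<in> \<Lambda>" unfolding \<Lambda> by blast
      then show "z \<in> ?V" by (simp only: V_iff)
    qed
    then show "SL \<subseteq> field_adjoin ?L ?V" using field_adjoin_incl(2)[where S="?V" and N="?L"] by blast
  qed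
qed

text \<open>The inertia group: \<open>lower_ram_group_iff\<close> and \<open>jump_ge\<close>
  identify it with the lower group of index 0.\<close>

definition I :: "('c \<Rightarrow> 'c) set" where "I = carrier (galois_group Ln M0)"

lemma I_emb: assumes "\<sigma> \<in> I" shows "field_emb Ln \<sigma>" "\<And>x. x \<in> M0 \<Longrightarrow> \<sigma> x = x"
  using assms by (auto simp: I_def galois_group_iff[OF sf_Ln])

lemma I_act: assumes "\<sigma> \<in> I" "z \<in> Ln" shows "\<sigma> (act a z) = act a (\<sigma> z)"
  by (rule field_emb_fixed_poly[OF K sf_Ln K_Ln I_emb(1)[OF assms(1)] _ \<psi>_polys_over assms(2)])
    (use I_emb(2)[OF assms(1)] K_M0 in blast)

lemma I_root: assumes "\<sigma> \<in> I" shows "poly f\<omega> (\<sigma> \<omega>) = 0"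
proof -
  have "act U (\<sigma> \<omega>) = \<sigma> s" using I_act[OF assms \<omega>_Ln, of U] act_\<omega> by simp
  moreover have "\<sigma> s ^ E0 = \<sigma> (s ^ E0)" by (rule field_emb_power[OF sf_Ln I_emb(1)[OF assms] s_Ln, symmetric])
  moreover have "\<sigma> (s ^ E0) = s ^ E0" by (rule I_emb(2)[OF assms sE_M0])
  ultimately show ?thesis by (simp add: poly_f\<omega>)
qed

lemma f\<omega>_root_cases:
  assumes "poly f\<omega> z = 0"
  obtains c \<zeta> where "c \<noteq> 0" "\<zeta> \<in> T" "z = \<gamma> [:c:] * \<omega> + \<zeta>" "\<gamma> [:c:] ^ E0 = 1" "act U z = \<gamma> [:c:] * s"
proof -
  have e: "act U z ^ E0 = s ^ E0" using assms by (simp add: poly_f\<omega>)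
  obtain k where k: "q - 1 = E0 * k" using E0_dvd_q by (auto elim: dvdE)
  have "z \<in> SL" by (simp only: SL_def k power_mult e mem_Collect_eq)
  then obtain c \<zeta> where c: "c \<noteq> 0" "\<zeta> \<in> T" "z = \<gamma> [:c:] * \<omega> + \<zeta>" "act U z = \<gamma> [:c:] * s"
    by (rule SL_cases)
  have "\<gamma> [:c:] ^ E0 = 1" using e s_nonzero unfolding c(4) by (simp add: power_mult_distrib)
  then show ?thesis using that c by blast
qed

lemma I_inj: "inj_on (\<lambda>\<sigma>. \<sigma> \<omega>) I"
proof (rule inj_onI)
  fix \<sigma> \<tau> assume st: "\<sigma> \<in> I" "\<tau> \<in> I" "\<sigma> \<omega> = \<tau> \<omega>"
  show "\<sigma> = \<tau>"
  proof (rule galois_generators.galois_eqI[OF gen_mid[OF sf_M0 K_M0 M0_Ln]])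
    show "\<sigma> \<in> carrier (galois_group Ln M0)" "\<tau> \<in> carrier (galois_group Ln M0)" using st by (auto simp: I_def)
    fix z assume "z \<in> SL"
    then obtain c \<zeta> where z: "\<zeta> \<in> T" "z = \<gamma> [:c:] * \<omega> + \<zeta>" by (rule SL_cases)
    have c: "\<gamma> [:c:] \<in> M0" "\<gamma> [:c:] \<in> Ln" using \<gamma>_M K_M0 K_Ln by blast+
    have \<zeta>: "\<zeta> \<in> M0" "\<zeta> \<in> Ln" using z(1) T_M0 T_Ln by blast+
    have key: "\<rho> z = \<gamma> [:c:] * \<rho> \<omega> + \<zeta>" if "\<rho> \<in> I" for \<rho>
      unfolding z(2)
      by (simp only: field_emb_add[OF sf_Ln I_emb(1)[OF that] sf_mult[OF sf_Ln c(2) \<omega>_Ln] \<zeta>(2)]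
        field_emb_mult[OF sf_Ln I_emb(1)[OF that] c(2) \<omega>_Ln] I_emb(2)[OF that c(1)] I_emb(2)[OF that \<zeta>(1)])
    show "\<sigma> z = \<tau> z" by (simp only: key[OF st(1)] key[OF st(2)] st(3))
  qed
qed

lemma I_surj: assumes "poly f\<omega> z = 0" obtains \<sigma> where "\<sigma> \<in> I" "\<sigma> \<omega> = z"
proof -
  have "poly g\<omega> z = 0" using assms by simp
  then obtain \<sigma> where "\<sigma> \<in> carrier (galois_group Ln M0)" "\<sigma> \<omega> = z"
    by (rule galois_generators.galois_transitive[OF gen_mid[OF sf_M0 K_M0 M0_Ln] sf_M0 order.refl M0_Ln min_poly_\<omega> \<omega>_Ln])
  then show ?thesis using that by (simp add: I_def)
qed

lemma card_I: "card I = E0 * Q"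
proof -
  have "(\<lambda>\<sigma>. \<sigma> \<omega>) ` I = {z. poly f\<omega> z = 0}"
    using I_root I_surj by (auto simp: image_iff) metis
  then show ?thesis using card_image[OF I_inj] card_f\<omega> by simp
qed

definition LT :: "'c set" where "LT = field_adjoin (field_adjoin K \<Lambda>) T"
text \<open>The wild inertia group: it turns out to be the lower group for every index above 0 and
  up to \<open>A\<close>.\<close>

definition J :: "('c \<Rightarrow> 'c) set" where "J = carrier (galois_group Ln LT)"

lemma LT_facts: "subfield LT ambient" "K \<subseteq> LT" "T \<subseteq> LT" "s \<in> LT" "LT \<subseteq> Ln"
proof -
  let ?L = "field_adjoin K \<Lambda>"
  show "subfield LT ambient" unfolding LT_def by (rule field_adjoin_subfield)
  have L: "K \<subseteq> ?L" "\<Lambda> \<subseteq> ?L" by (rule field_adjoin_incl)+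
  have LT: "?L \<subseteq> LT" "T \<subseteq> LT" unfolding LT_def by (rule field_adjoin_incl)+
  show "K \<subseteq> LT" "T \<subseteq> LT" using L LT by blast+
  have "s \<in> \<Lambda>" unfolding \<Lambda> using act_1 by (metis rangeI)
  then show "s \<in> LT" using L LT by blast
  show "LT \<subseteq> Ln"
    unfolding LT_def
    by (rule field_adjoin_least[OF sf_Ln field_adjoin_least[OF sf_Ln K_Ln \<Lambda>_Ln] T_Ln])
qed

lemma M0_LT: "M0 \<subseteq> LT"
  unfolding M0_def
proof (rule field_adjoin_least[OF LT_facts(1,2)])
  show "S0 \<subseteq> LT"
  proof
    fix x assume "x \<in> S0"
    then consider "x \<in> T" | "x ^ (q - 1) = (s ^ E0) ^ (q - 1)" by (auto simp: S0_def)
    then show "x \<in> LT"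
    proof cases
      case 1
      then show ?thesis using LT_facts(3) by blast
    next
      case 2
      have "s ^ E0 \<noteq> 0" using s_nonzero by simp
      with 2 obtain c where "x = \<gamma> [:c:] * s ^ E0" by (rule same_power)
      then show ?thesis
        using sf_mult[OF LT_facts(1) \<gamma>_M[OF LT_facts(2)] sf_power[OF LT_facts(1,4)]] by simp
    qed
  qed
qed

lemma J_I: "J \<subseteq> I"
  unfolding I_def J_def by (rule galois_group_antimono[OF M0_LT])

text \<open>The displacement of \<open>\<omega>\<close> is torsion exactly when \<sigma> fixes
  \<open>act U \<omega> = s\<close>, and \<open>s\<close> generates
  \<open>\<Lambda>\<close>.\<close>

lemma J_iff: "\<sigma> \<in> J \<longleftrightarrow> \<sigma> \<in> I \<and> \<sigma> \<omega> - \<omega> \<in> T"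
proof
  assume \<sigma>: "\<sigma> \<in> J"
  then have I: "\<sigma> \<in> I" using J_I by blast
  have "\<sigma> s = s" using \<sigma> LT_facts(4) by (auto simp: J_def galois_group_iff[OF sf_Ln])
  then have "act U (\<sigma> \<omega>) = s" using I_act[OF I \<omega>_Ln, of U] act_\<omega> by simp
  then show "\<sigma> \<in> I \<and> \<sigma> \<omega> - \<omega> \<in> T" using I by (simp add: T_iff act_diff act_\<omega>)
next
  assume \<sigma>: "\<sigma> \<in> I \<and> \<sigma> \<omega> - \<omega> \<in> T"
  then have "act U (\<sigma> \<omega>) = s" by (simp add: T_iff act_diff act_\<omega>)
  then have s: "\<sigma> s = s" using I_act[of \<sigma> \<omega> U] \<sigma> \<omega>_Ln act_\<omega> by simp
  have \<sigma>K: "\<sigma> \<in> carrier (galois_group Ln K)"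
    using \<sigma> galois_group_antimono[OF K_M0, of Ln] by (auto simp: I_def)
  have "\<sigma> x = x" if x: "x \<in> \<Lambda>" for x
  proof -
    obtain a where "x = act a s" using x unfolding \<Lambda> by blast
    then show ?thesis using I_act[of \<sigma> s a] \<sigma> s_Ln s by simp
  qed
  then have "\<sigma> \<in> carrier (galois_group Ln (field_adjoin K \<Lambda>))"
    by (rule galois_group_fixed_subfield[OF sf_Ln \<sigma>K K_Ln \<Lambda>_Ln])
  moreover have "\<sigma> x = x" if "x \<in> T" for x
    using I_emb(2)[of \<sigma> x] \<sigma> that T_M0 by blast
  ultimately show "\<sigma> \<in> J" unfolding J_def LT_def
    by (intro galois_group_fixed_subfield[OF sf_Ln _ field_adjoin_least[OF sf_Ln K_Ln \<Lambda>_Ln] T_Ln])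
qed

text \<open>Surjective because \<open>\<omega> + \<zeta>\<close> is a root of the minimal polynomial
  of \<open>\<omega>\<close> over \<open>M0\<close>, so some \<sigma> in \<open>I\<close> reaches
  it, and \<open>J_iff\<close> puts this \<sigma> into \<open>J\<close>.\<close>

lemma J_bij: "bij_betw (\<lambda>\<sigma>. \<sigma> \<omega> - \<omega>) J T"
  unfolding bij_betw_def
proof
  show "inj_on (\<lambda>\<sigma>. \<sigma> \<omega> - \<omega>) J"
    using inj_on_subset[OF I_inj J_I] by (simp add: inj_on_def)
  show "(\<lambda>\<sigma>. \<sigma> \<omega> - \<omega>) ` J = T"
  proof (intro equalityI subsetI)
    fix \<zeta> assume \<zeta>: "\<zeta> \<in> T"
    then have "poly f\<omega> (\<omega> + \<zeta>) = 0" by (simp add: poly_f\<omega> act_add T_iff act_\<omega>)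
    then obtain \<sigma> where \<sigma>: "\<sigma> \<in> I" "\<sigma> \<omega> = \<omega> + \<zeta>" by (rule I_surj)
    then have "\<sigma> \<in> J" "\<zeta> = \<sigma> \<omega> - \<omega>" using \<zeta> by (simp_all add: J_iff)
    then show "\<zeta> \<in> (\<lambda>\<sigma>. \<sigma> \<omega> - \<omega>) ` J" by blast
  qed (auto simp: J_iff)
qed

text \<open>The map is a cocycle, and a homomorphism because \<sigma> acts trivially on the torsion
  points.\<close>

lemma J_iso: "(\<lambda>\<sigma>. \<sigma> \<omega> - \<omega>) \<in> Group.iso (galois_group Ln LT) (additive_group T)"
proof (rule isoI)
  show "bij_betw (\<lambda>\<sigma>. \<sigma> \<omega> - \<omega>) (carrier (galois_group Ln LT)) (carrier (additive_group T))"
    using J_bij by (simp add: J_def additive_group_def)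
  show "(\<lambda>\<sigma>. \<sigma> \<omega> - \<omega>) \<in> hom (galois_group Ln LT) (additive_group T)"
  proof (rule homI)
    fix \<sigma> assume "\<sigma> \<in> carrier (galois_group Ln LT)"
    then show "\<sigma> \<omega> - \<omega> \<in> carrier (additive_group T)"
      using J_iff[of \<sigma>] by (simp add: J_def additive_group_def)
  next
    fix \<sigma> \<tau> assume st: "\<sigma> \<in> carrier (galois_group Ln LT)" "\<tau> \<in> carrier (galois_group Ln LT)"
    then have \<sigma>: "\<sigma> \<in> I" and \<tau>: "\<tau> \<omega> - \<omega> \<in> T" using J_iff by (auto simp: J_def)
    have "\<sigma> (\<tau> \<omega>) = \<sigma> (\<omega> + (\<tau> \<omega> - \<omega>))" by simp
    also have "\<dots> = \<sigma> \<omega> + \<sigma> (\<tau> \<omega> - \<omega>)"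
      by (rule field_emb_add[OF sf_Ln I_emb(1)[OF \<sigma>] \<omega>_Ln]) (use \<tau> T_Ln in blast)
    also have "\<sigma> (\<tau> \<omega> - \<omega>) = \<tau> \<omega> - \<omega>" by (rule I_emb(2)[OF \<sigma>]) (use \<tau> T_M0 in blast)
    finally show "(\<sigma> \<otimes>\<^bsub>galois_group Ln LT\<^esub> \<tau>) \<omega> - \<omega> =
        (\<sigma> \<omega> - \<omega>) \<otimes>\<^bsub>additive_group T\<^esub> (\<tau> \<omega> - \<omega>)"
      unfolding galois_group_mult[OF st] using \<omega>_Ln by (simp add: compose_def additive_group_def)
  qed
qed

lemma card_J: "card J = Q"
  using bij_betw_same_card[OF J_bij] card_T by simp

text \<open>The relative displacement of \<open>\<omega>\<close> replaces that of a uniformizer. It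
  is \<infinity> for the identity, \<open>R / Q\<close> on the rest of \<open>J\<close>, and 0 on
  \<open>I\<close> outside \<open>J\<close>.\<close>

definition jump :: "('c \<Rightarrow> 'c) \<Rightarrow> ereal" where "jump \<sigma> = w (\<sigma> \<omega> / \<omega> - 1)"

lemma \<omega>_nonzero: "\<omega> \<noteq> 0" using w_\<omega> by auto

lemma w_div_\<omega>: "\<zeta> \<in> T \<Longrightarrow> ereal (R / real Q) \<le> w (\<zeta> / \<omega>)"
  "\<zeta> \<in> T \<Longrightarrow> \<zeta> \<noteq> 0 \<Longrightarrow> w (\<zeta> / \<omega>) = ereal (R / real Q)"
proof -
  show *: "\<zeta> \<in> T \<Longrightarrow> \<zeta> \<noteq> 0 \<Longrightarrow> w (\<zeta> / \<omega>) = ereal (R / real Q)" for \<zeta>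
    using T_w[of \<zeta>] by (simp add: w_divide \<omega>_nonzero w_\<omega>)
  show "\<zeta> \<in> T \<Longrightarrow> ereal (R / real Q) \<le> w (\<zeta> / \<omega>)"
    using * by (cases "\<zeta> = 0") auto
qed

lemma RQ_pos: "0 < R / real Q" using R_pos Q_pos by simp

lemma jump_J: "\<sigma> \<in> J \<Longrightarrow> jump \<sigma> = (if \<sigma> \<omega> = \<omega> then \<infinity> else ereal (R / real Q))"
proof -
  assume "\<sigma> \<in> J"
  then have z: "\<sigma> \<omega> - \<omega> \<in> T" using J_iff by simp
  have "\<sigma> \<omega> / \<omega> - 1 = (\<sigma> \<omega> - \<omega>) / \<omega>" using \<omega>_nonzero by (simp add: field_simps)
  then show ?thesis using w_div_\<omega>(2)[OF z] \<omega>_nonzero by (simp add: jump_def)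
qed

lemma I_not_J:
  assumes "\<sigma> \<in> I" "\<sigma> \<notin> J"
  obtains c where "c \<noteq> 0" "\<gamma> [:c:] ^ E0 = 1" "\<gamma> [:c:] \<noteq> 1" "0 < w (\<sigma> \<omega> / \<omega> - \<gamma> [:c:])"
proof -
  obtain c \<zeta> where c: "c \<noteq> 0" "\<zeta> \<in> T" "\<sigma> \<omega> = \<gamma> [:c:] * \<omega> + \<zeta>" "\<gamma> [:c:] ^ E0 = 1"
    using f\<omega>_root_cases[OF I_root[OF assms(1)]] .
  have "\<gamma> [:c:] \<noteq> 1"
  proof
    assume "\<gamma> [:c:] = 1"
    then have "\<sigma> \<omega> - \<omega> = \<zeta>" using c(3) by simp
    then show False using assms c(2) J_iff by simp
  qed
  moreover have "\<sigma> \<omega> / \<omega> - \<gamma> [:c:] = \<zeta> / \<omega>" using \<omega>_nonzero c(3) by (simp add: field_simps)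
  moreover have "0 < ereal (R / real Q)" using RQ_pos by simp
  then have "0 < w (\<zeta> / \<omega>)" using w_div_\<omega>(1)[OF c(2)] by (rule order_less_le_trans)
  ultimately show ?thesis using that[OF c(1,4)] by simp
qed

text \<open>\<open>\<epsilon> ^ i\<close> is congruent to the constant
  \<open>\<gamma> [:c:] ^ i\<close>, and a constant other than 1 stays away from 1 in the residue
  field.\<close>

lemma near_root_of_unity:
  assumes c: "c \<noteq> 0" and \<epsilon>: "0 < w (\<epsilon> - \<gamma> [:c:])" and ne: "\<gamma> [:c:] ^ i \<noteq> 1"
  shows "w (\<epsilon> ^ i - 1) = 0"
proof -
  let ?c = "\<gamma> [:c:]"
  have wc: "w ?c = 0" by (rule w_const[OF c])
  have "w (?c + (\<epsilon> - ?c)) = w ?c" by (rule w_add_eq) (use wc \<epsilon> in simp)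
  then have w\<epsilon>: "w \<epsilon> = 0" using wc by simp
  have near: "0 < w (\<epsilon> ^ k - ?c ^ k)" for k
  proof (induction k)
    case (Suc k)
    have eq: "\<epsilon> ^ Suc k - ?c ^ Suc k = \<epsilon> * (\<epsilon> ^ k - ?c ^ k) + ?c ^ k * (\<epsilon> - ?c)"
      by (simp add: algebra_simps)
    show ?case unfolding eq
      by (rule w_add_gt) (use Suc \<epsilon> wc w\<epsilon> in \<open>simp_all add: w_mult w_power\<close>)
  qed simp
  have "(?c ^ i) ^ (q - 1) = (?c ^ (q - 1)) ^ i" by (simp only: power_mult[symmetric] mult.commute)
  then have "(?c ^ i) ^ (q - 1) = 1" using const_power(1)[OF c] by simp
  from root_of_unity_diff[OF this ne] have "w (?c ^ i - 1) = 0" .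
  moreover have "\<epsilon> ^ i - 1 = (?c ^ i - 1) + (\<epsilon> ^ i - ?c ^ i)" by simp
  ultimately show ?thesis using w_add_eq[of "?c ^ i - 1" "\<epsilon> ^ i - ?c ^ i"] near[of i] by simp
qed

lemma jump_not_J: "\<sigma> \<in> I \<Longrightarrow> \<sigma> \<notin> J \<Longrightarrow> jump \<sigma> = 0"
proof -
  assume "\<sigma> \<in> I" "\<sigma> \<notin> J"
  then obtain c where "c \<noteq> 0" "\<gamma> [:c:] ^ E0 = 1" "\<gamma> [:c:] \<noteq> 1" "0 < w (\<sigma> \<omega> / \<omega> - \<gamma> [:c:])"
    by (rule I_not_J)
  then show ?thesis using near_root_of_unity[of c "\<sigma> \<omega> / \<omega>" 1] by (simp add: jump_def)
qed

lemma jump_ge: "\<sigma> \<in> I \<Longrightarrow> 0 \<le> jump \<sigma>"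
  using jump_J[of \<sigma>] jump_not_J[of \<sigma>] RQ_pos by (cases "\<sigma> \<in> J") auto

lemma w_of_nat_unit: "\<not> p dvd i \<Longrightarrow> w (of_nat i) = 0"
proof -
  assume "\<not> p dvd i"
  then have "of_nat i \<noteq> (0::'c)" by (simp add: of_nat_eq_0_iff)
  moreover have "of_nat i = \<gamma> [:of_nat i:]" using \<gamma>_of_nat[of i] by (simp add: of_nat_poly)
  moreover have "(of_nat i :: 'q) \<noteq> 0" using calculation \<gamma>_0 by auto
  ultimately show ?thesis using w_const[of "of_nat i"] by simp
qed

text \<open>For these exponents \<open>\<pi>\<^sup>z \<omega>\<^sup>i\<close> is a uniformizer.\<close>

lemma test_exponents:
  obtains i z :: nat where "E0 * Q * z = i * A + 1"
proof -
  have "E0 * Q \<noteq> 0" using E0_pos Q_pos by simp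
  from bezout_nat[OF this, of A] obtain z i where "E0 * Q * z = A * i + gcd (E0 * Q) A" by blast
  moreover have "gcd (E0 * Q) A = 1" using coprime_A by (simp add: coprime_iff_gcd_eq_1[symmetric] coprime_commute)
  ultimately show ?thesis using that by (simp add: mult.commute)
qed

text \<open>The exponent loses nothing. On \<open>J\<close> it matters that \<open>p\<close> does
  not divide \<open>i\<close>, as \<open>i * A + 1\<close> is divisible by \<open>Q\<close>. Off
  \<open>J\<close> the constant \<open>c\<close> satisfies \<open>c ^ E0 = 1\<close>, and
  \<open>c ^ i = 1\<close> would give \<open>c = c ^ (i * A + 1) = 1\<close>.\<close>

lemma w_test_power:
  assumes \<sigma>: "\<sigma> \<in> I" and i: "E0 * Q * z = i * A + 1"
  shows "w ((\<sigma> \<omega> / \<omega>) ^ i - 1) = jump \<sigma>"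
proof (cases "\<sigma> \<in> J")
  case True
  have "\<not> p dvd i"
  proof
    assume "p dvd i"
    then have "p dvd i * A" by simp
    moreover have "p dvd i * A + 1" unfolding i[symmetric] using p_dvd_Q by simp
    ultimately have "p dvd 1" by (metis dvd_add_right_iff)
    then show False using p by (simp add: prime_nat_iff)
  qed
  moreover have "0 < w (\<sigma> \<omega> / \<omega> - 1)"
    using jump_J[OF True] RQ_pos unfolding jump_def by (auto split: if_splits)
  ultimately show ?thesis unfolding jump_def using w_power_minus_1 w_of_nat_unit by blast
next
  case False
  then obtain c where c: "c \<noteq> 0" "\<gamma> [:c:] ^ E0 = 1" "\<gamma> [:c:] \<noteq> 1" "0 < w (\<sigma> \<omega> / \<omega> - \<gamma> [:c:])"
    using \<sigma> I_not_J by blast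
  have "\<gamma> [:c:] ^ i \<noteq> 1"
  proof
    assume "\<gamma> [:c:] ^ i = 1"
    then have "\<gamma> [:c:] ^ (i * A) = 1" by (simp only: power_mult power_one)
    then have "\<gamma> [:c:] ^ (i * A + 1) = \<gamma> [:c:]" by simp
    moreover have "\<gamma> [:c:] ^ (i * A + 1) = 1"
      unfolding i[symmetric] using c(2) by (simp add: power_mult)
    ultimately show False using c(3) by metis
  qed
  then show ?thesis using near_root_of_unity[OF c(1,4)] jump_not_J[OF \<sigma> False] by simp
qed

text \<open>Write \<open>x\<close> as a polynomial in \<open>\<omega>\<close> over
  \<open>M0\<close>. The constant term is fixed; any other term is integral of nonintegral
  valuation, hence of valuation at least \<open>1 / (E0 * Q)\<close>, and is multiplied by
  \<open>\<epsilon> ^ i - 1\<close>, which contributes at least the jump.\<close>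

lemma displacement_ge:
  assumes \<sigma>: "\<sigma> \<in> I" and x: "x \<in> Ln" "0 \<le> w x"
  shows "ereal (1 / real (E0 * Q)) + jump \<sigma> \<le> w (\<sigma> x - x)"
proof -
  let ?n = "E0 * Q" and ?\<epsilon> = "\<sigma> \<omega> / \<omega>"
  have n0: "0 < ?n" using E0_pos Q_pos by simp
  have "x \<in> simple_ext M0 \<omega>" using x(1) Ln_simple by blast
  then obtain f where f: "f \<in> polys_over M0" "x = poly f \<omega>" "Polynomial.degree f < ?n"
    unfolding degree_g\<omega>[symmetric] by (rule simple_ext_reduced[OF sf_M0 min_poly_\<omega>])
  have "\<sigma> (poly f \<omega>) = poly f (\<sigma> \<omega>)"
    by (rule field_emb_fixed_poly[OF sf_M0 sf_Ln M0_Ln I_emb[OF \<sigma>] f(1) \<omega>_Ln])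
  then have "\<sigma> x - x = poly f (\<sigma> \<omega>) - poly f \<omega>" by (simp only: f(2))
  also have "\<dots> = (\<Sum>i\<le>Polynomial.degree f. Polynomial.coeff f i * \<omega> ^ i * (?\<epsilon> ^ i - 1))"
    unfolding poly_altdef sum_subtractf[symmetric] using \<omega>_nonzero
    by (intro sum.cong) (auto simp: power_divide field_simps)
  finally have eq: "\<sigma> x - x = (\<Sum>i\<le>Polynomial.degree f. Polynomial.coeff f i * \<omega> ^ i * (?\<epsilon> ^ i - 1))" .
  have w\<epsilon>: "0 \<le> w ?\<epsilon>"
  proof -
    have "0 \<le> w (1 + (?\<epsilon> - 1))" by (rule w_add_ge) (use jump_ge[OF \<sigma>] in \<open>auto simp: jump_def\<close>)
    then show ?thesis by simp
  qed
  show ?thesis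
    unfolding eq
  proof (rule w_sum_ge)
    fix i assume i: "i \<in> {..Polynomial.degree f}"
    show "ereal (1 / real ?n) + jump \<sigma> \<le> w (Polynomial.coeff f i * \<omega> ^ i * (?\<epsilon> ^ i - 1))"
    proof (cases "i = 0 \<or> Polynomial.coeff f i = 0")
      case False
      then have i': "0 < i" "i < ?n" using i f(3) by auto
      obtain k :: int where k: "w (Polynomial.coeff f i) = ereal (of_int k)"
        using M0Z[OF polys_over_coeff[OF f(1)]] False by blast
      have RQ: "R / real Q = real A / real ?n" using A E0_pos Q_pos by (simp add: field_simps)
      have wt: "w (Polynomial.coeff f i * \<omega> ^ i) = ereal (of_int k + real i * - (R / real Q))"
        by (simp add: w_mult w_power k w_\<omega>)
      have "w x \<le> w (Polynomial.coeff f i * \<omega> ^ i)"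
        unfolding f(2) by (rule ramified_values(1)[OF sf_M0 M0Z w_\<omega> \<omega>_nonint f(1,3)])
      then have "0 \<le> w (Polynomial.coeff f i * \<omega> ^ i)" using x(2) by (rule order_trans[rotated])
      then have ge: "0 \<le> of_int k + real i * - (R / real Q)" unfolding wt by simp
      have "of_int k + real i * - (R / real Q) \<noteq> 0"
      proof
        assume "of_int k + real i * - (R / real Q) = 0"
        then have "real i * - (R / real Q) = of_int (- k)" by simp
        then have "real i * - (R / real Q) \<in> \<int>" by (simp only: Ints_of_int)
        then show False using \<omega>_nonint[OF i'] by blast
      qed
      moreover have e: "of_int k + real i * - (R / real Q) = of_int (k * int ?n - int i * int A) / real ?n"
        unfolding RQ using n0 by (simp add: field_simps)
      ultimately have "0 < of_int (k * int ?n - int i * int A) / real ?n" using ge by simp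
      \<comment> \<open>The valuation is this integer divided by \<open>E0 * Q\<close>; being
        positive, the integer is at least 1.\<close>
      then have "0 < (of_int (k * int ?n - int i * int A) :: real)" using n0 by (simp only: zero_less_divide_iff) linarith
      then have "1 \<le> k * int ?n - int i * int A" by (simp only: of_int_0_less_iff)
      then have "(1::real) \<le> of_int (k * int ?n - int i * int A)" by (simp only: of_int_1_le_iff)
      then have "1 / real ?n \<le> of_int (k * int ?n - int i * int A) / real ?n"
        by (rule divide_right_mono) simp
      then have 1: "ereal (1 / real ?n) \<le> w (Polynomial.coeff f i * \<omega> ^ i)"
        unfolding wt e by (simp only: ereal_less_eq)
      have 2: "jump \<sigma> \<le> w (?\<epsilon> ^ i - 1)" unfolding jump_def by (rule w_power_minus_1_ge[OF w\<epsilon>])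
      show ?thesis unfolding w_mult[of "Polynomial.coeff f i * \<omega> ^ i"] by (rule add_mono[OF 1 2])
    qed auto
  qed
qed

text \<open>The bound is attained at \<open>\<pi> ^ z * \<omega> ^ i\<close> with the exponents of
  \<open>test_exponents\<close>, whose valuation is the least possible positive one.\<close>

lemma displacement_eq:
  assumes \<sigma>: "\<sigma> \<in> I"
  obtains x where "x \<in> Ln" "0 \<le> w x" "w (\<sigma> x - x) = ereal (1 / real (E0 * Q)) + jump \<sigma>"
proof -
  let ?n = "E0 * Q"
  have n0: "0 < real ?n" using E0_pos Q_pos by simp
  obtain i z where iz: "?n * z = i * A + 1" by (rule test_exponents)
  let ?x = "\<pi> ^ z * \<omega> ^ i"
  have RQ: "R / real Q = real A / real ?n" using A E0_pos Q_pos by (simp add: field_simps)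
  have \<pi>z: "\<pi> ^ z \<in> M0" using sf_power[OF K \<pi>(1)] K_M0 by blast
  have xL: "?x \<in> Ln" by (rule sf_mult[OF sf_Ln subsetD[OF M0_Ln \<pi>z] sf_power[OF sf_Ln \<omega>_Ln]])
  have "real ?n * real z = real i * real A + 1" using arg_cong[OF iz, of real] by simp
  then have "real z = (real i * real A + 1) / real ?n" using n0 by (metis less_irrefl nonzero_mult_div_cancel_left)
  then have "real z + real i * - (R / real Q) = 1 / real ?n" unfolding RQ by (simp add: add_divide_distrib)
  then have wx: "w ?x = ereal (1 / real ?n)" by (simp add: w_mult w_power \<pi>(2) w_\<omega>)
  have "\<sigma> ?x = \<pi> ^ z * \<sigma> \<omega> ^ i"
    using field_emb_mult[OF sf_Ln I_emb(1)[OF \<sigma>], of "\<pi> ^ z" "\<omega> ^ i"] \<pi>z M0_Ln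
      sf_power[OF sf_Ln \<omega>_Ln] field_emb_power[OF sf_Ln I_emb(1)[OF \<sigma>] \<omega>_Ln] I_emb(2)[OF \<sigma> \<pi>z] by auto
  then have "\<sigma> ?x - ?x = ?x * ((\<sigma> \<omega> / \<omega>) ^ i - 1)" using \<omega>_nonzero by (simp add: power_divide field_simps)
  then have "w (\<sigma> ?x - ?x) = ereal (1 / real ?n) + jump \<sigma>"
    using wx w_test_power[OF \<sigma> iz] by (simp only: w_mult)
  moreover have "0 \<le> w ?x" unfolding wx using n0 by simp
  ultimately show ?thesis using that xL by blast
qed

end

section \<open>The lower ramification filtration\<close>

context tate_ramification
begin

text \<open>The least displacement of an integral element has normalized valuation
  \<open>1 + E0 * Q * jump \<sigma>\<close>; its summand 1 cancels against the 1 in the definition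
  of the lower numbering.\<close>

lemma lower_ram_group_iff:
  assumes y: "0 \<le> y"
  shows "\<sigma> \<in> lower_ram_group w Ln K y \<longleftrightarrow>
    \<sigma> \<in> I \<and> ereal (of_int \<lceil>y\<rceil>) \<le> ereal (real (E0 * Q)) * jump \<sigma>"
proof -
  let ?n = "E0 * Q"
  have n0: "0 < real ?n" using E0_pos Q_pos by simp
  have c0: "0 \<le> \<lceil>y\<rceil>" using y by simp
  have scale: "ereal (real ?n) * (ereal (1 / real ?n) + jump \<sigma>) = 1 + ereal (real ?n) * jump \<sigma>"
    if "\<sigma> \<in> I" for \<sigma>
  proof (cases "jump \<sigma>")
    case (real j)
    have "real ?n * (1 / real ?n + j) = 1 + real ?n * j" using n0 by (simp add: distrib_left del: of_nat_mult)
    then show ?thesis unfolding real one_ereal_def by (simp only: plus_ereal.simps times_ereal.simps)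
  next
    case PInf
    have "ereal (real ?n) * \<infinity> = \<infinity>" using n0 by (simp del: of_nat_mult)
    then show ?thesis unfolding PInf by simp
  next
    case MInf
    then show ?thesis using jump_ge[OF that] by simp
  qed
  have ineq: "ereal (of_int \<lceil>y\<rceil> + 1) \<le> 1 + v \<longleftrightarrow> ereal (of_int \<lceil>y\<rceil>) \<le> v" for v
    by (cases v) (simp_all add: one_ereal_def)
  show ?thesis
  proof
    assume low: "\<sigma> \<in> lower_ram_group w Ln K y"
    then have \<sigma>K: "\<sigma> \<in> carrier (galois_group Ln K)"
      and lo: "\<And>x. x \<in> Ln \<Longrightarrow> 0 \<le> w x \<Longrightarrow> ereal (of_int \<lceil>y\<rceil> + 1) \<le> ereal (real ?n) * w (\<sigma> x - x)"
      unfolding lower_ram_group_def ram_index_Ln by blast+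
    \<comment> \<open>For \<open>y \<ge> 0\<close> every displacement must have normalized valuation
      at least 1, but moving a point of \<open>S0\<close> would displace some integral element by a
      unit.\<close>
    have fix_S0: "\<sigma> x = x" if xS: "x \<in> S0" for x
    proof (rule ccontr)
      assume "\<sigma> x \<noteq> x"
      then obtain b where "b \<in> Ln" "0 \<le> w b" "w (\<sigma> b - b) = 0"
        using detect[OF sf_Ln K_Ln S0_Ln \<sigma>K xS] by blast
      then have "ereal (of_int \<lceil>y\<rceil> + 1) \<le> ereal (real ?n) * 0"
        using lo[OF \<open>b \<in> Ln\<close> \<open>0 \<le> w b\<close>] by (simp only:)
      then have "of_int \<lceil>y\<rceil> + 1 \<le> (0::real)" by (simp only: zero_ereal_def times_ereal.simps mult_zero_right ereal_less_eq)
      moreover have "0 \<le> (of_int \<lceil>y\<rceil> :: real)" using c0 by (simp only: of_int_0_le_iff)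
      ultimately show False by linarith
    qed
    then have \<sigma>: "\<sigma> \<in> I"
      unfolding I_def M0_def by (rule galois_group_fixed_subfield[OF sf_Ln \<sigma>K K_Ln S0_Ln])
    obtain x where x: "x \<in> Ln" "0 \<le> w x" "w (\<sigma> x - x) = ereal (1 / real ?n) + jump \<sigma>"
      using displacement_eq[OF \<sigma>] .
    have "ereal (of_int \<lceil>y\<rceil> + 1) \<le> 1 + ereal (real ?n) * jump \<sigma>"
      using lo[OF x(1,2)] unfolding x(3) scale[OF \<sigma>] .
    then show "\<sigma> \<in> I \<and> ereal (of_int \<lceil>y\<rceil>) \<le> ereal (real ?n) * jump \<sigma>" using \<sigma> by (simp only: ineq simp_thms)
  next
    assume a: "\<sigma> \<in> I \<and> ereal (of_int \<lceil>y\<rceil>) \<le> ereal (real ?n) * jump \<sigma>"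
    then have \<sigma>: "\<sigma> \<in> I" by simp
    have \<sigma>K: "\<sigma> \<in> carrier (galois_group Ln K)"
      using \<sigma> galois_group_antimono[OF K_M0, of Ln] by (auto simp: I_def)
    have "ereal (of_int \<lceil>y\<rceil> + 1) \<le> ereal (real ?n) * w (\<sigma> x - x)" if x: "x \<in> Ln" "0 \<le> w x" for x
    proof -
      have "ereal (of_int \<lceil>y\<rceil> + 1) \<le> 1 + ereal (real ?n) * jump \<sigma>" using a by (simp only: ineq)
      also have "\<dots> = ereal (real ?n) * (ereal (1 / real ?n) + jump \<sigma>)" by (rule scale[OF \<sigma>, symmetric])
      also have "\<dots> \<le> ereal (real ?n) * w (\<sigma> x - x)"
        by (rule ereal_mult_left_mono[OF displacement_ge[OF \<sigma> x]]) simp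
      finally show ?thesis .
    qed
    then show "\<sigma> \<in> lower_ram_group w Ln K y"
      using \<sigma>K unfolding lower_ram_group_def ram_index_Ln by blast
  qed
qed

lemma scaled_RQ: "real (E0 * Q) * (R / real Q) = real A"
  using A Q_pos by (simp add: field_simps)

lemma card_lower_0: "card (lower_ram_group w Ln K 0) = E0 * Q"
proof -
  have "0 \<le> ereal (real (E0 * Q)) * jump \<sigma>" if "\<sigma> \<in> I" for \<sigma>
    using jump_ge[OF that] by (intro ereal_0_le_mult) auto
  moreover have "ereal (of_int \<lceil>0::real\<rceil>) = 0" by (simp add: zero_ereal_def)
  ultimately have "lower_ram_group w Ln K 0 = I"
    using lower_ram_group_iff[OF order.refl] by (metis (no_types, lifting) subsetI subset_antisym)
  then show ?thesis using card_I by simp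
qed

lemma card_lower_1: assumes "0 < y" "y \<le> real A" shows "card (lower_ram_group w Ln K y) = Q"
proof -
  have c: "1 \<le> \<lceil>y\<rceil>" "\<lceil>y\<rceil> \<le> int A" using assms by (simp_all add: ceiling_le_iff)
  have "(of_int \<lceil>y\<rceil> :: real) \<le> of_int (int A)" using c(2) by (simp only: of_int_le_iff)
  then have cA: "of_int \<lceil>y\<rceil> \<le> real A" by simp
  have "\<sigma> \<in> lower_ram_group w Ln K y \<longleftrightarrow> \<sigma> \<in> J" for \<sigma>
  proof
    assume "\<sigma> \<in> lower_ram_group w Ln K y"
    then have \<sigma>: "\<sigma> \<in> I" "ereal (of_int \<lceil>y\<rceil>) \<le> ereal (real (E0 * Q)) * jump \<sigma>"
      using lower_ram_group_iff[of y] assms(1) by (simp_all only: less_imp_le)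
    show "\<sigma> \<in> J"
    proof (rule ccontr)
      assume "\<sigma> \<notin> J"
      then have "ereal (of_int \<lceil>y\<rceil>) \<le> ereal (real (E0 * Q)) * 0" using \<sigma> jump_not_J by metis
      then have "of_int \<lceil>y\<rceil> \<le> (0::real)" by (simp only: zero_ereal_def times_ereal.simps mult_zero_right ereal_less_eq)
      then have "\<lceil>y\<rceil> \<le> 0" by (simp only: of_int_le_0_iff)
      then show False using c(1) by linarith
    qed
  next
    assume \<sigma>: "\<sigma> \<in> J"
    have "ereal (of_int \<lceil>y\<rceil>) \<le> ereal (real (E0 * Q)) * jump \<sigma>"
    proof (cases "\<sigma> \<omega> = \<omega>")
      case True
      then have "jump \<sigma> = \<infinity>" using jump_J[OF \<sigma>] by simp
      then show ?thesis using E0_pos Q_pos by simp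
    next
      case False
      then have "jump \<sigma> = ereal (R / real Q)" using jump_J[OF \<sigma>] by simp
      then show ?thesis using cA by (simp only: times_ereal.simps scaled_RQ ereal_less_eq)
    qed
    then show "\<sigma> \<in> lower_ram_group w Ln K y"
      using lower_ram_group_iff[of y] assms(1) \<sigma> J_I less_imp_le by blast
  qed
  then have "lower_ram_group w Ln K y = J" by blast
  then show ?thesis using card_J by simp
qed

lemma card_lower_2: assumes "real A < y" shows "card (lower_ram_group w Ln K y) = 1"
proof -
  have y0: "0 \<le> y" using assms by (meson less_imp_le of_nat_0_le_iff order_trans)
  have cA: "real A < of_int \<lceil>y\<rceil>" using assms by (meson le_of_int_ceiling order_less_le_trans)
  let ?id = "restrict id Ln"
  have idJ: "?id \<in> J" unfolding J_def by (rule galois_group_id[OF sf_Ln LT_facts(5)])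
  have "\<sigma> \<in> lower_ram_group w Ln K y \<longleftrightarrow> \<sigma> = ?id" for \<sigma>
  proof
    assume "\<sigma> \<in> lower_ram_group w Ln K y"
    then have \<sigma>: "\<sigma> \<in> I" "ereal (of_int \<lceil>y\<rceil>) \<le> ereal (real (E0 * Q)) * jump \<sigma>"
      using lower_ram_group_iff[OF y0] by blast+
    have J: "\<sigma> \<in> J"
    proof (rule ccontr)
      assume "\<sigma> \<notin> J"
      then have "ereal (of_int \<lceil>y\<rceil>) \<le> ereal (real (E0 * Q)) * 0" using \<sigma> jump_not_J by metis
      then have "of_int \<lceil>y\<rceil> \<le> (0::real)" by (simp only: zero_ereal_def times_ereal.simps mult_zero_right ereal_less_eq)
      then show False using cA by (meson of_nat_0_le_iff not_le order_trans)
    qed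
    have "\<sigma> \<omega> = \<omega>"
    proof (rule ccontr)
      assume "\<sigma> \<omega> \<noteq> \<omega>"
      then have "jump \<sigma> = ereal (R / real Q)" using jump_J[OF J] by simp
      then have "ereal (of_int \<lceil>y\<rceil>) \<le> ereal (real A)" using \<sigma>(2) by (simp only: times_ereal.simps scaled_RQ)
      then show False using cA by (simp only: ereal_less_eq not_le[symmetric] not_True_eq_False)
    qed
    then show "\<sigma> = ?id"
      using inj_onD[OF I_inj _ \<sigma>(1), of ?id] idJ J_I \<omega>_Ln by auto
  next
    assume "\<sigma> = ?id"
    then have \<sigma>: "\<sigma> \<in> J" "\<sigma> \<omega> = \<omega>" using idJ \<omega>_Ln by auto
    then have "jump \<sigma> = \<infinity>" using jump_J by simp
    then have "ereal (of_int \<lceil>y\<rceil>) \<le> ereal (real (E0 * Q)) * jump \<sigma>"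
      using E0_pos Q_pos by simp
    then show "\<sigma> \<in> lower_ram_group w Ln K y"
      using lower_ram_group_iff[OF y0] \<sigma> J_I by blast
  qed
  then have "lower_ram_group w Ln K y = {?id}" by blast
  then show ?thesis by simp
qed

lemmas herbrand_psi_Ln = herbrand_psi_two_steps[OF E0_pos Q_pos card_lower_0 card_lower_1 card_lower_2 A]

lemma Ln_galois: "finite_galois Ln K"
  by (rule galois_generators.is_finite_galois[OF gen_Ln])

end

section \<open>From the given place and module to the locales\<close>

lemma fract_hom_poly_emb:
  fixes \<iota> :: "'q::field poly fract \<Rightarrow> 'c::field"
  assumes "\<iota> \<in> ring_hom ambient ambient"
  shows "poly_emb \<iota> (a + b) = poly_emb \<iota> a + poly_emb \<iota> b"
    and "poly_emb \<iota> (a * b) = poly_emb \<iota> a * poly_emb \<iota> b"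
    and "poly_emb \<iota> 1 = 1" and "inj (poly_emb \<iota>)"
proof -
  have hom: "\<iota> (x + y) = \<iota> x + \<iota> y" "\<iota> (x * y) = \<iota> x * \<iota> y" "\<iota> 1 = 1" for x y
    using assms by (auto simp: ring_hom_def)
  have zero: "\<iota> 0 = 0" using hom(1)[of 0 0] by (metis add.right_neutral add_left_cancel)
  have nz: "\<iota> x \<noteq> 0" if "x \<noteq> 0" for x
    using hom(2)[of x "inverse x"] hom(3) that by auto
  have inj: "x = y" if "\<iota> x = \<iota> y" for x y
  proof (rule ccontr)
    assume "x \<noteq> y"
    then have "\<iota> (x - y) \<noteq> 0" by (intro nz) simp
    moreover have "\<iota> x = \<iota> (x - y) + \<iota> y" using hom(1)[of "x - y" y] by simp
    ultimately show False using that by simp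
  qed
  show "poly_emb \<iota> (a + b) = poly_emb \<iota> a + poly_emb \<iota> b"
    "poly_emb \<iota> (a * b) = poly_emb \<iota> a * poly_emb \<iota> b"
    unfolding poly_emb_def hom[symmetric] by (simp_all add: mult_fract)
  show "poly_emb \<iota> 1 = 1"
    unfolding poly_emb_def One_fract_def[symmetric] by (rule hom(3))
  show "inj (poly_emb \<iota>)"
  proof (rule injI)
    fix x y assume "poly_emb \<iota> x = poly_emb \<iota> y"
    then have "Fraction_Field.Fract x 1 = Fraction_Field.Fract y 1"
      unfolding poly_emb_def by (rule inj)
    then show "x = y" by (simp add: eq_fract)
  qed
qed

text \<open>An element of \<open>F\<close> close enough to \<open>x\<close> has the same valuation
  as \<open>x\<close>.\<close>

lemma completion_values:
  fixes \<iota> :: "'q::{field,finite} poly fract \<Rightarrow> 'c::field"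
  assumes w: "valuation w" and fp: "finite_prime \<iota> F w" and c: "is_completion w F K"
    and x: "x \<in> K" "x \<noteq> 0"
  shows "\<exists>k::int. w x = ereal (of_int k)"
proof -
  interpret valued w by (rule valued.intro[OF w])
  obtain v where v: "w x = ereal v" using x(2) by (rule w_real)
  obtain y where y: "y \<in> F" "ereal v < w (x - y)"
    using c x(1) unfolding is_completion_def val_dense_in_def by blast
  have "w (x - (x - y)) = w x" by (rule w_diff_eq) (use v y in simp)
  then have "w y = w x" by simp
  moreover have "y \<noteq> 0" using \<open>w y = w x\<close> v by auto
  then have "w y \<in> range (\<lambda>k::int. ereal (of_int k))"
    using fp y(1) unfolding finite_prime_def by blast
  ultimately show ?thesis by auto
qed

theorem theorem6p1:
  fixes \<iota> :: "'q::{field,finite} poly fract \<Rightarrow> 'c::alg_closed_field"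
    and p q m d n :: nat and k :: int
    and F K L Ln \<Lambda> :: "'c set" and w :: "'c \<Rightarrow> ereal"
    and \<phi> \<psi> :: "'q poly \<Rightarrow> 'c poly" and e :: "'c \<Rightarrow> 'c"
    and a1 a2 j \<omega>20 \<omega>2 :: 'c and u :: "'q poly" and R :: real and E :: nat
  assumes "Factorial_Ring.prime p" and "q = p ^ m" and "CARD('q) = q"
    and "finite_ext_of_rational_functions \<iota> F"
    and "valuation w" and "finite_prime \<iota> F w"
    and "is_completion w F K" and "completed_algebraic_closure w K"
    and "drinfeld_module (poly_emb \<iota>) K 2 \<phi>"
    and "\<phi> [:0, 1:] = Polynomial.monom (poly_emb \<iota> [:0, 1:]) 1 +
           Polynomial.monom a1 q + Polynomial.monom a2 (q ^ 2)"
    and "bad_reduction w a1 a2"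
    and "j = a1 ^ (q + 1) / a2"
    and "w j = ereal (of_int k)" and "\<not> int p dvd k"
    and "tate_uniformization w (poly_emb \<iota>) K \<phi> \<psi> \<Lambda> e"
    and "Factorial_Ring.irreducible u" and "Polynomial.degree u = d" and "w (poly_emb \<iota> u) = 0"
    and "0 < n"
    and "is_smb w \<Lambda> \<omega>20"
    and "poly (\<psi> (u ^ n) - [:\<omega>20:]) \<omega>2 = 0"
    and "L = field_adjoin K \<Lambda>"
    and "Ln = field_adjoin L (division_lattice \<psi> (u ^ n) \<Lambda>)"
    and "ereal R = - w \<omega>20"
    and "E = ram_index w K L"
  shows "R = - of_int k / (real q - 1) \<and>
    finite_galois Ln K \<and>
    (\<lambda>\<sigma>. \<sigma> \<omega>2 - \<omega>2)
      \<in> Group.iso (galois_group Ln (field_adjoin L (torsion \<psi> (u ^ n))))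
            (additive_group (torsion \<psi> (u ^ n))) \<and>
    (\<forall>y. (-1 \<le> y \<and> y \<le> 0 \<longrightarrow> herbrand_psi w Ln K y = y) \<and>
         (0 \<le> y \<and> y \<le> R \<longrightarrow> herbrand_psi w Ln K y = real E * y) \<and>
         (R \<le> y \<longrightarrow> herbrand_psi w Ln K y =
            real (q ^ (n * d)) * real E * y - (real (q ^ (n * d)) - 1) * real E * R))"
proof -
  let ?\<gamma> = "poly_emb \<iota>"
  have hom: "\<iota> \<in> ring_hom ambient ambient" and \<iota>F: "range \<iota> \<subseteq> F"
    using assms(4) by (auto simp: finite_ext_of_rational_functions_def)
  have sfK: "subfield K ambient" "F \<subseteq> K" "val_complete w K"
    using assms(7) by (auto simp: is_completion_def val_dense_in_def)
  have tate: "drinfeld_module ?\<gamma> K 1 \<psi>" "rank1_lattice w \<psi> \<Lambda>"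
    "\<And>\<mu>. \<mu> \<in> \<Lambda> - {0} \<Longrightarrow> w \<mu> < 0" "lattice_exponential w \<Lambda> e"
    "\<And>a z. e (poly (\<psi> a) z) = poly (\<phi> a) (e z)"
    using assms(15) unfolding tate_uniformization_def by blast+
  obtain b1 where psi_t: "\<psi> [:0, 1:] = Polynomial.monom (?\<gamma> [:0, 1:]) 1 + Polynomial.monom b1 q" "w b1 = 0"
    using assms(15) unfolding tate_uniformization_def assms(3) by blast
  interpret valued_closed w
    by (intro valued_closed.intro valued.intro assms(5))
  interpret good_rank1 w ?\<gamma> p m q K \<psi> b1
  proof (intro good_rank1.intro constants.intro constants_axioms.intro good_rank1_axioms.intro)
    show "0 \<le> w (?\<gamma> [:0, 1:])" using assms(6) by (simp add: finite_prime_def)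
  qed (fact fract_hom_poly_emb[OF hom] assms(1-3) sfK(1) tate(1) psi_t valued_closed_axioms)+
  obtain \<pi> where pi: "\<pi> \<in> F" "w \<pi> = 1"
  proof -
    have "ereal (of_int 1) \<in> w ` (F - {0})" using assms(6) unfolding finite_prime_def by blast
    then obtain x where "x \<in> F" "ereal (of_int 1) = w x" by blast
    then show ?thesis using that[of x] by (simp add: one_ereal_def)
  qed
  have phi_K: "Polynomial.coeff (\<phi> [:0, 1:]) i \<in> K" for i
    using assms(9) by (auto simp: drinfeld_module_def q_polys_def)
  have q_less: "1 < q" "q < q ^ 2" using q_ge_2 by (simp_all add: power2_eq_square)
  have coeffs_K: "a1 \<in> K" "a2 \<in> K"
    using phi_K[of q] phi_K[of "q ^ 2"] q_less unfolding assms(10) by simp_all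
  have b1K: "b1 \<in> K"
  proof -
    have "Polynomial.coeff (\<psi> [:0, 1:]) q = b1" unfolding \<psi>_t using q_less by simp
    then show ?thesis using polys_over_coeff[OF \<psi>_polys_over] by metis
  qed
  have red: "w a1 = 0" "0 < w a2" using assms(11) by (auto simp: bad_reduction_def)
  have smb: "\<omega>20 \<in> \<Lambda> - {0}" using assms(20) by (simp add: is_smb_def)
  have ws: "w \<omega>20 = ereal (- R)" using assms(24) by (metis ereal_uminus_uminus uminus_ereal.simps(1))
  interpret tate_lattice w ?\<gamma> p m q K \<psi> b1 \<Lambda> \<omega>20 \<pi> R e "\<phi> [:0, 1:]" a1 a2
  proof
    show "val_complete w UNIV" using assms(8) by (simp add: completed_algebraic_closure_def)
    show "\<Lambda> = range (\<lambda>a. act a \<omega>20)" by (rule smb_generates[OF tate(2,3) assms(20)])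
    show "finite {z \<in> \<Lambda>. ereal r \<le> w z}" for r using tate(2) unfolding rank1_lattice_def by blast
    show "0 < R" using tate(3)[OF smb] ws by (simp add: zero_ereal_def)
    show "?\<gamma> a \<in> K" for a using \<iota>F sfK(2) by (auto simp: poly_emb_def)
  qed (use sfK pi ws tate(4,5) assms(10) coeffs_K red b1K in auto)
  have a2_nonzero: "a2 \<noteq> 0" using w_a2 by auto
  \<comment> \<open>As \<open>a1\<close> is a unit, \<open>w j = - w a2\<close>; hence the
    sign.\<close>
  have kR: "real (q - 1) * R = of_int (- k)"
  proof -
    have "w j = - w a2" unfolding assms(12) by (simp add: w_divide[OF a2_nonzero] w_mult w_power red(1))
    then show ?thesis using assms(13) w_a2 by simp
  qed
  have u0: "u \<noteq> 0" using assms(16) by auto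
  \<comment> \<open>An irreducible polynomial is neither zero nor a unit, so it is not
    constant.\<close>
  have d0: "0 < d"
  proof (rule ccontr)
    assume "\<not> 0 < d"
    then obtain c where c: "u = [:c:]" using assms(17) by (metis degree_eq_zeroE neq0_conv)
    then have "u dvd 1" using u0 by (simp add: is_unit_const_poly_iff dvd_field_iff)
    then show False using assms(16) by (simp add: Factorial_Ring.irreducible_def)
  qed
  interpret tate_ramification w ?\<gamma> p m q K \<psi> b1 \<Lambda> \<omega>20 \<pi> R e "\<phi> [:0, 1:]" a1 a2 "u ^ n" "n * d" \<omega>2 "- k"
  proof
    show "w (?\<gamma> (u ^ n)) = 0" by (simp add: \<gamma>_power w_power assms(18))
    show "Polynomial.degree (u ^ n) = n * d" using u0 assms(17) by (simp add: degree_power_eq)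
    show "act (u ^ n) \<omega>2 = \<omega>20" using assms(21) by simp
  qed (use completion_values[OF assms(5-7)] assms(14,19) d0 kR in auto)
  have Ln: "Ln = local.Ln" unfolding assms(22,23) by (rule Ln_eq)
  have LT: "field_adjoin L (torsion \<psi> (u ^ n)) = LT" unfolding assms(22) LT_def ..
  have E: "E = E0" unfolding assms(22,25) by (rule ram_index_L)
  have "R = - of_int k / (real q - 1)" using kR q_ge_2 by (simp add: of_nat_diff field_simps)
  then show ?thesis
    unfolding LT unfolding Ln E Q_def[symmetric]
    using Ln_galois J_iso herbrand_psi_Ln by blast
qed

end
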